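(* Let $X\in U_{\ge0}$. Then $X$ has a factorization of the form $$X=ZYW,\qquad Z=\prod_{i=1}^{\infty}N(a^{(i)}_1,\dots,a^{(i)}_n),\qquad W=\prod_{i=-\infty}^{-1}M(b^{(i)}_1,\dots,b^{(i)}_n),$$ where all the curls $N(a^{(i)}_1,\dots,a^{(i)}_n)$ and whirls $M(b^{(i)}_1,\dots,b^{(i)}_n)$ are either non-degenerate or the identity matrix, the parameters satisfy $\sum_{i,j}a^{(i)}_j+\sum_{i,j}b^{(i)}_j<\infty$, and $Y\in U_{\ge0}$ is doubly entire. This factorization is unique, in the sense that the matrices $Z$, $Y$, $W$ are uniquely determined by $X$.
   Context: Fix $n\ge1$. $GL_n(\mathbb{R}((t)))$ is the group of $n\times n$ matrices $A(t)=(a_{ij}(t))$ over the field of formal Laurent series with non-zero determinant. $A(t)$ is identified with its unfolding $X=(x_{i,j})_{i,j\in\mathbb{Z}}$, the doubly infinite real matrix with $x_{i+n,j+n}=x_{i,j}$ and $a_{ij}(t)=\sum_{k\in\mathbb{Z}}x_{i,j+kn}t^k$ for $1\le i,j\le n$; $A(t)$ is called the folding of $X$. $X$ is totally nonnegative if all finite minors of $X$ are nonnegative. $U$ is the subgroup of matrices $X$ that are upper triangular with $1$'s on the diagonal, and $U_{\ge0}$ is the set of totally nonnegative elements of $U$. The whirl $M(a_1,\dots,a_n)$ has $m_{i,i}=1$, $m_{i,i+1}=a_i$ (index modulo $n$), other entries $0$. The curl $N(a_1,\dots,a_n)$ is upper triangular with $1$'s on the diagonal and $(i,j)$ entry $a_ia_{i+1}\cdots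 a_{j-1}$ for $i<j$ (indices modulo $n$). Parameters here are nonnegative; a whirl or curl is non-degenerate if all its parameters are strictly positive. Limits of matrices are entrywise; $\prod_{i=1}^\infty X^{(i)}=\lim_{k\to\infty}X^{(1)}X^{(2)}\cdots X^{(k)}$ and $\prod_{i=-\infty}^{-1}X^{(i)}=\lim_{k\to-\infty}X^{(k)}X^{(k+1)}\cdots X^{(-1)}$ (with summable nonnegative parameters these limits exist for whirls and curls). $X\in U$ is entire if all $n^2$ entries of its folding are entire functions of $t$; $X$ is doubly entire if both $X$ and $X^{-1}$ are entire. *)

theory Defs
  imports
    "Jordan_Normal_Form.Determinant"
    "HOL-Computational_Algebra.Formal_Laurent_Series"
    "HOL-Complex_Analysis.Complex_Analysis"
begin

type_synonym bimat = "int \<Rightarrow> int \<Rightarrow> real"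

definition bi_id :: bimat where
  "bi_id = (\<lambda>i j. if i = j then 1 else 0)"

text \<open>
  The sum runs over the indices that contribute. For unfoldings of matrices over
  formal Laurent series this index set is finite, because rows vanish far to the left and
  (by periodicity) columns vanish far down.
\<close>
definition bi_mult :: "bimat \<Rightarrow> bimat \<Rightarrow> bimat" where
  "bi_mult X Y = (\<lambda>i j. \<Sum>k\<in>{k. X i k \<noteq> 0 \<and> Y k j \<noteq> 0}. X i k * Y k j)"

text \<open>
  Row and column indices of \<open>mat\<close> start at 0, those of the folding at 1, whence the shift.
  The term \<open>Abs_fls\<close> is meaningful only if the coefficient function vanishes at almost all
  negative indices, which is the second condition on membership in \<open>GL_unfolded\<close>.
\<close>
definition folding :: "nat \<Rightarrow> bimat \<Rightarrow> real fls mat" where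
  "folding n X = Matrix.mat n n (\<lambda>(i, j).
     Abs_fls (\<lambda>k. X (int i + 1) (int j + 1 + k * int n)))"

definition GL_unfolded :: "nat \<Rightarrow> bimat set" where
  "GL_unfolded n = {X.
     (\<forall>i j. X (i + int n) (j + int n) = X i j) \<and>
     (\<forall>i j. \<forall>\<^sub>\<infinity>k::nat. X i (j - int k * int n) = 0) \<and>
     Determinant.det (folding n X) \<noteq> 0}"

definition totally_nonneg :: "bimat \<Rightarrow> bool" where
  "totally_nonneg X \<longleftrightarrow>
     (\<forall>m (r :: nat \<Rightarrow> int) (c :: nat \<Rightarrow> int).
        strict_mono_on {..<m} r \<longrightarrow> strict_mono_on {..<m} c \<longrightarrow>
        Determinant.det (Matrix.mat m m (\<lambda>(p, q). X (r p) (c q))) \<ge> 0)"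

definition U_group :: "nat \<Rightarrow> bimat set" where
  "U_group n = {X \<in> GL_unfolded n. (\<forall>i. X i i = 1) \<and> (\<forall>i j. j < i \<longrightarrow> X i j = 0)}"

definition U_nonneg :: "nat \<Rightarrow> bimat set" where
  "U_nonneg n = {X \<in> U_group n. totally_nonneg X}"

text \<open>The representative of \<open>i\<close> modulo \<open>n\<close> in \<open>{1..n}\<close>.\<close>
definition cyc :: "nat \<Rightarrow> int \<Rightarrow> nat" where
  "cyc n i = nat ((i - 1) mod int n) + 1"

definition whirl :: "nat \<Rightarrow> (nat \<Rightarrow> real) \<Rightarrow> bimat" where
  "whirl n a = (\<lambda>i j. if j = i then 1 else if j = i + 1 then a (cyc n i) else 0)"

definition curl :: "nat \<Rightarrow> (nat \<Rightarrow> real) \<Rightarrow> bimat" where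
  "curl n a = (\<lambda>i j. if j < i then 0 else \<Prod>k\<in>{i..<j}. a (cyc n k))"

definition nondegenerate :: "nat \<Rightarrow> (nat \<Rightarrow> real) \<Rightarrow> bool" where
  "nondegenerate n a \<longleftrightarrow> (\<forall>j\<in>{1..n}. a j > 0)"

definition entrywise_lim :: "(nat \<Rightarrow> bimat) \<Rightarrow> bimat \<Rightarrow> bool" where
  "entrywise_lim P X \<longleftrightarrow> (\<forall>i j. (\<lambda>k. P k i j) \<longlonglongrightarrow> X i j)"

text \<open>\<open>F 1 * F 2 * \<dots> * F k\<close>\<close>
primrec right_partial_prod :: "(nat \<Rightarrow> bimat) \<Rightarrow> nat \<Rightarrow> bimat" where
  "right_partial_prod F 0 = bi_id"
| "right_partial_prod F (Suc k) = bi_mult (right_partial_prod F k) (F (Suc k))"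

text \<open>\<open>F (- k) * \<dots> * F (- 2) * F (- 1)\<close>\<close>
primrec left_partial_prod :: "(int \<Rightarrow> bimat) \<Rightarrow> nat \<Rightarrow> bimat" where
  "left_partial_prod F 0 = bi_id"
| "left_partial_prod F (Suc k) = bi_mult (F (- int (Suc k))) (left_partial_prod F k)"

definition is_right_inf_prod :: "(nat \<Rightarrow> bimat) \<Rightarrow> bimat \<Rightarrow> bool" where
  "is_right_inf_prod F X \<longleftrightarrow> entrywise_lim (right_partial_prod F) X"

definition is_left_inf_prod :: "(int \<Rightarrow> bimat) \<Rightarrow> bimat \<Rightarrow> bool" where
  "is_left_inf_prod F X \<longleftrightarrow> entrywise_lim (left_partial_prod F) X"

text \<open>
  A real formal Laurent series is an entire function of \<open>t\<close> if it has no polar part and is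
  the power series at 0 of a function holomorphic on the whole complex plane.
\<close>
definition entire_fls :: "real fls \<Rightarrow> bool" where
  "entire_fls f \<longleftrightarrow>
     (\<forall>k<0. fls_nth f k = 0) \<and>
     (\<exists>F. F holomorphic_on (UNIV :: complex set) \<and>
          (\<forall>z. (\<lambda>k. complex_of_real (fls_nth f (int k)) * z ^ k) sums F z))"

definition entire :: "nat \<Rightarrow> bimat \<Rightarrow> bool" where
  "entire n X \<longleftrightarrow> (\<forall>i<n. \<forall>j<n. entire_fls (folding n X $$ (i, j)))"

definition doubly_entire :: "nat \<Rightarrow> bimat \<Rightarrow> bool" where
  "doubly_entire n X \<longleftrightarrow> entire n X \<and>
     (\<exists>X'\<in>GL_unfolded n. bi_mult X X' = bi_id \<and> bi_mult X' X = bi_id \<and> entire n X')"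

definition curl_whirl_factorization ::
  "nat \<Rightarrow> bimat \<Rightarrow> bimat \<Rightarrow> bimat \<Rightarrow> bimat \<Rightarrow> bool" where
  "curl_whirl_factorization n X Z Y W \<longleftrightarrow>
     X = bi_mult (bi_mult Z Y) W \<and>
     Y \<in> U_nonneg n \<and> doubly_entire n Y \<and>
     (\<exists>(a :: nat \<Rightarrow> nat \<Rightarrow> real) (b :: int \<Rightarrow> nat \<Rightarrow> real).
        (\<forall>i\<ge>1. \<forall>j\<in>{1..n}. a i j \<ge> 0) \<and>
        (\<forall>i\<le>-1. \<forall>j\<in>{1..n}. b i j \<ge> 0) \<and>
        (\<forall>i\<ge>1. nondegenerate n (a i) \<or> curl n (a i) = bi_id) \<and>
        (\<forall>i\<le>-1. nondegenerate n (b i) \<or> whirl n (b i) = bi_id) \<and>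
        (\<lambda>(i, j). a i j) summable_on ({1..} \<times> {1..n}) \<and>
        (\<lambda>(i, j). b i j) summable_on ({..-1} \<times> {1..n}) \<and>
        is_right_inf_prod (\<lambda>i. curl n (a i)) Z \<and>
        is_left_inf_prod (\<lambda>i. whirl n (b i)) W)"

end

theory Submission
  imports Defs
begin

text \<open>
  Let \<open>X\<close> be periodic, upper unitriangular and totally nonnegative. Nonnegativity of the \<open>2 \<times> 2\<close> minors makes the
  ratio of the entries \<open>(i, j)\<close> and \<open>(i + 1, j)\<close> decrease in \<open>j\<close>. If \<open>X\<close> is not entire, the limits
  \<open>\<epsilon>\<^sub>i\<close> of these ratios are positive, and the curl with parameters \<open>\<epsilon>\<^sub>i\<close> can be divided off on the left of
  \<open>X\<close>, leaving a quotient that is again totally nonnegative (\<open>strip_curl_tnn\<close>). The reason is that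
  the division is a Neville elimination (\<open>tnn_eliminate\<close>): it clears a virtual column at infinity,
  whose entries are in the ratios \<open>\<epsilon>\<^sub>i\<close>. If \<open>X\<close> is entire, nothing is divided off.

  Iteration gives an entrywise decreasing sequence of quotients. Superdiagonal entries of
  unitriangular matrices add under multiplication, so the parameters of the curls are summable and in
  particular tend to \<open>0\<close>; as they govern the growth of the entries, the limit \<open>Q\<close> of the quotients, the
  curl-free part of \<open>X\<close>, is entire. Thus \<open>X = Z Q\<close> with \<open>Z\<close> a product of curls. Passing to the inverse
  with alternating signs (\<open>dual\<close>) reverses products, exchanges curls and whirls and preserves total
  nonnegativity. The same procedure applied to the dual of \<open>Q\<close> therefore gives \<open>Q = Y W\<close>, where \<open>W\<close> is
  a product of whirls and the inverse of \<open>Y\<close> is entire; \<open>Y\<close> itself is entire because it lies below \<open>Q\<close>.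

  Uniqueness cannot be read off factor by factor, because curls can be moved past each other by
  changing their parameters. Instead one shows that the curl-free part of \<open>X\<close> does not change if
  \<open>X\<close> is multiplied by a non-degenerate curl on the left (\<open>curl_free_part_icurl_mult\<close>), and that it
  is multiplied by \<open>Q\<close> if \<open>X\<close> is multiplied by an entire \<open>Q\<close> on the right
  (\<open>curl_free_part_mult_entire\<close>). So a convergent product \<open>Z\<close> of curls has the same curl-free part as
  each of its tails. That part lies below the tails, which tend to the identity, so it is the identity.
  Hence \<open>X = Z Q\<close> with \<open>Q\<close> entire forces \<open>Q\<close> to be the curl-free part of \<open>X\<close>. Applied to \<open>X\<close> and then to
  the dual of \<open>Q = Y W\<close>, this determines \<open>Z\<close>, \<open>Y\<close> and \<open>W\<close>.
\<close>

section \<open>Minors as lists of rows and columns\<close>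

text \<open>
  Rows are functions of the column index and need not belong to one matrix, so a row of a minor can be
  exchanged for a linear combination of others without leaving this format.
\<close>

definition rows_minor :: "(int \<Rightarrow> real) list \<Rightarrow> int list \<Rightarrow> real" where
  "rows_minor fs cs = Determinant.det (Matrix.mat (length fs) (length fs) (\<lambda>(p, q). (fs ! p) (cs ! q)))"

lemma rows_minor_cong:
  assumes "length fs = length gs" "length cs = length fs" "length ds = length fs"
    and "\<And>p q. p < length fs \<Longrightarrow> q < length fs \<Longrightarrow> (fs ! p) (cs ! q) = (gs ! p) (ds ! q)"
  shows "rows_minor fs cs = rows_minor gs ds"
proof -
  have "Matrix.mat (length fs) (length fs) (\<lambda>(p, q). (fs ! p) (cs ! q)) =
        Matrix.mat (length gs) (length gs) (\<lambda>(p, q). (gs ! p) (ds ! q))"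
    by (rule eq_matI) (use assms in auto)
  then show ?thesis by (simp add: rows_minor_def)
qed

definition del_nth :: "nat \<Rightarrow> 'a list \<Rightarrow> 'a list" where
  "del_nth k xs = take k xs @ drop (Suc k) xs"

lemma length_del_nth [simp]: "k < length xs \<Longrightarrow> length (del_nth k xs) = length xs - 1"
  by (simp add: del_nth_def)

lemma set_del_nth: "set (del_nth k xs) \<subseteq> set xs"
  by (auto simp: del_nth_def dest: in_set_takeD in_set_dropD)

lemma sorted_del_nth: "sorted_wrt R xs \<Longrightarrow> sorted_wrt R (del_nth k xs)"
proof -
  assume a: "sorted_wrt R xs"
  have "sorted_wrt R (take k xs @ drop k xs)" using a by simp
  moreover have "drop (Suc k) xs = tl (drop k xs)" by (simp add: drop_Suc tl_drop)
  ultimately show ?thesis unfolding del_nth_def sorted_wrt_append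
    by (metis (no_types, lifting) a append_take_drop_id in_set_dropD in_set_takeD list.set_sel(2) sorted_wrt_append sorted_wrt_drop tl_Nil)
qed

lemma rows_minor_expand_row:
  assumes "length cs = Suc (length R1 + length R2)"
  shows "rows_minor (R1 @ x # R2) cs =
    (\<Sum>k<length cs. x (cs ! k) * ((-1) ^ (length R1 + k) * rows_minor (R1 @ R2) (del_nth k cs)))"
proof -
  let ?f = "R1 @ x # R2"
  let ?M = "Matrix.mat (length ?f) (length ?f) (\<lambda>(p, q). (?f ! p) (cs ! q))"
  have M: "?M \<in> carrier_mat (length cs) (length cs)" using assms by simp
  have "Determinant.det ?M = (\<Sum>k<length cs. ?M $$ (length R1, k) * cofactor ?M (length R1) k)"
    by (rule laplace_expansion_row[OF M]) (use assms in simp)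
  also have "\<dots> = (\<Sum>k<length cs. x (cs ! k) * ((-1) ^ (length R1 + k) * rows_minor (R1 @ R2) (del_nth k cs)))"
  proof (rule sum.cong[OF refl])
    fix k assume k: "k \<in> {..<length cs}"
    have "mat_delete ?M (length R1) k =
      Matrix.mat (length (R1 @ R2)) (length (R1 @ R2)) (\<lambda>(p, q). ((R1 @ R2) ! p) (del_nth k cs ! q))"
      by (rule eq_matI) (use assms k in \<open>auto simp: mat_delete_def del_nth_def nth_append min_def Suc_diff_le\<close>)
    then show "?M $$ (length R1, k) * cofactor ?M (length R1) k =
        x (cs ! k) * ((-1) ^ (length R1 + k) * rows_minor (R1 @ R2) (del_nth k cs))"
      using k assms by (simp add: cofactor_def rows_minor_def)
  qed
  finally show ?thesis by (simp add: rows_minor_def)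
qed

lemma rows_minor_row_sum:
  assumes "length cs = Suc (length R1 + length R2)" "finite K"
    and "\<And>c. c \<in> set cs \<Longrightarrow> x c = (\<Sum>k\<in>K. g k * y k c)"
  shows "rows_minor (R1 @ x # R2) cs = (\<Sum>k\<in>K. g k * rows_minor (R1 @ y k # R2) cs)"
proof -
  let ?c = "\<lambda>q. (-1) ^ (length R1 + q) * rows_minor (R1 @ R2) (del_nth q cs)"
  have "rows_minor (R1 @ x # R2) cs = (\<Sum>q<length cs. (\<Sum>k\<in>K. g k * y k (cs ! q)) * ?c q)"
    unfolding rows_minor_expand_row[OF assms(1)] by (rule sum.cong) (use assms(3) in auto)
  also have "\<dots> = (\<Sum>q<length cs. \<Sum>k\<in>K. g k * (y k (cs ! q) * ?c q))"
    by (simp add: sum_distrib_right mult.assoc)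
  also have "\<dots> = (\<Sum>k\<in>K. g k * (\<Sum>q<length cs. y k (cs ! q) * ?c q))"
    by (subst sum.swap) (simp add: sum_distrib_left)
  finally show ?thesis by (simp add: rows_minor_expand_row[OF assms(1)])
qed

lemma rows_minor_row_comb:
  assumes "length cs = Suc (length R1 + length R2)"
    and "\<And>c. c \<in> set cs \<Longrightarrow> x c = y c + b * z c"
  shows "rows_minor (R1 @ x # R2) cs = rows_minor (R1 @ y # R2) cs + b * rows_minor (R1 @ z # R2) cs"
  unfolding rows_minor_expand_row[OF assms(1)] sum_distrib_left sum.distrib[symmetric]
  by (rule sum.cong) (use assms(2) in \<open>auto simp: algebra_simps\<close>)

lemma rows_minor_row_zero:
  assumes "length cs = Suc (length R1 + length R2)" and "\<And>c. c \<in> set cs \<Longrightarrow> x c = 0"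
  shows "rows_minor (R1 @ x # R2) cs = 0"
  unfolding rows_minor_expand_row[OF assms(1)] by (rule sum.neutral) (use assms(2) in auto)

lemma rows_minor_repeat:
  assumes "length cs = length fs" "i < length fs" "j < length fs" "i \<noteq> j" "fs ! i = fs ! j"
  shows "rows_minor fs cs = 0"
  unfolding rows_minor_def
  by (rule Determinant.det_identical_rows[where n="length fs" and i=i and j=j]) (use assms in \<open>auto simp: Matrix.row_def\<close>)

lemma rows_minor_repeat_in:
  assumes "length cs = Suc (length R1 + length R2)" "x \<in> set R1 \<union> set R2"
  shows "rows_minor (R1 @ x # R2) cs = 0"
proof -
  from assms(2) consider k where "k < length R1" "R1 ! k = x" | k where "k < length R2" "R2 ! k = x"
    by (auto simp: in_set_conv_nth)
  then show ?thesis
  proof cases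
    case 1 then show ?thesis
      by (intro rows_minor_repeat[where i=k and j="length R1"]) (use assms in \<open>auto simp: nth_append\<close>)
  next
    case 2 then show ?thesis
      by (intro rows_minor_repeat[where i="Suc (length R1 + k)" and j="length R1"])
        (use assms in \<open>auto simp: nth_append\<close>)
  qed
qed

lemma rows_minor_swap:
  assumes "length cs = Suc (Suc (length R1 + length R2))"
  shows "rows_minor (R1 @ x # y # R2) cs = - rows_minor (R1 @ y # x # R2) cs"
proof -
  let ?s = "\<lambda>c. x c + 1 * y c"
  have 1: "length cs = Suc (length R1 + length (u # R2))" for u :: "int \<Rightarrow> real" using assms by simp
  have 2: "length cs = Suc (length (R1 @ [u]) + length R2)" for u :: "int \<Rightarrow> real" using assms by simp
  have "0 = rows_minor (R1 @ ?s # ?s # R2) cs"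
    by (rule rows_minor_repeat_in[symmetric]) (use assms in auto)
  also have "\<dots> = rows_minor (R1 @ x # ?s # R2) cs + rows_minor (R1 @ y # ?s # R2) cs"
    using rows_minor_row_comb[OF 1, of ?s x 1 y ?s] by simp
  also have "rows_minor (R1 @ x # ?s # R2) cs = rows_minor (R1 @ x # x # R2) cs + rows_minor (R1 @ x # y # R2) cs"
    using rows_minor_row_comb[OF 2, of ?s x 1 y x] by simp
  also have "rows_minor (R1 @ y # ?s # R2) cs = rows_minor (R1 @ y # x # R2) cs + rows_minor (R1 @ y # y # R2) cs"
    using rows_minor_row_comb[OF 2, of ?s x 1 y y] by simp
  also have "rows_minor (R1 @ x # x # R2) cs = 0" by (rule rows_minor_repeat_in) (use assms in auto)
  also have "rows_minor (R1 @ y # y # R2) cs = 0" by (rule rows_minor_repeat_in) (use assms in auto)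
  finally show ?thesis by simp
qed

lemma rows_minor_transpose:
  assumes "length rs = length cs"
  shows "rows_minor (map A rs) cs = rows_minor (map (\<lambda>j i. A i j) cs) rs"
proof -
  let ?M = "Matrix.mat (length rs) (length rs) (\<lambda>(p, q). A (rs ! p) (cs ! q))"
  have "rows_minor (map A rs) cs = Determinant.det ?M"
    unfolding rows_minor_def by (rule arg_cong[where f=Determinant.det]) (rule eq_matI, auto)
  also have "\<dots> = Determinant.det (transpose_mat ?M)"
    by (rule Determinant.det_transpose[symmetric, where n="length rs"]) simp
  also have "transpose_mat ?M = Matrix.mat (length rs) (length rs) (\<lambda>(p, q). (map (\<lambda>j i. A i j) cs ! p) (rs ! q))"
    by (rule eq_matI) (use assms in auto)
  finally show ?thesis using assms by (simp add: rows_minor_def)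
qed

text \<open>
  Cramer's rule: the coefficients come from the adjugate matrix.
\<close>

lemma rows_minor_row_span:
  assumes "length cs = length B" "rows_minor B cs \<noteq> 0"
  shows "\<exists>g. \<forall>c\<in>set cs. x c = (\<Sum>k<length B. g k * (B ! k) c)"
proof -
  let ?m = "length B"
  let ?M = "Matrix.mat ?m ?m (\<lambda>(p, q). (B ! p) (cs ! q))"
  let ?d = "Determinant.det ?M"
  have M: "?M \<in> carrier_mat ?m ?m" by simp
  note ad = adj_mat[OF M]
  define g where "g k = (\<Sum>p<?m. x (cs ! p) * adj_mat ?M $$ (p, k)) / ?d" for k
  have d: "?d \<noteq> 0" using assms(2) by (simp add: rows_minor_def)
  have inv: "(\<Sum>k<?m. adj_mat ?M $$ (p, k) * (B ! k) (cs ! q)) = (if p = q then ?d else 0)"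
    if "p < ?m" "q < ?m" for p q
  proof -
    have "(adj_mat ?M * ?M) $$ (p, q) = (\<Sum>k<?m. adj_mat ?M $$ (p, k) * (B ! k) (cs ! q))"
      using that ad(1) by (simp add: scalar_prod_def atLeast0LessThan)
    then show ?thesis using ad(3) that by (auto simp del: index_mult_mat split: if_splits)
  qed
  have "x (cs ! q) = (\<Sum>k<?m. g k * (B ! k) (cs ! q))" if q: "q < ?m" for q
  proof -
    have "(\<Sum>k<?m. g k * (B ! k) (cs ! q)) =
       (\<Sum>k<?m. \<Sum>p<?m. x (cs ! p) * (adj_mat ?M $$ (p, k) * (B ! k) (cs ! q)) / ?d)"
      by (simp add: g_def sum_divide_distrib sum_distrib_right mult.assoc)
    also have "\<dots> = (\<Sum>p<?m. x (cs ! p) * (\<Sum>k<?m. adj_mat ?M $$ (p, k) * (B ! k) (cs ! q)) / ?d)"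
      by (subst sum.swap) (simp add: sum_divide_distrib sum_distrib_left)
    also have "\<dots> = (\<Sum>p<?m. if p = q then x (cs ! p) else 0)"
      by (rule sum.cong) (use inv q d in auto)
    also have "\<dots> = x (cs ! q)" using q by simp
    finally show ?thesis by simp
  qed
  then have "\<forall>c\<in>set cs. x c = (\<Sum>k<?m. g k * (B ! k) c)" using assms(1) by (metis in_set_conv_nth)
  then show ?thesis by blast
qed

lemma rows_minor_expand_last:
  assumes "length cs = length fs"
    and "\<And>f. f \<in> set fs \<Longrightarrow> f l = 0"
  shows "rows_minor (fs @ [x]) (cs @ [l]) = x l * rows_minor fs cs"
proof -
  let ?M = "Matrix.mat (Suc (length fs)) (Suc (length fs)) (\<lambda>(p, q). ((fs @ [x]) ! p) ((cs @ [l]) ! q))"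
  have M: "?M \<in> carrier_mat (Suc (length fs)) (Suc (length fs))" by simp
  have z: "(\<Sum>i<length fs. ?M $$ (i, length fs) * cofactor ?M i (length fs)) = 0"
    by (rule sum.neutral) (use assms in \<open>auto simp: nth_append\<close>)
  have "rows_minor (fs @ [x]) (cs @ [l]) = Determinant.det ?M" by (simp add: rows_minor_def)
  also have "\<dots> = (\<Sum>i<Suc (length fs). ?M $$ (i, length fs) * cofactor ?M i (length fs))"
    by (rule laplace_expansion_column[OF M]) simp
  also have "\<dots> = x l * cofactor ?M (length fs) (length fs)"
    unfolding sum.lessThan_Suc z using assms(1) by (simp add: nth_append)
  also have "mat_delete ?M (length fs) (length fs) = Matrix.mat (length fs) (length fs) (\<lambda>(p, q). (fs ! p) (cs ! q))"
    by (rule eq_matI) (use assms in \<open>auto simp: mat_delete_def nth_append\<close>)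
  then have "cofactor ?M (length fs) (length fs) = rows_minor fs cs" by (simp add: cofactor_def rows_minor_def)
  finally show ?thesis .
qed

lemma tendsto_rows_minor:
  assumes "length fs = m" "length cs = m" "\<And>k. length (G k) = m"
    and "\<And>p c. p < m \<Longrightarrow> c \<in> set cs \<Longrightarrow> ((\<lambda>k. (G k ! p) c) \<longlongrightarrow> (fs ! p) c) F"
  shows "((\<lambda>k. rows_minor (G k) cs) \<longlongrightarrow> rows_minor fs cs) F"
proof -
  have pl: "p i < m" if "p permutes {0..<m}" "i < m" for p i
    using permutes_in_image[OF that(1), of i] that(2) by simp
  have L: "rows_minor gs cs = (\<Sum>p\<in>{p. p permutes {0..<m}}. signof p * (\<Prod>i = 0..<m. (gs ! i) (cs ! p i)))"
    if "length gs = m" for gs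
  proof -
    have "rows_minor gs cs = (\<Sum>p\<in>{p. p permutes {0..<m}}. signof p *
        (\<Prod>i = 0..<m. Matrix.mat m m (\<lambda>(p, q). (gs ! p) (cs ! q)) $$ (i, p i)))"
      unfolding rows_minor_def that by (rule det_def') simp
    also have "\<dots> = (\<Sum>p\<in>{p. p permutes {0..<m}}. signof p * (\<Prod>i = 0..<m. (gs ! i) (cs ! p i)))"
      by (intro sum.cong prod.cong arg_cong2[where f="(*)"] refl) (auto simp: pl)
    finally show ?thesis .
  qed
  show ?thesis
    unfolding L[OF assms(1)] L[OF assms(3)]
    by (intro tendsto_sum tendsto_mult tendsto_const tendsto_prod assms(4))
      (use assms(2) pl in \<open>auto intro!: nth_mem\<close>)
qed

section \<open>Total nonnegativity on a window, and elimination\<close>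

text \<open>
  Rows and columns are restricted because an elimination preserves total nonnegativity only on the
  columns up to the one that is cleared.
\<close>

definition tnn_on :: "int set \<Rightarrow> int set \<Rightarrow> (int \<Rightarrow> int \<Rightarrow> real) \<Rightarrow> bool" where
  "tnn_on R C A \<longleftrightarrow> (\<forall>rs cs. sorted_wrt (<) rs \<longrightarrow> sorted_wrt (<) cs \<longrightarrow> set rs \<subseteq> R \<longrightarrow> set cs \<subseteq> C \<longrightarrow>
     length rs = length cs \<longrightarrow> 0 \<le> rows_minor (map A rs) cs)"

lemma tnnI:
  "(\<And>rs cs. sorted_wrt (<) rs \<Longrightarrow> sorted_wrt (<) cs \<Longrightarrow> set rs \<subseteq> R \<Longrightarrow> set cs \<subseteq> C \<Longrightarrow>
     length rs = length cs \<Longrightarrow> 0 \<le> rows_minor (map A rs) cs) \<Longrightarrow> tnn_on R C A"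
  by (simp add: tnn_on_def)

lemma tnnD:
  "tnn_on R C A \<Longrightarrow> sorted_wrt (<) rs \<Longrightarrow> sorted_wrt (<) cs \<Longrightarrow> set rs \<subseteq> R \<Longrightarrow> set cs \<subseteq> C \<Longrightarrow>
     length rs = length cs \<Longrightarrow> 0 \<le> rows_minor (map A rs) cs"
  by (simp add: tnn_on_def)

lemma rows_minor_map_cong:
  assumes "length rs = length cs" "\<And>r c. r \<in> set rs \<Longrightarrow> c \<in> set cs \<Longrightarrow> A r c = B r c"
  shows "rows_minor (map A rs) cs = rows_minor (map B rs) cs"
  by (rule rows_minor_cong) (use assms in auto)

lemma tnn_cong:
  assumes "tnn_on R C A" "\<And>r c. r \<in> R \<Longrightarrow> c \<in> C \<Longrightarrow> A r c = B r c"
  shows "tnn_on R C B"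
proof (rule tnnI)
  fix rs cs assume *: "sorted_wrt (<) rs" "sorted_wrt (<) cs" "set rs \<subseteq> R" "set cs \<subseteq> C" "length rs = length cs"
  have "rows_minor (map B rs) cs = rows_minor (map A rs) cs"
    by (rule rows_minor_map_cong) (use * assms(2) in \<open>auto simp: subset_iff\<close>)
  then show "0 \<le> rows_minor (map B rs) cs" using tnnD[OF assms(1) *] by simp
qed

lemma tnn_subset: "tnn_on R C A \<Longrightarrow> R' \<subseteq> R \<Longrightarrow> C' \<subseteq> C \<Longrightarrow> tnn_on R' C' A"
  by (meson order_trans tnn_on_def)

lemma tnn_transpose: "tnn_on R C A \<Longrightarrow> tnn_on C R (\<lambda>j i. A i j)"
  unfolding tnn_on_def by (metis (no_types, lifting) rows_minor_transpose)

lemma tnn_limit: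
  assumes "F \<noteq> bot" "eventually (\<lambda>k. tnn_on R C (G k)) F"
    and "\<And>r c. r \<in> R \<Longrightarrow> c \<in> C \<Longrightarrow> ((\<lambda>k. G k r c) \<longlongrightarrow> A r c) F"
  shows "tnn_on R C A"
proof (rule tnnI)
  fix rs cs assume *: "sorted_wrt (<) rs" "sorted_wrt (<) cs" "set rs \<subseteq> R" "set cs \<subseteq> C" "length rs = length cs"
  have "((\<lambda>k. rows_minor (map (G k) rs) cs) \<longlongrightarrow> rows_minor (map A rs) cs) F"
    by (rule tendsto_rows_minor[where m="length cs"]) (use * assms(3) in \<open>auto simp: subset_iff\<close>)
  moreover have "eventually (\<lambda>k. 0 \<le> rows_minor (map (G k) rs) cs) F"
    using assms(2) by eventually_elim (use * tnnD in blast)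
  ultimately show "0 \<le> rows_minor (map A rs) cs"
    using assms(1) by (rule tendsto_lowerbound)
qed

lemma rows_minor_Nil [simp]: "rows_minor [] [] = 1"
  by (simp add: rows_minor_def)

lemma rows_minor_single [simp]: "rows_minor [f] [c] = f c"
  using rows_minor_expand_last[of "[]" "[]" c f] by simp

lemma rows_minor_two: "rows_minor [f, g] [c, d] = f c * g d - f d * g c"
  using rows_minor_expand_row[of "[c, d]" "[]" "[g]" f] by (simp add: del_nth_def eval_nat_numeral)

lemma tnn_entry: "tnn_on R C A \<Longrightarrow> r \<in> R \<Longrightarrow> c \<in> C \<Longrightarrow> 0 \<le> A r c"
  using tnnD[of R C A "[r]" "[c]"] by simp

lemma tnn_two:
  "tnn_on R C A \<Longrightarrow> r \<in> R \<Longrightarrow> r' \<in> R \<Longrightarrow> c \<in> C \<Longrightarrow> c' \<in> C \<Longrightarrow> r < r' \<Longrightarrow> c < c' \<Longrightarrow>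
    A r c' * A r' c \<le> A r c * A r' c'"
  using tnnD[of R C A "[r, r']" "[c, c']"] by (simp add: rows_minor_two)

lemma sorted_split:
  assumes "sorted_wrt (<) (rs :: int list)" "i \<in> set rs"
  obtains R1 R2 where "rs = R1 @ i # R2" "\<And>r. r \<in> set R1 \<Longrightarrow> r < i" "\<And>r. r \<in> set R2 \<Longrightarrow> i < r"
    "sorted_wrt (<) R1" "sorted_wrt (<) R2"
proof -
  obtain R1 R2 where "rs = R1 @ i # R2" using assms(2) by (meson split_list)
  then show ?thesis using that assms(1) by (auto simp: sorted_wrt_append)
qed

text \<open>
  A minor that contains row \<open>i\<close> changes by \<open>b\<close> times the minor with \<open>i\<close> replaced by \<open>i'\<close>. No integer
  lies between \<open>i\<close> and \<open>i'\<close>, so the new list of rows is again increasing, unless it repeats a row.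
\<close>

lemma tnn_row_add:
  assumes "tnn_on R C A" "0 \<le> b" "i' \<in> R" "i' = i + 1 \<or> i' = i - 1"
    and "\<And>c. c \<in> C \<Longrightarrow> A' i c = A i c + b * A i' c"
    and "\<And>r c. r \<in> R \<Longrightarrow> r \<noteq> i \<Longrightarrow> c \<in> C \<Longrightarrow> A' r c = A r c"
  shows "tnn_on R C A'"
proof (rule tnnI)
  fix rs cs assume *: "sorted_wrt (<) rs" "sorted_wrt (<) cs" "set rs \<subseteq> R" "set cs \<subseteq> C" "length rs = length cs"
  show "0 \<le> rows_minor (map A' rs) cs"
  proof (cases "i \<in> set rs")
    case False
    then have "rows_minor (map A' rs) cs = rows_minor (map A rs) cs"
      by (intro rows_minor_map_cong) (use * assms(6) in \<open>auto simp: subset_iff\<close>)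
    then show ?thesis using tnnD[OF assms(1) *] by simp
  next
    case True
    then obtain R1 R2 where rs: "rs = R1 @ i # R2" "\<And>r. r \<in> set R1 \<Longrightarrow> r < i" "\<And>r. r \<in> set R2 \<Longrightarrow> i < r"
      "sorted_wrt (<) R1" "sorted_wrt (<) R2" using sorted_split[OF *(1)] by metis
    have len: "length cs = Suc (length (map A R1) + length (map A R2))" using * rs by simp
    have ni: "i \<notin> set R1" "i \<notin> set R2" using rs by auto
    have "rows_minor (map A' rs) cs = rows_minor (map (A(i := A' i)) rs) cs"
      by (intro rows_minor_map_cong) (use * assms(6) in \<open>auto simp: subset_iff\<close>)
    also have "\<dots> = rows_minor (map A R1 @ A' i # map A R2) cs" using ni by (simp add: rs)
    also have "\<dots> = rows_minor (map A R1 @ A i # map A R2) cs + b * rows_minor (map A R1 @ A i' # map A R2) cs"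
      by (rule rows_minor_row_comb[OF len]) (use assms(5) * in auto)
    also have "rows_minor (map A R1 @ A i # map A R2) cs = rows_minor (map A rs) cs" by (simp add: rs)
    finally have eq: "rows_minor (map A' rs) cs = rows_minor (map A rs) cs + b * rows_minor (map A R1 @ A i' # map A R2) cs" .
    have "0 \<le> rows_minor (map A R1 @ A i' # map A R2) cs"
    proof (cases "i' \<in> set rs")
      case True
      then have "A i' \<in> set (map A R1) \<union> set (map A R2)" using assms(4) rs by auto
      from rows_minor_repeat_in[OF len this] show ?thesis by simp
    next
      case False
      have s: "r < i'" if "r \<in> set R1" for r using rs(2)[OF that] False that assms(4) rs(1)
        by (cases "r = i'") auto
      have t: "i' < r" if "r \<in> set R2" for r using rs(3)[OF that] False that assms(4) rs(1)
        by (cases "r = i'") auto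
      have "sorted_wrt (<) (R1 @ i' # R2)" using rs s t by (fastforce simp: sorted_wrt_append)
      from tnnD[OF assms(1) this *(2) _ *(4)] show ?thesis using * rs assms(3) by simp
    qed
    then show ?thesis using eq tnnD[OF assms(1) *] assms(2) by simp
  qed
qed

lemma tnn_col_add:
  assumes "tnn_on R C A" "0 \<le> b" "j' \<in> C" "j' = j + 1 \<or> j' = j - 1"
    and "\<And>r. r \<in> R \<Longrightarrow> A' r j = A r j + b * A r j'"
    and "\<And>r c. c \<in> C \<Longrightarrow> c \<noteq> j \<Longrightarrow> r \<in> R \<Longrightarrow> A' r c = A r c"
  shows "tnn_on R C A'"
  using tnn_transpose[OF tnn_row_add[OF tnn_transpose[OF assms(1)] assms(2-4), of "\<lambda>c r. A' r c"]] assms(5,6)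
  by simp

lemma tnn_row_scale:
  assumes "tnn_on R C A" "0 \<le> b"
    and "\<And>c. c \<in> C \<Longrightarrow> A' i c = b * A i c"
    and "\<And>r c. r \<in> R \<Longrightarrow> r \<noteq> i \<Longrightarrow> c \<in> C \<Longrightarrow> A' r c = A r c"
  shows "tnn_on R C A'"
proof (rule tnnI)
  fix rs cs assume *: "sorted_wrt (<) rs" "sorted_wrt (<) cs" "set rs \<subseteq> R" "set cs \<subseteq> C" "length rs = length cs"
  show "0 \<le> rows_minor (map A' rs) cs"
  proof (cases "i \<in> set rs")
    case False
    then have "rows_minor (map A' rs) cs = rows_minor (map A rs) cs"
      by (intro rows_minor_map_cong) (use * assms(4) in \<open>auto simp: subset_iff\<close>)
    then show ?thesis using tnnD[OF assms(1) *] by simp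
  next
    case True
    then obtain R1 R2 where rs: "rs = R1 @ i # R2" "\<And>r. r \<in> set R1 \<Longrightarrow> r < i" "\<And>r. r \<in> set R2 \<Longrightarrow> i < r"
      "sorted_wrt (<) R1" "sorted_wrt (<) R2" using sorted_split[OF *(1)] by metis
    have len: "length cs = Suc (length (map A R1) + length (map A R2))" using * rs by simp
    have ni: "i \<notin> set R1" "i \<notin> set R2" using rs by auto
    have "rows_minor (map A' rs) cs = rows_minor (map (A(i := A' i)) rs) cs"
      by (intro rows_minor_map_cong) (use * assms(4) in \<open>auto simp: subset_iff\<close>)
    also have "\<dots> = rows_minor (map A R1 @ A' i # map A R2) cs" using ni by (simp add: rs)
    also have "\<dots> = rows_minor (map A R1 @ (\<lambda>_. 0) # map A R2) cs + b * rows_minor (map A R1 @ A i # map A R2) cs"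
      by (rule rows_minor_row_comb[OF len]) (use assms(3) * in auto)
    also have "rows_minor (map A R1 @ (\<lambda>_. 0) # map A R2) cs = 0"
      by (rule rows_minor_row_zero[OF len]) simp
    also have "map A R1 @ A i # map A R2 = map A rs" by (simp add: rs)
    finally show ?thesis using tnnD[OF assms(1) *] assms(2) by simp
  qed
qed

lemma tnn_col_scale:
  assumes "tnn_on R C A" "0 \<le> b"
    and "\<And>r. r \<in> R \<Longrightarrow> A' r j = b * A r j"
    and "\<And>r c. c \<in> C \<Longrightarrow> c \<noteq> j \<Longrightarrow> r \<in> R \<Longrightarrow> A' r c = A r c"
  shows "tnn_on R C A'"
  using tnn_transpose[OF tnn_row_scale[OF tnn_transpose[OF assms(1)] assms(2), of "\<lambda>c r. A' r c" j]] assms(3,4)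
  by simp

lemma tnn_col_relabel:
  assumes "tnn_on R C' A" "strict_mono_on C \<phi>" "\<phi> ` C \<subseteq> C'"
  shows "tnn_on R C (\<lambda>r c. A r (\<phi> c))"
proof (rule tnnI)
  fix rs cs assume *: "sorted_wrt (<) rs" "sorted_wrt (<) cs" "set rs \<subseteq> R" "set cs \<subseteq> C" "length rs = length cs"
  have "sorted_wrt (<) (map \<phi> cs)"
    unfolding sorted_wrt_map
    by (rule sorted_wrt_mono_rel[OF _ *(2)]) (use assms(2) *(4) in \<open>auto simp: strict_mono_on_def subset_iff\<close>)
  then have "0 \<le> rows_minor (map A rs) (map \<phi> cs)"
    by (intro tnnD[OF assms(1) *(1)]) (use * assms(3) in auto)
  also have "\<dots> = rows_minor (map (\<lambda>r c. A r (\<phi> c)) rs) cs"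
    by (rule rows_minor_cong) (use * in auto)
  finally show "0 \<le> rows_minor (map (\<lambda>r c. A r (\<phi> c)) rs) cs" .
qed

lemma sorted_last_max:
  assumes "sorted_wrt (<) (cs :: int list)" "l \<in> set cs" "\<And>c. c \<in> set cs \<Longrightarrow> c \<le> l"
  obtains cs' where "cs = cs' @ [l]" "sorted_wrt (<) cs'" "\<And>c. c \<in> set cs' \<Longrightarrow> c < l"
proof -
  obtain C1 C2 where c: "cs = C1 @ l # C2" "\<And>r. r \<in> set C1 \<Longrightarrow> r < l" "\<And>r. r \<in> set C2 \<Longrightarrow> l < r" "sorted_wrt (<) C1"
    using sorted_split[OF assms(1,2)] by metis
  have "C2 = []" using c(1,3) assms(3) by (cases C2) force+
  then show ?thesis using that c by auto
qed

text \<open>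
  One step of Neville elimination. Write \<open>x\<close> for the new row. Only the minors \<open>D(R1, x, R2)\<close> with
  \<open>b + 1\<close> not in \<open>R2\<close> need an argument, which goes by induction on \<open>R2\<close>. If \<open>R2\<close> is empty, then
  \<open>D(R1, x)\<close> times the entry \<open>(b + 1, l)\<close> is the minor on the rows \<open>R1, b, b + 1\<close> with the column \<open>l\<close>
  adjoined. If \<open>R2\<close> starts with \<open>s\<close>, expand \<open>x\<close> in the rows \<open>R1, b + 1, s, \<dots>\<close>, assuming that these have a
  positive minor. The coordinate of \<open>x\<close> at \<open>s\<close> is at most \<open>0\<close>, since \<open>D(R1, x, b + 1, \<dots>)\<close> is nonnegative and
  arises by exchanging \<open>s\<close> and \<open>b + 1\<close>. A smaller minor, known to be nonnegative by induction, then shows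
  that the coordinate at \<open>b + 1\<close> is nonnegative, and \<open>D(R1, x, s, \<dots>)\<close> is this coordinate times the positive minor.
\<close>

lemma tnn_eliminate:
  assumes A: "tnn_on R C A"
    and l: "l \<in> C" "\<And>c. c \<in> C \<Longrightarrow> c \<le> l"
    and b: "b \<in> R" "b + 1 \<in> R"
    and zero: "\<And>r. r \<in> R \<Longrightarrow> r < b \<Longrightarrow> A r l = 0"
    and e: "A b l = e * A (b + 1) l" and pos: "0 < A (b + 1) l"
  shows "tnn_on R C (A(b := \<lambda>c. A b c - e * A (b + 1) c))"
proof -
  define x where "x = (\<lambda>c. A b c - e * A (b + 1) c)"
  define y where "y = A (b + 1)"
  have xcomb: "rows_minor (f1 @ x # f2) cs = rows_minor (f1 @ A b # f2) cs - e * rows_minor (f1 @ y # f2) cs"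
    if "length cs = Suc (length f1 + length f2)" for f1 f2 cs
    using rows_minor_row_comb[OF that, of x "A b" "-e" y] by (simp add: x_def y_def)
  \<comment> \<open>Row \<open>b + 1\<close> is present, so subtracting a multiple of it does not change the minor.\<close>
  have both: "0 \<le> rows_minor (map A R1 @ x # y # map A R2) cs"
    if "sorted_wrt (<) (R1 @ b # (b + 1) # R2)" "set R1 \<subseteq> R" "set R2 \<subseteq> R" "sorted_wrt (<) cs" "set cs \<subseteq> C"
      "length cs = Suc (Suc (length R1 + length R2))" for R1 R2 cs
  proof -
    have "rows_minor (map A R1 @ y # y # map A R2) cs = 0"
      by (rule rows_minor_repeat_in) (use that in auto)
    then have "rows_minor (map A R1 @ x # y # map A R2) cs = rows_minor (map A (R1 @ b # (b + 1) # R2)) cs"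
      using xcomb[of cs "map A R1" "y # map A R2"] that by (simp add: y_def)
    also have "0 \<le> \<dots>" by (rule tnnD[OF A that(1)]) (use that b in auto)
    finally show ?thesis .
  qed
  have core: "0 \<le> rows_minor (map A R1 @ x # map A R2) cs"
    if "sorted_wrt (<) (R1 @ b # R2)" "b + 1 \<notin> set R2" "set R1 \<subseteq> R" "set R2 \<subseteq> R" "sorted_wrt (<) cs" "set cs \<subseteq> C"
      "length cs = Suc (length R1 + length R2)" for R1 R2 cs
    using that
  proof (induction R2 arbitrary: cs)
    case Nil
    have R1l: "f l = 0" if "f \<in> set (map A R1)" for f
      using that Nil.prems zero by (auto simp: sorted_wrt_append)
    have xl: "x l = 0" using e by (simp add: x_def)
    show ?case
    proof (cases "l \<in> set cs")
      case True
      then obtain cs' where cs': "cs = cs' @ [l]"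
        using sorted_last_max[OF \<open>sorted_wrt (<) cs\<close> True] l(2) Nil.prems(6) by (metis subsetD)
      show ?thesis using rows_minor_expand_last[of cs' "map A R1" l x] R1l xl Nil.prems by (simp add: cs')
    next
      case False
      have lt: "c < l" if "c \<in> set cs" for c
        using l(2)[of c] that False Nil.prems(6) by (cases "c = l") auto
      have "0 \<le> rows_minor (map A R1 @ x # y # map A []) (cs @ [l])"
        by (rule both) (use Nil.prems lt l in \<open>auto simp: sorted_wrt_append\<close>)
      also have "\<dots> = rows_minor ((map A R1 @ [x]) @ [y]) (cs @ [l])" by simp
      also have "\<dots> = y l * rows_minor (map A R1 @ [x]) cs"
        by (rule rows_minor_expand_last) (use Nil.prems R1l xl in auto)
      finally show ?thesis using pos by (simp add: y_def zero_le_mult_iff)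
    qed
  next
    case (Cons s R2)
    let ?A1 = "map A R1" and ?A2 = "map A R2"
    let ?B = "?A1 @ y # A s # ?A2"
    let ?p = "length R1"
    have bs: "b + 1 < s" using Cons.prems by (auto simp: sorted_wrt_append)
    have R1b: "r < b" if "r \<in> set R1" for r using Cons.prems that by (auto simp: sorted_wrt_append)
    have sR2: "s < r" if "r \<in> set R2" for r using Cons.prems that by (auto simp: sorted_wrt_append)
    have so: "sorted_wrt (<) R1" "sorted_wrt (<) R2" using Cons.prems by (auto simp: sorted_wrt_append)
    have lenB: "length cs = length ?B" using Cons.prems by simp
    have len: "length cs = Suc (length ?A1 + length (f # ?A2))" for f :: "int \<Rightarrow> real"
      using Cons.prems by simp
    have ubs: "u < r" if "r \<in> set (s # R2)" "u \<le> b + 1" for r u using that bs sR2[of r] by auto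
    have lR1: "r < u" if "r \<in> set R1" "b \<le> u" for r u using that R1b[of r] by auto
    have B0: "0 \<le> rows_minor ?B cs"
    proof -
      have "sorted_wrt (<) (R1 @ (b + 1) # s # R2)"
        using so ubs lR1 sR2 by (fastforce simp: sorted_wrt_append)
      from tnnD[OF A this Cons.prems(5)] show ?thesis using Cons.prems b by (simp add: y_def)
    qed
    show ?case
    proof (cases "rows_minor ?B cs = 0")
      case True
      have "0 \<le> rows_minor (map A (R1 @ b # s # R2)) cs"
        by (rule tnnD[OF A]) (use Cons.prems b in auto)
      then show ?thesis using xcomb[OF len[of "A s"]] True by simp
    next
      case False
      then have Bp: "0 < rows_minor ?B cs" using B0 by simp
      obtain g where g: "\<And>c. c \<in> set cs \<Longrightarrow> x c = (\<Sum>k<length ?B. g k * (?B ! k) c)"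
        using rows_minor_row_span[OF lenB False, of x] by blast
      have Bk: "?B ! k \<in> set ?A1 \<union> set ?A2" if "k < length ?B" "k \<noteq> ?p" "k \<noteq> Suc ?p" for k
        using that by (auto simp: nth_append nth_Cons' )
      have Bp1: "?B ! ?p = y" "?B ! Suc ?p = A s" by (auto simp: nth_append)
      have e1: "rows_minor (?A1 @ x # A s # ?A2) cs = g ?p * rows_minor ?B cs"
      proof -
        have "rows_minor (?A1 @ x # A s # ?A2) cs = (\<Sum>k<length ?B. g k * rows_minor (?A1 @ ?B ! k # A s # ?A2) cs)"
          by (rule rows_minor_row_sum[OF len]) (use g in auto)
        also have "\<dots> = (\<Sum>k\<in>{?p}. g k * rows_minor (?A1 @ ?B ! k # A s # ?A2) cs)"
        proof (rule sum.mono_neutral_right)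
          show "\<forall>k\<in>{..<length ?B} - {?p}. g k * rows_minor (?A1 @ ?B ! k # A s # ?A2) cs = 0"
          proof
            fix k assume k: "k \<in> {..<length ?B} - {?p}"
            then have "?B ! k \<in> set ?A1 \<union> set (A s # ?A2)" using Bk[of k] Bp1 by (cases "k = Suc ?p") auto
            from rows_minor_repeat_in[OF len this] show "g k * rows_minor (?A1 @ ?B ! k # A s # ?A2) cs = 0" by simp
          qed
        qed auto
        finally show ?thesis using Bp1 by simp
      qed
      have e2: "rows_minor (?A1 @ x # y # ?A2) cs = - (g (Suc ?p) * rows_minor ?B cs)"
      proof -
        have "rows_minor (?A1 @ x # y # ?A2) cs = (\<Sum>k<length ?B. g k * rows_minor (?A1 @ ?B ! k # y # ?A2) cs)"
          by (rule rows_minor_row_sum[OF len]) (use g in auto)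
        also have "\<dots> = (\<Sum>k\<in>{Suc ?p}. g k * rows_minor (?A1 @ ?B ! k # y # ?A2) cs)"
        proof (rule sum.mono_neutral_right)
          show "\<forall>k\<in>{..<length ?B} - {Suc ?p}. g k * rows_minor (?A1 @ ?B ! k # y # ?A2) cs = 0"
          proof
            fix k assume k: "k \<in> {..<length ?B} - {Suc ?p}"
            then have "?B ! k \<in> set ?A1 \<union> set (y # ?A2)" using Bk[of k] Bp1 by (cases "k = ?p") auto
            from rows_minor_repeat_in[OF len this] show "g k * rows_minor (?A1 @ ?B ! k # y # ?A2) cs = 0" by simp
          qed
        qed auto
        also have "\<dots> = g (Suc ?p) * rows_minor (?A1 @ A s # y # ?A2) cs" using Bp1 by simp
        also have "rows_minor (?A1 @ A s # y # ?A2) cs = - rows_minor ?B cs"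
          by (rule rows_minor_swap) (use Cons.prems in simp)
        finally show ?thesis by simp
      qed
      have "0 \<le> rows_minor (?A1 @ x # y # ?A2) cs"
      proof (rule both)
        show "sorted_wrt (<) (R1 @ b # (b + 1) # R2)"
          using so ubs lR1 by (fastforce simp: sorted_wrt_append)
      qed (use Cons.prems in auto)
      then have g2: "g (Suc ?p) \<le> 0" using e2 Bp by (simp add: mult_le_0_iff)
      \<comment> \<open>Expansion of the positive minor along row \<open>s\<close> yields a column to delete.\<close>
      have "\<exists>d<length cs. rows_minor (?A1 @ y # ?A2) (del_nth d cs) \<noteq> 0"
      proof (rule ccontr)
        assume "\<not> ?thesis"
        then have "rows_minor ((?A1 @ [y]) @ A s # ?A2) cs = 0"
          using rows_minor_expand_row[of cs "?A1 @ [y]" ?A2 "A s"] Cons.prems by simp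
        then show False using False by simp
      qed
      then obtain d where d: "d < length cs" "rows_minor (?A1 @ y # ?A2) (del_nth d cs) \<noteq> 0" by blast
      let ?D = "del_nth d cs"
      have D: "sorted_wrt (<) ?D" "set ?D \<subseteq> C" "length ?D = Suc (length R1 + length R2)" "set ?D \<subseteq> set cs"
        using Cons.prems d sorted_del_nth set_del_nth[of d cs] by auto
      have lenD: "length ?D = Suc (length ?A1 + length ?A2)" using D by simp
      have qy: "0 < rows_minor (?A1 @ y # ?A2) ?D"
      proof -
        have "sorted_wrt (<) (R1 @ (b + 1) # R2)"
          using so ubs lR1 by (fastforce simp: sorted_wrt_append)
        from tnnD[OF A this D(1)] show ?thesis using Cons.prems b D d by (simp add: y_def less_le)
      qed
      have qs: "0 \<le> rows_minor (?A1 @ A s # ?A2) ?D"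
      proof -
        have "sorted_wrt (<) (R1 @ s # R2)"
          using so sR2 lR1 bs by (fastforce simp: sorted_wrt_append)
        from tnnD[OF A this D(1)] show ?thesis using Cons.prems b D d by simp
      qed
      have "rows_minor (?A1 @ x # ?A2) ?D = (\<Sum>k<length ?B. g k * rows_minor (?A1 @ ?B ! k # ?A2) ?D)"
        by (rule rows_minor_row_sum[OF lenD]) (use g D in auto)
      also have "\<dots> = (\<Sum>k\<in>{?p, Suc ?p}. g k * rows_minor (?A1 @ ?B ! k # ?A2) ?D)"
      proof (rule sum.mono_neutral_right)
        show "\<forall>k\<in>{..<length ?B} - {?p, Suc ?p}. g k * rows_minor (?A1 @ ?B ! k # ?A2) ?D = 0"
          using rows_minor_repeat_in[OF lenD] Bk by auto
      qed auto
      also have "\<dots> = g ?p * rows_minor (?A1 @ y # ?A2) ?D + g (Suc ?p) * rows_minor (?A1 @ A s # ?A2) ?D"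
        using Bp1 by simp
      finally have "rows_minor (?A1 @ x # ?A2) ?D =
         g ?p * rows_minor (?A1 @ y # ?A2) ?D + g (Suc ?p) * rows_minor (?A1 @ A s # ?A2) ?D" .
      moreover have "0 \<le> rows_minor (?A1 @ x # ?A2) ?D"
        by (rule Cons.IH) (use Cons.prems D in \<open>auto simp: sorted_wrt_append\<close>)
      moreover have "g (Suc ?p) * rows_minor (?A1 @ A s # ?A2) ?D \<le> 0"
        using g2 qs by (simp add: mult_nonpos_nonneg)
      ultimately have "0 \<le> g ?p * rows_minor (?A1 @ y # ?A2) ?D" by linarith
      then have "0 \<le> g ?p" using qy by (simp add: zero_le_mult_iff)
      then show ?thesis using e1 Bp by simp
    qed
  qed
  show ?thesis
    unfolding x_def[symmetric]
  proof (rule tnnI)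
    fix rs cs assume *: "sorted_wrt (<) rs" "sorted_wrt (<) cs" "set rs \<subseteq> R" "set cs \<subseteq> C" "length rs = length cs"
    show "0 \<le> rows_minor (map (A(b := x)) rs) cs"
    proof (cases "b \<in> set rs")
      case False
      then have eq: "map (A(b := x)) rs = map A rs" by auto
      show ?thesis unfolding eq by (rule tnnD[OF A *])
    next
      case True
      then obtain R1 R2 where rs: "rs = R1 @ b # R2" "\<And>r. r \<in> set R1 \<Longrightarrow> r < b" "\<And>r. r \<in> set R2 \<Longrightarrow> b < r"
        "sorted_wrt (<) R1" "sorted_wrt (<) R2" using sorted_split[OF *(1)] by metis
      have "b \<notin> set R1" "b \<notin> set R2" using rs by auto
      then have eq: "map (A(b := x)) rs = map A R1 @ x # map A R2" by (simp add: rs)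
      show ?thesis
      proof (cases "b + 1 \<in> set R2")
        case False
        then show ?thesis unfolding eq by (intro core) (use * rs in auto)
      next
        case True
        then obtain S1 S2 where S: "R2 = S1 @ (b + 1) # S2" "\<And>r. r \<in> set S1 \<Longrightarrow> r < b + 1"
          using sorted_split[OF rs(5)] by metis
        have "S1 = []" using S rs(3) by (cases S1) force+
        then show ?thesis unfolding eq using both[of R1 S2 cs] * rs S by (simp add: y_def)
      qed
    qed
  qed
qed

section \<open>The group of upper unitriangular matrices\<close>

definition unitri :: "bimat \<Rightarrow> bool" where
  "unitri X \<longleftrightarrow> (\<forall>i. X i i = 1) \<and> (\<forall>i j. j < i \<longrightarrow> X i j = 0)"

lemma unitriD: "unitri X \<Longrightarrow> X i i = 1" "unitri X \<Longrightarrow> j < i \<Longrightarrow> X i j = 0"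
  by (auto simp: unitri_def)

lemma unitri_nonzero: "unitri X \<Longrightarrow> X i j \<noteq> 0 \<Longrightarrow> i \<le> j"
  using unitriD(2)[of X j i] by force

lemma bi_mult_sum:
  assumes "finite K" "\<And>k. X i k \<noteq> 0 \<Longrightarrow> Y k j \<noteq> 0 \<Longrightarrow> k \<in> K"
  shows "bi_mult X Y i j = (\<Sum>k\<in>K. X i k * Y k j)"
  unfolding bi_mult_def
  by (rule sum.mono_neutral_left) (use assms in auto)

lemma bi_mult_bounded:
  assumes "\<And>k. k < L \<Longrightarrow> X i k = 0" "unitri Y"
  shows "bi_mult X Y i j = (\<Sum>k\<in>{L..j}. X i k * Y k j)"
  by (rule bi_mult_sum) (use assms unitri_nonzero[OF assms(2)] in force)+

lemma bi_mult_unitri: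
  assumes "unitri X" "unitri Y"
  shows "bi_mult X Y i j = (\<Sum>k\<in>{i..j}. X i k * Y k j)"
  by (rule bi_mult_bounded) (use assms in \<open>auto simp: unitri_def\<close>)

lemma unitri_bi_id: "unitri bi_id"
  by (auto simp: unitri_def bi_id_def)

lemma bi_mult_id_right [simp]: "bi_mult X bi_id = X"
proof (intro ext)
  fix i j
  show "bi_mult X bi_id i j = X i j"
    by (subst bi_mult_sum[where K="{j}"]) (auto simp: bi_id_def split: if_splits)
qed

lemma bi_mult_id_left [simp]: "bi_mult bi_id X = X"
proof (intro ext)
  fix i j
  show "bi_mult bi_id X i j = X i j"
    by (subst bi_mult_sum[where K="{i}"]) (auto simp: bi_id_def split: if_splits)
qed

lemma unitri_mult:
  assumes "unitri X" "unitri Y"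
  shows "unitri (bi_mult X Y)"
  using assms by (auto simp: unitri_def bi_mult_unitri[OF assms])

text \<open>
  The left factor only has to vanish far to the left in the row considered. This covers inverses that
  are not known to be triangular.
\<close>

lemma bi_mult_assoc_bounded:
  assumes X: "\<And>k. k < L \<Longrightarrow> X i k = 0" and Y: "unitri Y" and Z: "unitri Z"
  shows "bi_mult (bi_mult X Y) Z i j = bi_mult X (bi_mult Y Z) i j"
proof -
  have XY: "bi_mult X Y i k = (\<Sum>m\<in>{L..k}. X i m * Y m k)" for k
    by (rule bi_mult_bounded) (use X Y in auto)
  have ext: "(\<Sum>m\<in>{L..k}. X i m * Y m k) = (\<Sum>m\<in>{L..j}. X i m * Y m k)" if "k \<le> j" for k
    by (rule sum.mono_neutral_left) (use that unitriD(2)[OF Y] in auto)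
  have "bi_mult (bi_mult X Y) Z i j = (\<Sum>k\<in>{L..j}. bi_mult X Y i k * Z k j)"
    by (rule bi_mult_bounded) (use XY Z in auto)
  also have "\<dots> = (\<Sum>k\<in>{L..j}. \<Sum>m\<in>{L..j}. X i m * (Y m k * Z k j))"
    by (rule sum.cong) (simp_all add: XY ext sum_distrib_right mult.assoc)
  also have "\<dots> = (\<Sum>m\<in>{L..j}. X i m * (\<Sum>k\<in>{L..j}. Y m k * Z k j))"
    by (subst sum.swap) (simp add: sum_distrib_left)
  also have "\<dots> = (\<Sum>m\<in>{L..j}. X i m * bi_mult Y Z m j)"
  proof (rule sum.cong[OF refl])
    fix m assume m: "m \<in> {L..j}"
    have "bi_mult Y Z m j = (\<Sum>k\<in>{L..j}. Y m k * Z k j)"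
      by (rule bi_mult_sum) (use m unitri_nonzero[OF Y, of m] unitri_nonzero[OF Z, of _ j] in force)+
    then show "X i m * (\<Sum>k\<in>{L..j}. Y m k * Z k j) = X i m * bi_mult Y Z m j" by simp
  qed
  also have "\<dots> = bi_mult X (bi_mult Y Z) i j"
    by (rule bi_mult_bounded[symmetric]) (use X unitri_mult[OF Y Z] in auto)
  finally show ?thesis .
qed

lemma bi_mult_assoc:
  assumes "unitri X" "unitri Y" "unitri Z"
  shows "bi_mult (bi_mult X Y) Z = bi_mult X (bi_mult Y Z)"
proof (intro ext)
  fix i j
  show "bi_mult (bi_mult X Y) Z i j = bi_mult X (bi_mult Y Z) i j"
    by (rule bi_mult_assoc_bounded[of i]) (use assms in \<open>auto simp: unitri_def\<close>)
qed

text \<open>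
  The entries of the left inverse are found by moving away from the diagonal.
\<close>

function unitri_inv :: "bimat \<Rightarrow> bimat" where
  "unitri_inv X i j = (if j < i then 0 else if j = i then 1 else - (\<Sum>k\<in>{i..<j}. unitri_inv X i k * X k j))"
  by pat_completeness auto
termination by (relation "Wellfounded.measure (\<lambda>(X, i, j). nat (j - i))") auto

declare unitri_inv.simps [simp del]

lemma unitri_unitri_inv: "unitri (unitri_inv X)"
  by (auto simp: unitri_def unitri_inv.simps)

lemma unitri_inv_left:
  assumes "unitri X"
  shows "bi_mult (unitri_inv X) X = bi_id"
proof (intro ext)
  fix i j :: int
  consider "j < i" | "j = i" | "i < j" by linarith
  then show "bi_mult (unitri_inv X) X i j = bi_id i j"
  proof cases
    case 3
    then have "{i..j} = insert j {i..<j}" by auto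
    then have "bi_mult (unitri_inv X) X i j = unitri_inv X i j * X j j + (\<Sum>k\<in>{i..<j}. unitri_inv X i k * X k j)"
      by (simp add: bi_mult_unitri[OF unitri_unitri_inv assms])
    also have "\<dots> = 0" using 3 by (simp add: unitriD(1)[OF assms] unitri_inv.simps[of X i j])
    finally show ?thesis using 3 by (simp add: bi_id_def)
  qed (auto simp: bi_mult_unitri[OF unitri_unitri_inv assms] bi_id_def unitriD[OF assms] unitriD(1)[OF unitri_unitri_inv])
qed

text \<open>
  A left inverse with rows that vanish far to the left is automatically triangular.
\<close>

lemma left_inverse_is_unitri_inv:
  assumes "unitri X" "bi_mult Y X = bi_id" "\<And>i. \<exists>L. \<forall>k<L. Y i k = 0"
  shows "Y = unitri_inv X"
proof -
  let ?Z = "unitri_inv (unitri_inv X)"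
  have u: "unitri (unitri_inv X)" "unitri ?Z" by (rule unitri_unitri_inv)+
  have ZX: "?Z = X"
    using bi_mult_assoc[OF u(2,1) assms(1)] by (simp add: unitri_inv_left[OF u(1)] unitri_inv_left[OF assms(1)])
  have r: "bi_mult X (unitri_inv X) = bi_id" using unitri_inv_left[OF u(1)] ZX by simp
  show ?thesis
  proof (intro ext)
    fix i j
    obtain L where L: "\<And>k. k < L \<Longrightarrow> Y i k = 0" using assms(3) by blast
    have "bi_mult (bi_mult Y X) (unitri_inv X) i j = bi_mult Y (bi_mult X (unitri_inv X)) i j"
      by (rule bi_mult_assoc_bounded) (use L assms(1) u(1) in auto)
    then show "Y i j = unitri_inv X i j" by (simp add: r assms(2))
  qed
qed

lemma unitri_inv_unique:
  assumes "unitri X" "unitri Y" "bi_mult Y X = bi_id"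
  shows "unitri_inv X = Y"
proof -
  have "\<exists>L. \<forall>k<L. Y i k = 0" for i using unitriD(2)[OF assms(2)] by blast
  then show ?thesis using left_inverse_is_unitri_inv[OF assms(1,3)] by simp
qed

lemma unitri_inv_unitri_inv:
  assumes "unitri X" shows "unitri_inv (unitri_inv X) = X"
  using bi_mult_assoc[OF unitri_unitri_inv[of "unitri_inv X"] unitri_unitri_inv[of X] assms]
  by (simp add: unitri_inv_left[OF unitri_unitri_inv] unitri_inv_left[OF assms])

lemma unitri_inv_right:
  assumes "unitri X" shows "bi_mult X (unitri_inv X) = bi_id"
  using unitri_inv_left[OF unitri_unitri_inv[of X]] by (simp add: unitri_inv_unitri_inv[OF assms])

lemma unitri_inv_mult:
  assumes X: "unitri X" and Y: "unitri Y"
  shows "unitri_inv (bi_mult X Y) = bi_mult (unitri_inv Y) (unitri_inv X)"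
proof (rule unitri_inv_unique)
  have "bi_mult (bi_mult (unitri_inv Y) (unitri_inv X)) (bi_mult X Y) = bi_mult (unitri_inv Y) (bi_mult (bi_mult (unitri_inv X) X) Y)"
    by (simp add: bi_mult_assoc unitri_unitri_inv unitri_mult X Y)
  then show "bi_mult (bi_mult (unitri_inv Y) (unitri_inv X)) (bi_mult X Y) = bi_id"
    by (simp add: unitri_inv_left X Y)
qed (intro unitri_mult unitri_unitri_inv X Y)+

lemma cancel_left: "unitri X \<Longrightarrow> unitri Y \<Longrightarrow> bi_mult (unitri_inv X) (bi_mult X Y) = Y"
  by (simp add: bi_mult_assoc[symmetric] unitri_unitri_inv unitri_inv_left)

lemma cancel_left': "unitri X \<Longrightarrow> unitri Y \<Longrightarrow> bi_mult X (bi_mult (unitri_inv X) Y) = Y"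
  by (simp add: bi_mult_assoc[symmetric] unitri_unitri_inv unitri_inv_right)

lemma cancel_right: "unitri X \<Longrightarrow> unitri Y \<Longrightarrow> bi_mult (bi_mult X Y) (unitri_inv Y) = X"
  by (simp add: bi_mult_assoc unitri_unitri_inv unitri_inv_right)

definition alternate :: "bimat \<Rightarrow> bimat" where
  "alternate X = (\<lambda>i j. (if even (i + j) then 1 else -1) * X i j)"

lemma alternate_alternate [simp]: "alternate (alternate X) = X"
  by (auto simp: alternate_def fun_eq_iff)

lemma unitri_alternate: "unitri X \<Longrightarrow> unitri (alternate X)"
  by (auto simp: unitri_def alternate_def)

lemma alternate_mult: 
  assumes "unitri X" "unitri Y"
  shows "alternate (bi_mult X Y) = bi_mult (alternate X) (alternate Y)"
proof (intro ext)
  fix i j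
  define s :: "int \<Rightarrow> real" where "s k = (if even k then 1 else -1)" for k
  have alt: "alternate Z p q = s (p + q) * Z p q" for Z p q by (simp add: alternate_def s_def)
  have ss: "s (i + j) = s (i + k) * s (k + j)" for k by (auto simp: s_def)
  have "alternate (bi_mult X Y) i j = (\<Sum>k\<in>{i..j}. s (i + j) * (X i k * Y k j))"
    by (simp add: alt bi_mult_unitri[OF assms] sum_distrib_left)
  also have "\<dots> = (\<Sum>k\<in>{i..j}. (s (i + k) * X i k) * (s (k + j) * Y k j))"
  proof (rule sum.cong[OF refl])
    fix k
    show "s (i + j) * (X i k * Y k j) = (s (i + k) * X i k) * (s (k + j) * Y k j)"
      unfolding ss[of k] by (simp only: ac_simps)
  qed
  also have "\<dots> = bi_mult (alternate X) (alternate Y) i j"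
    by (simp add: bi_mult_unitri[OF unitri_alternate[OF assms(1)] unitri_alternate[OF assms(2)]] alt)
  finally show "alternate (bi_mult X Y) i j = bi_mult (alternate X) (alternate Y) i j" .
qed

lemma alternate_id [simp]: "alternate bi_id = bi_id"
  by (auto simp: alternate_def bi_id_def fun_eq_iff)

text \<open>
  This is the matrix \<open>X\<^bsup>-c\<^esup>\<close>. It reverses products and exchanges curls and whirls, so that statements
  about the right end of a product follow from statements about its left end.
\<close>

definition dual :: "bimat \<Rightarrow> bimat" where
  "dual X = alternate (unitri_inv X)"

lemma unitri_dual: "unitri (dual X)"
  by (simp add: dual_def unitri_alternate unitri_unitri_inv)

lemma unitri_inv_alternate:
  assumes "unitri X" shows "unitri_inv (alternate X) = alternate (unitri_inv X)"
  by (rule unitri_inv_unique)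
    (simp_all add: unitri_alternate assms unitri_unitri_inv alternate_mult[symmetric] unitri_inv_left)

lemma dual_dual: "unitri X \<Longrightarrow> dual (dual X) = X"
  by (simp add: dual_def unitri_inv_alternate unitri_unitri_inv unitri_inv_unitri_inv)

lemma dual_mult: "unitri X \<Longrightarrow> unitri Y \<Longrightarrow> dual (bi_mult X Y) = bi_mult (dual Y) (dual X)"
  by (simp add: dual_def unitri_inv_mult alternate_mult unitri_unitri_inv)

lemma bi_mult_lim:
  assumes "\<And>k. unitri (F k)" "\<And>k. unitri (G k)" "unitri X" "unitri Y" "entrywise_lim F X" "entrywise_lim G Y"
  shows "entrywise_lim (\<lambda>k. bi_mult (F k) (G k)) (bi_mult X Y)"
  unfolding entrywise_lim_def bi_mult_unitri[OF assms(1,2)] bi_mult_unitri[OF assms(3,4)]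
  using assms(5,6) by (auto simp: entrywise_lim_def intro!: tendsto_sum tendsto_mult)

lemma entrywise_lim_const: "entrywise_lim (\<lambda>_. X) X"
  by (simp add: entrywise_lim_def)

lemma entrywise_lim_unique: "entrywise_lim F X \<Longrightarrow> entrywise_lim F Y \<Longrightarrow> X = Y"
  by (intro ext) (metis LIMSEQ_unique entrywise_lim_def)

lemma unitri_inv_lim:
  assumes "entrywise_lim F X"
  shows "entrywise_lim (\<lambda>k. unitri_inv (F k)) (unitri_inv X)"
proof -
  have "(\<lambda>k. unitri_inv (F k) i j) \<longlonglongrightarrow> unitri_inv X i j" for i j
  proof (induction "nat (j - i)" arbitrary: j rule: less_induct)
    case less
    have "(\<lambda>k. - (\<Sum>m\<in>{i..<j}. unitri_inv (F k) i m * F k m j)) \<longlonglongrightarrow> - (\<Sum>m\<in>{i..<j}. unitri_inv X i m * X m j)"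
      by (intro tendsto_minus tendsto_sum tendsto_mult less) (use assms in \<open>auto simp: entrywise_lim_def\<close>)
    then show ?case by (subst (1 2) unitri_inv.simps) simp
  qed
  then show ?thesis by (simp add: entrywise_lim_def)
qed

lemma dual_lim: "entrywise_lim F X \<Longrightarrow> entrywise_lim (\<lambda>k. dual (F k)) (dual X)"
  using unitri_inv_lim[of F X] unfolding entrywise_lim_def dual_def alternate_def
  by (auto intro!: tendsto_intros)

lemma unitri_lim:
  assumes "\<And>k. unitri (F k)" "entrywise_lim F X"
  shows "unitri X"
proof -
  have lim: "(\<lambda>k. F k i j) \<longlonglongrightarrow> X i j" for i j using assms(2) by (simp add: entrywise_lim_def)
  have "X i i = 1" for i
    using LIMSEQ_unique[OF lim[of i i]] by (simp add: unitriD(1)[OF assms(1)])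
  moreover have "X i j = 0" if "j < i" for i j
    using LIMSEQ_unique[OF lim[of i j]] that by (simp add: unitriD(2)[OF assms(1)])
  ultimately show ?thesis by (simp add: unitri_def)
qed

section \<open>Curls and whirls\<close>

text \<open>
  Curls and whirls with one parameter for each integer. Periodicity of the parameters is a separate
  hypothesis, so that elementary bidiagonal matrices are whirls of this kind as well.
\<close>

definition icurl :: "(int \<Rightarrow> real) \<Rightarrow> bimat" where
  "icurl a = (\<lambda>i j. if j < i then 0 else \<Prod>k\<in>{i..<j}. a k)"

definition iwhirl :: "(int \<Rightarrow> real) \<Rightarrow> bimat" where
  "iwhirl a = (\<lambda>i j. if j = i then 1 else if j = i + 1 then a i else 0)"

lemma unitri_icurl: "unitri (icurl a)" and unitri_iwhirl: "unitri (iwhirl a)"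
  by (auto simp: unitri_def icurl_def iwhirl_def)

lemma icurl_rec: "i < j \<Longrightarrow> icurl a i j = a i * icurl a (i + 1) j"
proof -
  assume "i < j"
  then have "{i..<j} = insert i {i + 1..<j}" by auto
  then show ?thesis using \<open>i < j\<close> by (simp add: icurl_def)
qed

lemma icurl_step: "i \<le> j \<Longrightarrow> icurl a i (j + 1) = icurl a i j * a j"
proof -
  assume "i \<le> j"
  then have "{i..<j + 1} = insert j {i..<j}" by auto
  then show ?thesis using \<open>i \<le> j\<close> by (simp add: icurl_def)
qed

lemma icurl_mult:
  assumes "unitri T"
  shows "bi_mult (icurl a) T i j = T i j + a i * bi_mult (icurl a) T (i + 1) j"
proof (cases "i \<le> j")
  case True
  then have "{i..j} = insert i {i + 1..j}" by auto
  then have "bi_mult (icurl a) T i j = icurl a i i * T i j + (\<Sum>k\<in>{i + 1..j}. icurl a i k * T k j)"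
    by (simp add: bi_mult_unitri[OF unitri_icurl assms])
  also have "(\<Sum>k\<in>{i + 1..j}. icurl a i k * T k j) = (\<Sum>k\<in>{i + 1..j}. a i * (icurl a (i + 1) k * T k j))"
    by (rule sum.cong) (auto simp: icurl_rec)
  finally show ?thesis
    by (simp add: bi_mult_unitri[OF unitri_icurl assms] unitriD(1)[OF unitri_icurl] sum_distrib_left)
next
  case False
  then show ?thesis using unitriD(2)[OF assms] unitriD(2)[OF unitri_mult[OF unitri_icurl assms]] by simp
qed

lemma iwhirl_mult: "bi_mult (iwhirl b) T i j = T i j + b i * T (i + 1) j"
  by (subst bi_mult_sum[where K="{i, i + 1}"]) (auto simp: iwhirl_def split: if_splits)

lemma mult_iwhirl: "bi_mult T (iwhirl b) i j = T i j + T i (j - 1) * b (j - 1)"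
  by (subst bi_mult_sum[where K="{j, j - 1}"]) (auto simp: iwhirl_def split: if_splits)

lemma icurl_iwhirl_inverse: "bi_mult (iwhirl (\<lambda>k. - a k)) (icurl a) = bi_id"
proof (intro ext)
  fix i j :: int
  consider "j < i" | "j = i" | "i < j" by linarith
  then show "bi_mult (iwhirl (\<lambda>k. - a k)) (icurl a) i j = bi_id i j"
    unfolding iwhirl_mult
    by cases (auto simp: bi_id_def unitriD[OF unitri_icurl] icurl_rec)
qed

lemma unitri_inv_icurl: "unitri_inv (icurl a) = iwhirl (\<lambda>k. - a k)"
  by (rule unitri_inv_unique) (simp_all add: unitri_icurl unitri_iwhirl icurl_iwhirl_inverse)

lemma dual_icurl: "dual (icurl a) = iwhirl a"
  by (auto simp: dual_def unitri_inv_icurl alternate_def iwhirl_def fun_eq_iff)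

text \<open>
  Row \<open>i\<close> of the product is row \<open>i\<close> of \<open>T\<close> plus \<open>a i\<close> times row \<open>i + 1\<close> of the product. On the columns up to
  \<open>l\<close> the rows below \<open>l\<close> vanish, so every minor is reached from \<open>T\<close> by finitely many row additions,
  beginning with row \<open>l\<close> and moving up.
\<close>

lemma icurl_mult_tnn:
  assumes T: "unitri T" "tnn_on UNIV UNIV T" and a: "\<And>i. 0 \<le> a i"
  shows "tnn_on UNIV UNIV (bi_mult (icurl a) T)"
proof (rule tnnI)
  fix rs cs :: "int list"
  assume *: "sorted_wrt (<) rs" "sorted_wrt (<) cs" "length rs = length cs"
  let ?S = "bi_mult (icurl a) T"
  define l where "l = Max (insert 0 (set cs))"
  define A where "A k i = (if l - int k < i then ?S i else T i)" for k i
  have S0: "?S i j = 0" "T i j = 0" if "j < i" for i j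
    using that unitriD(2)[OF T(1)] unitriD(2)[OF unitri_mult[OF unitri_icurl T(1)]] by auto
  have A: "tnn_on UNIV {..l} (A k)" for k
  proof (induction k)
    case 0
    show ?case by (rule tnn_cong[OF tnn_subset[OF T(2)]]) (auto simp: A_def S0)
  next
    case (Suc k)
    show ?case
    proof (rule tnn_row_add[OF Suc, of "a (l - int k)" "l - int k + 1" "l - int k"])
      fix c show "A (Suc k) (l - int k) c = A k (l - int k) c + a (l - int k) * A k (l - int k + 1) c"
        using icurl_mult[OF T(1), of a "l - int k" c] by (simp add: A_def)
    qed (auto simp: A_def a)
  qed
  define m where "m = Min (insert 0 (set rs))"
  have "rows_minor (map ?S rs) cs = rows_minor (map (A (nat (l - m + 1))) rs) cs"
  proof (rule rows_minor_map_cong[OF *(3)])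
    fix r c assume "r \<in> set rs" "c \<in> set cs"
    then have "m \<le> r" "c \<le> l" by (auto simp: m_def l_def)
    then show "?S r c = A (nat (l - m + 1)) r c" using S0[of c r] by (auto simp: A_def)
  qed
  also have "0 \<le> \<dots>" by (rule tnnD[OF A]) (use * in \<open>auto simp: l_def\<close>)
  finally show "0 \<le> rows_minor (map ?S rs) cs" .
qed

section \<open>Total nonnegativity of the dual\<close>

lemma tnn_windows:
  assumes "\<And>a l. a \<le> l \<Longrightarrow> tnn_on {a..l} {a..l} A"
  shows "tnn_on UNIV UNIV A"
proof (rule tnnI)
  fix rs cs :: "int list"
  assume *: "sorted_wrt (<) rs" "sorted_wrt (<) cs" "length rs = length cs"
  let ?S = "insert 0 (set rs \<union> set cs)"
  have "tnn_on {Min ?S..Max ?S} {Min ?S..Max ?S} A"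
    by (rule assms, rule order_trans[of _ 0]) (auto intro!: Min_le Max_ge)
  then show "0 \<le> rows_minor (map A rs) cs" by (rule tnnD) (use * in auto)
qed

text \<open>
  A minor that uses both row \<open>l\<close> and column \<open>l\<close> loses them by expansion; one that uses only one of them
  vanishes.
\<close>

lemma tnn_extend_window:
  assumes T: "unitri T" "tnn_on {a..l - 1} {a..l - 1} T" and z: "\<And>r. a \<le> r \<Longrightarrow> r < l \<Longrightarrow> T r l = 0"
  shows "tnn_on {a..l} {a..l} T"
proof (rule tnnI)
  fix rs cs assume *: "sorted_wrt (<) rs" "sorted_wrt (<) cs" "set rs \<subseteq> {a..l}" "set cs \<subseteq> {a..l}" "length rs = length cs"
  show "0 \<le> rows_minor (map T rs) cs"
  proof (cases "l \<in> set cs")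
    case True
    then obtain cs' where cs: "cs = cs' @ [l]" "sorted_wrt (<) cs'" "\<And>c. c \<in> set cs' \<Longrightarrow> c < l"
      using sorted_last_max[OF *(2) True] *(4) by (metis atLeastAtMost_iff subsetD)
    show ?thesis
    proof (cases "l \<in> set rs")
      case True
      then obtain rs' where rs: "rs = rs' @ [l]" "sorted_wrt (<) rs'" "\<And>c. c \<in> set rs' \<Longrightarrow> c < l"
        using sorted_last_max[OF *(1) True] *(3) by (metis atLeastAtMost_iff subsetD)
      have "rows_minor (map T rs' @ [T l]) (cs' @ [l]) = T l l * rows_minor (map T rs') cs'"
        by (rule rows_minor_expand_last) (use * rs cs z in auto)
      moreover have "0 \<le> rows_minor (map T rs') cs'"
        by (rule tnnD[OF T(2)]) (use * rs cs in force)+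
      ultimately show ?thesis by (simp add: rs cs unitriD(1)[OF T(1)])
    next
      case False
      then have r: "T r l = 0" if "r \<in> set rs" for r using z[of r] that * by (cases "r = l") auto
      have "rows_minor (map T rs) cs = rows_minor (map (\<lambda>j i. T i j) cs) rs" by (rule rows_minor_transpose) (use * in simp)
      also have "\<dots> = rows_minor (map (\<lambda>j i. T i j) cs' @ (\<lambda>i. T i l) # []) rs" by (simp add: cs)
      also have "\<dots> = 0"
        by (rule rows_minor_row_zero) (use r * cs in auto)
      finally show ?thesis by simp
    qed
  next
    case False
    then have c: "c < l" if "c \<in> set cs" for c using that * by (cases "c = l") force+
    show ?thesis
    proof (cases "l \<in> set rs")
      case True
      then obtain rs' where rs: "rs = rs' @ [l]" "sorted_wrt (<) rs'" "\<And>c. c \<in> set rs' \<Longrightarrow> c < l"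
        using sorted_last_max[OF *(1) True] *(3) by (metis atLeastAtMost_iff subsetD)
      have "rows_minor (map T rs' @ T l # []) cs = 0"
        by (rule rows_minor_row_zero) (use c unitriD(2)[OF T(1)] * rs in auto)
      then show ?thesis by (simp add: rs)
    next
      case False
      then have r: "r < l" if "r \<in> set rs" for r using that * by (cases "r = l") force+
      show ?thesis by (rule tnnD[OF T(2)]) (use * r c in force)+
    qed
  qed
qed

text \<open>
  The last column of the window is cleared by eliminations from the top down; then the window shrinks.
  An elimination multiplies \<open>X\<close> on the left by an elementary bidiagonal matrix, and on the dual this is
  undone by adding a nonnegative multiple of one column to the next.
\<close>

lemma dual_tnn_window:
  assumes "unitri X" "tnn_on {a..a + int d} {a..a + int d} X"
  shows "tnn_on {a..a + int d} {a..a + int d} (dual X)"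
  using assms
proof (induction d arbitrary: X)
  case 0
  show ?case by (rule tnn_cong[OF 0(2)]) (use unitriD(1)[OF 0(1)] unitriD(1)[OF unitri_dual] in auto)
next
  case (Suc d)
  define l where "l = a + int (Suc d)"
  have al: "a < l" "a + int d = l - 1" by (auto simp: l_def)
  have "\<forall>X. a \<le> b \<longrightarrow> unitri X \<longrightarrow> tnn_on {a..l} {a..l} X \<longrightarrow> (\<forall>r. a \<le> r \<longrightarrow> r < b \<longrightarrow> X r l = 0) \<longrightarrow>
      tnn_on {a..l} {a..l} (dual X)" if "b \<le> l" for b
    using that
  proof (induction b rule: int_le_induct)
    case base
    show ?case
    proof (intro allI impI)
      fix X assume X: "a \<le> l" "unitri X" "tnn_on {a..l} {a..l} X" "\<forall>r. a \<le> r \<longrightarrow> r < l \<longrightarrow> X r l = 0"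
      have "tnn_on {a..l - 1} {a..l - 1} (dual X)"
        using Suc.IH[of X] X(2) tnn_subset[OF X(3), of "{a..l - 1}" "{a..l - 1}"] al by simp
      then show "tnn_on {a..l} {a..l} (dual X)"
      proof (rule tnn_extend_window[OF unitri_dual])
        fix r assume r: "a \<le> r" "r < l"
        then have "unitri_inv X r l = - (\<Sum>k\<in>{r..<l}. unitri_inv X r k * X k l)" by (subst unitri_inv.simps) simp
        also have "(\<Sum>k\<in>{r..<l}. unitri_inv X r k * X k l) = 0"
          by (rule sum.neutral) (use X(4) r in auto)
        finally show "dual X r l = 0" by (simp add: dual_def alternate_def)
      qed
    qed
  next
    case (step b')
    define b where "b = b' - 1"
    have bl: "b < l" "b' = b + 1" using step.hyps by (auto simp: b_def)
    show ?case
      unfolding b_def[symmetric]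
    proof (intro allI impI)
      fix X assume X: "a \<le> b" "unitri X" "tnn_on {a..l} {a..l} X" "\<forall>r. a \<le> r \<longrightarrow> r < b \<longrightarrow> X r l = 0"
      show "tnn_on {a..l} {a..l} (dual X)"
      proof (cases "X b l = 0")
        case True
        have "\<forall>r. a \<le> r \<longrightarrow> r < b + 1 \<longrightarrow> X r l = 0" using True X(4) by (metis zless_add1_eq)
        then show ?thesis using step.IH X bl by simp
      next
        case False
        have m: "b \<in> {a..l}" "b + 1 \<in> {a..l}" "l \<in> {a..l}" using X(1) bl by auto
        have pb: "0 < X b l" using tnn_entry[OF X(3) m(1,3)] False by simp
        have pb1: "0 < X (b + 1) l"
        proof (cases "b + 1 = l")
          case True then show ?thesis using unitriD(1)[OF X(2)] by simp
        next
          case False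
          then have "X b l * X (b + 1) (b + 1) \<le> X b (b + 1) * X (b + 1) l"
            by (intro tnn_two[OF X(3)]) (use m bl in auto)
          then have "0 < X b (b + 1) * X (b + 1) l" using pb unitriD(1)[OF X(2)] by simp
          then show ?thesis using tnn_entry[OF X(3) m(2,3)] by (auto simp: zero_less_mult_iff)
        qed
        \<comment> \<open>The multiple of row \<open>b + 1\<close> that clears the entry \<open>(b, l)\<close>.\<close>
        define e where "e = X b l / X (b + 1) l"
        define E where "E = iwhirl (\<lambda>k. if k = b then - e else 0)"
        define X1 where "X1 = X(b := \<lambda>c. X b c - e * X (b + 1) c)"
        have e0: "0 \<le> e" using pb pb1 by (simp add: e_def)
        have X1E: "X1 = bi_mult E X"
          by (auto simp: fun_eq_iff E_def iwhirl_mult X1_def)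
        have uE: "unitri E" by (simp add: E_def unitri_iwhirl)
        have uX1: "unitri X1" by (simp add: X1E unitri_mult uE X(2))
        have "tnn_on {a..l} {a..l} X1"
          unfolding X1_def by (rule tnn_eliminate[OF X(3), of l]) (use m pb1 X(4) in \<open>auto simp: e_def\<close>)
        moreover have "X1 r l = 0" if "a \<le> r" "r < b + 1" for r
          using X(4) that pb1 by (auto simp: X1_def e_def)
        ultimately have t: "tnn_on {a..l} {a..l} (dual X1)" using step.IH uX1 X(1) bl by auto
        have "unitri_inv X = bi_mult (unitri_inv X1) E"
          by (simp add: X1E unitri_inv_mult uE X(2) bi_mult_assoc unitri_unitri_inv unitri_inv_left)
        then have eq: "unitri_inv X i j = unitri_inv X1 i j - (if j = b + 1 then e * unitri_inv X1 i b else 0)" for i j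
          by (simp add: E_def mult_iwhirl)
        show ?thesis
        proof (rule tnn_col_add[OF t e0, of b "b + 1"])
          show "dual X r (b + 1) = dual X1 r (b + 1) + e * dual X1 r b" for r
            by (auto simp: dual_def alternate_def eq algebra_simps)
        qed (use m in \<open>auto simp: dual_def alternate_def eq\<close>)
      qed
    qed
  qed
  from this[of a] show ?case using Suc.prems al by (simp add: l_def)
qed

lemma dual_tnn:
  assumes "unitri X" "tnn_on UNIV UNIV X"
  shows "tnn_on UNIV UNIV (dual X)"
proof (rule tnn_windows)
  fix a l :: int assume "a \<le> l"
  define d where "d = nat (l - a)"
  have l: "l = a + int d" using \<open>a \<le> l\<close> by (simp add: d_def)
  show "tnn_on {a..l} {a..l} (dual X)"
    unfolding l by (rule dual_tnn_window[OF assms(1) tnn_subset[OF assms(2)]]) auto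
qed

section \<open>Growth of entries and limits of ratios\<close>

definition periodic :: "nat \<Rightarrow> bimat \<Rightarrow> bool" where
  "periodic n X \<longleftrightarrow> (\<forall>i j. X (i + int n) (j + int n) = X i j)"

text \<open>
  By \<open>U_nonneg_iff\<close> this is membership in \<open>U_nonneg n\<close>.
\<close>

definition U_tnn :: "nat \<Rightarrow> bimat \<Rightarrow> bool" where
  "U_tnn n X \<longleftrightarrow> unitri X \<and> periodic n X \<and> tnn_on UNIV UNIV X"

text \<open>
  The entry \<open>(i, i + m)\<close> is a coefficient of a power of \<open>t\<close> whose exponent differs from \<open>m / n\<close> by less than
  \<open>1\<close>, so this says that all power series in the folding have infinite radius of convergence.
\<close>

definition entire_growth :: "bimat \<Rightarrow> bool" where
  "entire_growth X \<longleftrightarrow> (\<forall>\<rho>>0. \<exists>C. \<forall>i. \<forall>m::nat. \<bar>X i (i + int m)\<bar> * \<rho> ^ m \<le> C)"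

lemma U_tnnD: "U_tnn n X \<Longrightarrow> unitri X" "U_tnn n X \<Longrightarrow> periodic n X" "U_tnn n X \<Longrightarrow> tnn_on UNIV UNIV X"
  by (auto simp: U_tnn_def)

lemma U_tnn_nonneg: "U_tnn n X \<Longrightarrow> 0 \<le> X i j"
  using tnn_entry[OF U_tnnD(3)] by simp

lemma U_tnn_two: "U_tnn n X \<Longrightarrow> r < r' \<Longrightarrow> c < c' \<Longrightarrow> X r c' * X r' c \<le> X r c * X r' c'"
  using tnn_two[OF U_tnnD(3)] by simp

lemma period_multiple:
  fixes f :: "int \<Rightarrow> 'b"
  assumes "\<And>i. f (i + p) = f i"
  shows "f (i + k * p) = f i"
proof -
  have nat: "f (i + int m * p) = f i" for m i
  proof (induction m)
    case (Suc m)
    have "f (i + int (Suc m) * p) = f ((i + int m * p) + p)" by (simp add: algebra_simps)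
    then show ?case using Suc assms by simp
  qed simp
  show ?thesis
  proof (cases "0 \<le> k")
    case True then show ?thesis using nat[of i "nat k"] by simp
  next
    case False
    then show ?thesis using nat[of "i + k * p" "nat (- k)"] by simp
  qed
qed

lemma periodic_shift: "periodic n X \<Longrightarrow> X (i + int n) (j + int n) = X i j"
  by (simp add: periodic_def)

lemma periodic_multiple:
  assumes "periodic n X" shows "X (i + k * int n) (j + k * int n) = X i j"
proof -
  have "(\<lambda>t. X (i + t) (j + t)) (0 + k * int n) = (\<lambda>t. X (i + t) (j + t)) 0"
    by (rule period_multiple) (use assms in \<open>auto simp: periodic_def add.assoc[symmetric]\<close>)
  then show ?thesis by simp
qed

lemma period_bound:
  fixes f :: "int \<Rightarrow> nat \<Rightarrow> real"
  assumes n: "n \<ge> 1" and per: "\<And>i m. f (i + int n) m = f i m"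
  shows "\<exists>C\<ge>0. \<forall>i. \<forall>m\<le>D. f i m \<le> C"
proof -
  let ?S = "(\<lambda>(i, m). f i m) ` ({0..<int n} \<times> {..D})"
  have "f i m \<le> max 0 (Max ?S)" if "m \<le> D" for i m
  proof -
    have "f i m = f (i mod int n + (i div int n) * int n) m" by simp
    also have "\<dots> = f (i mod int n) m"
      using period_multiple[of "\<lambda>i. f i m" "int n"] per by blast
    also have "\<dots> \<in> ?S"
      by (rule image_eqI[of _ _ "(i mod int n, m)"]) (use n that in auto)
    then have "f (i mod int n) m \<le> Max ?S" by (intro Max_ge) auto
    finally show ?thesis by simp
  qed
  then show ?thesis by (intro exI[of _ "max 0 (Max ?S)"]) auto
qed

lemma U_tnn_le_prod:
  assumes X: "U_tnn n X" and "i \<le> k" "k \<le> j" shows "X i j \<le> X i k * X k j"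
proof -
  consider "i = k" | "k = j" | "i < k" "k < j" using assms by linarith
  then show ?thesis
  proof cases
    case 3
    show ?thesis using U_tnn_two[OF X 3] unitriD(1)[OF U_tnnD(1)[OF X]] by simp
  qed (auto simp: unitriD(1)[OF U_tnnD(1)[OF X]])
qed

text \<open>
  By the \<open>2 \<times> 2\<close> minors a zero at \<open>(i, j)\<close> with \<open>i \<le> j\<close> forces all entries above and to the right of it
  to vanish. Together with its translates along the diagonal it makes \<open>X\<close> a band matrix, which is entire.
\<close>

lemma not_entire_positive:
  assumes n: "n \<ge> 1" and X: "U_tnn n X" and ne: "\<not> entire_growth X" and ij: "i \<le> j"
  shows "0 < X i j"
proof (rule ccontr)
  assume "\<not> 0 < X i j"
  then have z: "X i j = 0" using U_tnn_nonneg[OF X, of i j] by simp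
  define D where "D = nat (j - i) + n"
  have zero: "X r (r + int m) = 0" if m: "D \<le> m" for r m
  proof -
    \<comment> \<open>The translate of the zero entry with row in \<open>{r..<r + n}\<close>.\<close>
    define k where "k = - ((i - r) div int n)"
    define i' where "i' = i + k * int n"
    define j' where "j' = j + k * int n"
    have "i' - r = (i - r) mod int n"
      using div_mult_mod_eq[of "i - r" "int n"] by (simp add: i'_def k_def algebra_simps)
    moreover have "0 \<le> (i - r) mod int n" "(i - r) mod int n < int n" using n by auto
    ultimately have r: "r \<le> i'" "i' < r + int n" by linarith+
    have j': "i' \<le> j'" "j' \<le> r + int m" using r m ij by (auto simp: i'_def j'_def D_def)
    have z': "X i' j' = 0" using z periodic_multiple[OF U_tnnD(2)[OF X]] by (simp add: i'_def j'_def)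
    have "X r (r + int m) \<le> X r i' * X i' (r + int m)"
      by (rule U_tnn_le_prod[OF X]) (use r j' in auto)
    also have "X i' (r + int m) \<le> X i' j' * X j' (r + int m)"
      by (rule U_tnn_le_prod[OF X]) (use r j' in auto)
    then have "X i' (r + int m) = 0" using z' U_tnn_nonneg[OF X, of i' "r + int m"] by simp
    finally show ?thesis using U_tnn_nonneg[OF X, of r "r + int m"] by simp
  qed
  have "entire_growth X"
    unfolding entire_growth_def
  proof (intro allI impI)
    fix \<rho> :: real assume \<rho>: "0 < \<rho>"
    obtain C where C: "C \<ge> 0" "\<And>r m. m \<le> D \<Longrightarrow> \<bar>X r (r + int m)\<bar> * \<rho> ^ m \<le> C"
    proof -
      have "X (r + int n) (r + int n + int m) = X r (r + int m)" for r m
        using periodic_shift[OF U_tnnD(2)[OF X], of r "r + int m"] by (simp add: algebra_simps)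
      then show ?thesis
        using period_bound[OF n, of "\<lambda>r m. \<bar>X r (r + int m)\<bar> * \<rho> ^ m" D] that by auto
    qed
    have "\<bar>X r (r + int m)\<bar> * \<rho> ^ m \<le> C" for r m
      using C zero[of m r] by (cases "m \<le> D") auto
    then show "\<exists>C. \<forall>i m. \<bar>X i (i + int m)\<bar> * \<rho> ^ m \<le> C" by blast
  qed
  then show False using ne by simp
qed

text \<open>
  The ratios decrease in \<open>j\<close>, so the infimum is their limit.
\<close>

definition ratio_limit :: "bimat \<Rightarrow> int \<Rightarrow> real" where
  "ratio_limit X i = Inf ((\<lambda>j. X i j / X (i + 1) j) ` {i + 1..})"

definition all_pos :: "bimat \<Rightarrow> bool" where
  "all_pos X \<longleftrightarrow> (\<forall>i j. i \<le> j \<longrightarrow> 0 < X i j)"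

lemma ratio_limit_le_ratio:
  assumes X: "U_tnn n X" and j: "i + 1 \<le> j"
  shows "ratio_limit X i \<le> X i j / X (i + 1) j"
  unfolding ratio_limit_def
  by (rule cInf_lower) (use j U_tnn_nonneg[OF X] in \<open>auto intro!: bdd_belowI[of _ 0] divide_nonneg_nonneg\<close>)

lemma ratio_limit_nonneg:
  assumes X: "U_tnn n X" shows "0 \<le> ratio_limit X i"
  unfolding ratio_limit_def
  by (rule cInf_greatest) (use U_tnn_nonneg[OF X] in \<open>auto intro!: divide_nonneg_nonneg\<close>)

lemma ratio_antimono:
  assumes X: "U_tnn n X" and p: "all_pos X" and j: "i + 1 \<le> j" "j \<le> k"
  shows "X i k / X (i + 1) k \<le> X i j / X (i + 1) j"
proof (cases "j = k")
  case False
  then have "X i k * X (i + 1) j \<le> X i j * X (i + 1) k"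
    using U_tnn_two[OF X, of i "i + 1" j k] j by simp
  moreover have "0 < X (i + 1) j" "0 < X (i + 1) k" using p j by (auto simp: all_pos_def)
  ultimately show ?thesis by (simp add: divide_simps)
qed simp

lemma ratio_limit_tendsto:
  assumes X: "U_tnn n X" and p: "all_pos X"
  shows "((\<lambda>j. X i j / X (i + 1) j) \<longlongrightarrow> ratio_limit X i) at_top"
proof (rule order_tendstoI)
  fix y assume "y < ratio_limit X i"
  then show "eventually (\<lambda>j. y < X i j / X (i + 1) j) at_top"
    using ratio_limit_le_ratio[OF X] by (intro eventually_at_top_linorderI[of "i + 1"]) (metis less_le_trans)
next
  fix y assume "ratio_limit X i < y"
  then obtain j where j: "i + 1 \<le> j" "X i j / X (i + 1) j < y"
    unfolding ratio_limit_def by (force dest!: cInf_lessD[rotated])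
  then show "eventually (\<lambda>j. X i j / X (i + 1) j < y) at_top"
    using ratio_antimono[OF X p j(1)] by (intro eventually_at_top_linorderI[of j]) (metis le_less_trans)
qed

lemma ratio_limit_mult_le:
  assumes X: "U_tnn n X" shows "ratio_limit X i * X (i + 1) j \<le> X i j"
proof (cases "i + 1 \<le> j \<and> X (i + 1) j \<noteq> 0")
  case True
  then have "0 < X (i + 1) j" using U_tnn_nonneg[OF X, of "i + 1" j] by simp
  then show ?thesis using ratio_limit_le_ratio[OF X, of i j] True by (simp add: field_simps)
next
  case False
  then have "X (i + 1) j = 0" using unitriD(2)[OF U_tnnD(1)[OF X], of j "i + 1"] by (cases "i + 1 \<le> j") auto
  then show ?thesis using U_tnn_nonneg[OF X] by simp
qed

lemma ratio_limit_period:
  assumes "periodic n X" shows "ratio_limit X (i + int n) = ratio_limit X i"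
proof -
  have X: "X (i + int n + 1) (j + int n) = X (i + 1) j" for j
    using periodic_shift[OF assms, of "i + 1" j] by (simp add: algebra_simps)
  have "{i + int n + 1..} = (\<lambda>j. j + int n) ` {i + 1..}"
  proof (intro equalityI subsetI)
    fix x assume "x \<in> {i + int n + 1..}"
    then show "x \<in> (\<lambda>j. j + int n) ` {i + 1..}" by (intro image_eqI[of _ _ "x - int n"]) auto
  qed auto
  then have "(\<lambda>j. X (i + int n) j / X (i + int n + 1) j) ` {i + int n + 1..} =
      (\<lambda>j. X (i + int n) (j + int n) / X (i + int n + 1) (j + int n)) ` {i + 1..}"
    by (simp only: image_image)
  then show ?thesis by (simp only: ratio_limit_def X periodic_shift[OF assms])
qed

lemma eventually_ge_int: "eventually (\<lambda>j::int. c \<le> j) at_top"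
  by (rule eventually_ge_at_top)

lemma ratio_tendsto_icurl:
  assumes X: "U_tnn n X" and p: "all_pos X" and "i \<le> k"
  shows "((\<lambda>j. X i j / X k j) \<longlongrightarrow> icurl (ratio_limit X) i k) at_top"
  using \<open>i \<le> k\<close>
proof (induction k rule: int_ge_induct)
  case base
  have nz: "X i j \<noteq> 0" if "i \<le> j" for j using p that by (auto simp: all_pos_def less_le)
  have "eventually (\<lambda>j. X i j / X i j = 1) at_top"
    using eventually_ge_int[of i] by eventually_elim (simp add: nz)
  then show ?case unfolding unitriD(1)[OF unitri_icurl] by (rule tendsto_eventually)
next
  case (step k)
  have nz: "X k j \<noteq> 0" if "k \<le> j" for j using p that by (auto simp: all_pos_def less_le)
  have "eventually (\<lambda>j. X i j / X k j * (X k j / X (k + 1) j) = X i j / X (k + 1) j) at_top"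
    using eventually_ge_int[of k] by eventually_elim (simp add: nz)
  moreover have "((\<lambda>j. X i j / X k j * (X k j / X (k + 1) j)) \<longlongrightarrow> icurl (ratio_limit X) i k * ratio_limit X k) at_top"
    by (intro tendsto_mult step.IH ratio_limit_tendsto[OF X p])
  ultimately show ?case
    unfolding icurl_step[OF step.hyps] by (rule Lim_transform_eventually[rotated])
qed

text \<open>
  The product of \<open>\<epsilon>\<close> over a period is the limit of the ratio of the entries \<open>(i, j)\<close> and \<open>(i + n, j)\<close>,
  and the latter equals the entry \<open>(i, j - n)\<close>. So the product controls the growth along a row.
\<close>

lemma growth_upper:
  assumes n: "n \<ge> 1" and X: "U_tnn n X" and p: "all_pos X" and s: "0 < \<sigma>"
    and lt: "\<And>i. icurl (ratio_limit X) i (i + int n) < \<sigma> ^ n"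
  shows "\<exists>C. \<forall>i m. X i (i + int m) \<le> C * \<sigma> ^ m"
proof -
  have per: "\<And>i j. X (i + int n) (j + int n) = X i j" using U_tnnD(2)[OF X] by (simp add: periodic_def)
  have "\<exists>J. \<forall>j\<ge>J. X i j \<le> \<sigma> ^ n * X (i + int n) j" for i
  proof -
    have "eventually (\<lambda>j. X i j / X (i + int n) j < \<sigma> ^ n) at_top"
      by (rule order_tendstoD(2)[OF ratio_tendsto_icurl[OF X p]]) (use lt in auto)
    then have "eventually (\<lambda>j. X i j \<le> \<sigma> ^ n * X (i + int n) j) at_top"
      using eventually_ge_int[of "i + int n"]
    proof eventually_elim
      case (elim j)
      then have "0 < X (i + int n) j" using p by (simp add: all_pos_def)
      then show ?case using elim by (simp add: divide_less_eq)
    qed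
    then show ?thesis by (simp add: eventually_at_top_linorder)
  qed
  then obtain J where J: "\<And>i j. J i \<le> j \<Longrightarrow> X i j \<le> \<sigma> ^ n * X (i + int n) j" by metis
  define D where "D = nat (Max ((\<lambda>i. J i - i) ` {0..<int n})) + n"
  have main: "X i (i + int m) \<le> \<sigma> ^ n * X (i + int n) (i + int m)" if m: "D \<le> m" for i m
  proof -
    define r where "r = i mod int n"
    define k where "k = i div int n"
    have i: "i = r + k * int n" by (simp add: r_def k_def)
    have "J r - r \<le> Max ((\<lambda>i. J i - i) ` {0..<int n})"
      by (rule Max_ge) (use n in \<open>auto simp: r_def\<close>)
    then have "J r \<le> r + int m" using m by (auto simp: D_def)
    from J[OF this] have "X r (r + int m) \<le> \<sigma> ^ n * X (r + int n) (r + int m)" .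
    moreover have "X i (i + int m) = X r (r + int m)" "X (i + int n) (i + int m) = X (r + int n) (r + int m)"
      using periodic_multiple[OF U_tnnD(2)[OF X], of r k "r + int m"]
        periodic_multiple[OF U_tnnD(2)[OF X], of "r + int n" k "r + int m"]
      by (auto simp: i algebra_simps)
    ultimately show ?thesis by simp
  qed
  obtain C where C: "C \<ge> 0" "\<And>i m. m \<le> D \<Longrightarrow> X i (i + int m) / \<sigma> ^ m \<le> C"
  proof -
    have "X (i + int n) (i + int n + int m) / \<sigma> ^ m = X i (i + int m) / \<sigma> ^ m" for i m
      using per[of i "i + int m"] by (simp add: algebra_simps)
    then show ?thesis using period_bound[OF n, of "\<lambda>i m. X i (i + int m) / \<sigma> ^ m" D] that by blast
  qed
  have "X i (i + int m) \<le> C * \<sigma> ^ m" for i m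
  proof (induction m arbitrary: i rule: less_induct)
    case (less m)
    show ?case
    proof (cases "m \<le> D")
      case True
      then show ?thesis using C(2)[of m i] s by (simp add: divide_simps)
    next
      case False
      then have nm: "n \<le> m" by (simp add: D_def)
      have "X i (i + int m) \<le> \<sigma> ^ n * X (i + int n) (i + int m)" using main False by simp
      also have "X (i + int n) (i + int m) = X (i + int n) (i + int n + int (m - n))" using nm by (simp add: of_nat_diff)
      also have "\<sigma> ^ n * \<dots> \<le> \<sigma> ^ n * (C * \<sigma> ^ (m - n))"
        by (rule mult_left_mono[OF less]) (use s n nm in auto)
      also have "\<dots> = C * (\<sigma> ^ n * \<sigma> ^ (m - n))" by simp
      also have "\<sigma> ^ n * \<sigma> ^ (m - n) = \<sigma> ^ m" using nm by (simp add: power_add[symmetric])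
      finally show ?thesis .
    qed
  qed
  then show ?thesis by blast
qed

text \<open>
  One vanishing limit makes the product over every period vanish, and then the entries decay faster than
  every geometric sequence.
\<close>

lemma ratio_limit_pos:
  assumes n: "n \<ge> 1" and X: "U_tnn n X" and ne: "\<not> entire_growth X"
  shows "0 < ratio_limit X i"
proof (rule ccontr)
  assume "\<not> 0 < ratio_limit X i"
  then have z: "ratio_limit X i = 0" using ratio_limit_nonneg[OF X, of i] by simp
  have p: "all_pos X" using not_entire_positive[OF n X ne] by (simp add: all_pos_def)
  have zero: "icurl (ratio_limit X) r (r + int n) = 0" for r
  proof -
    define k where "k = - ((i - r) div int n)"
    have "i + k * int n - r = (i - r) mod int n"
      using div_mult_mod_eq[of "i - r" "int n"] by (simp add: k_def algebra_simps)
    moreover have "0 \<le> (i - r) mod int n" "(i - r) mod int n < int n" using n by auto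
    ultimately have "i + k * int n \<in> {r..<r + int n}" by (simp only: atLeastLessThan_iff) linarith
    moreover have "ratio_limit X (i + k * int n) = 0"
      using period_multiple[of "ratio_limit X" "int n" i k] ratio_limit_period[OF U_tnnD(2)[OF X]] z by simp
    ultimately show ?thesis using n by (auto simp: icurl_def intro!: prod_zero)
  qed
  have "entire_growth X"
    unfolding entire_growth_def
  proof (intro allI impI)
    fix \<rho> :: real assume \<rho>: "0 < \<rho>"
    obtain C where C: "\<And>i m. X i (i + int m) \<le> C * (1 / \<rho>) ^ m"
      using growth_upper[OF n X p, of "1 / \<rho>"] zero \<rho> by auto
    have "\<bar>X i (i + int m)\<bar> * \<rho> ^ m \<le> C" for i m
      using C[of i m] \<rho> U_tnn_nonneg[OF X, of i "i + int m"] by (simp add: field_simps)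
    then show "\<exists>C. \<forall>i m. \<bar>X i (i + int m)\<bar> * \<rho> ^ m \<le> C" by blast
  qed
  then show False using ne by simp
qed

lemma icurl_ratio_limit_le:
  assumes X: "U_tnn n X" shows "icurl (ratio_limit X) i j \<le> X i j"
proof (cases "i \<le> j")
  case True
  then show ?thesis
  proof (induction i rule: int_le_induct)
    case base then show ?case using unitriD(1)[OF unitri_icurl] unitriD(1)[OF U_tnnD(1)[OF X]] by simp
  next
    case (step i)
    have "icurl (ratio_limit X) (i - 1) j = ratio_limit X (i - 1) * icurl (ratio_limit X) i j"
      using icurl_rec[of "i - 1" j] step.hyps by simp
    also have "\<dots> \<le> ratio_limit X (i - 1) * X i j"
      by (rule mult_left_mono[OF step.IH ratio_limit_nonneg[OF X]])
    also have "\<dots> \<le> X (i - 1) j" using ratio_limit_mult_le[OF X, of "i - 1" j] by simp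
    finally show ?case .
  qed
next
  case False
  then show ?thesis using unitriD(2)[OF unitri_icurl] unitriD(2)[OF U_tnnD(1)[OF X]] by simp
qed

lemma icurl_lower:
  assumes n: "n \<ge> 1" and per: "\<And>i. a (i + int n) = a i" and pos: "\<And>i. 0 < a i"
  shows "\<exists>r>0. \<forall>i m. r ^ m \<le> icurl a i (i + int m)"
proof -
  define r where "r = Min (a ` {0..<int n})"
  have r0: "0 < r" unfolding r_def using n pos by (subst Min_gr_iff) auto
  have ra: "r \<le> a i" for i
  proof -
    have "a i = a (i mod int n + (i div int n) * int n)" by simp
    also have "\<dots> = a (i mod int n)" by (rule period_multiple) (rule per)
    finally have "a i = a (i mod int n)" .
    moreover have "r \<le> a (i mod int n)" unfolding r_def by (rule Min_le) (use n in auto)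
    ultimately show ?thesis by simp
  qed
  have "r ^ m \<le> icurl a i (i + int m)" for i m
  proof (induction m)
    case (Suc m)
    have "r ^ m * r \<le> icurl a i (i + int m) * a (i + int m)"
      by (rule mult_mono[OF Suc ra]) (use r0 Suc in \<open>auto intro: order_trans[OF _ Suc]\<close>)
    then show ?case using icurl_step[of i "i + int m" a] by (simp add: algebra_simps)
  qed (simp add: unitriD(1)[OF unitri_icurl])
  then show ?thesis using r0 by blast
qed

lemma not_entire_if_ge:
  assumes r: "0 < r" and ge: "\<And>i m. r ^ m \<le> X i (i + int m)"
  shows "\<not> entire_growth X"
proof
  assume "entire_growth X"
  then obtain C where C: "\<And>i m. \<bar>X i (i + int m)\<bar> * (2 / r) ^ m \<le> C"
    unfolding entire_growth_def using r by (meson divide_pos_pos zero_less_numeral)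
  obtain m where m: "C < 2 ^ m" using real_arch_pow[of 2 C] by auto
  have "2 ^ m = r ^ m * (2 / r) ^ m" using r by (simp add: power_divide)
  also have "\<dots> \<le> \<bar>X 0 (0 + int m)\<bar> * (2 / r) ^ m"
    by (rule mult_right_mono) (use ge[of m 0] r in auto)
  also have "\<dots> \<le> C" by (rule C)
  finally show False using m by simp
qed

section \<open>Stripping off a curl\<close>

text \<open>
  Entire matrices are left alone, so that every curl that is stripped off is either non-degenerate or
  the identity.
\<close>

definition curl_params :: "bimat \<Rightarrow> int \<Rightarrow> real" where
  "curl_params X = (if entire_growth X then (\<lambda>_. 0) else ratio_limit X)"

definition strip_curl :: "bimat \<Rightarrow> bimat" where
  "strip_curl X = (\<lambda>i j. X i j - curl_params X i * X (i + 1) j)"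

lemma strip_curl_mult: "strip_curl X = bi_mult (iwhirl (\<lambda>k. - curl_params X k)) X"
  by (simp add: strip_curl_def fun_eq_iff iwhirl_mult)

lemma unitri_strip_curl: "unitri X \<Longrightarrow> unitri (strip_curl X)"
  by (simp add: strip_curl_mult unitri_mult unitri_iwhirl)

lemma strip_curl_inverse: "unitri X \<Longrightarrow> bi_mult (icurl (curl_params X)) (strip_curl X) = X"
  unfolding strip_curl_mult unitri_inv_icurl[symmetric] by (rule cancel_left'[OF unitri_icurl])

lemma strip_curl_entire: "entire_growth X \<Longrightarrow> strip_curl X = X"
  by (simp add: strip_curl_def curl_params_def)

lemma curl_params_nonneg: "U_tnn n X \<Longrightarrow> 0 \<le> curl_params X i"
  using ratio_limit_nonneg by (simp add: curl_params_def)

lemma curl_params_period: "periodic n X \<Longrightarrow> curl_params X (i + int n) = curl_params X i"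
  using ratio_limit_period by (simp add: curl_params_def)

lemma periodic_strip_curl:
  assumes "periodic n X" shows "periodic n (strip_curl X)"
proof -
  have "X (i + int n + 1) (j + int n) = X (i + 1) j" for i j
    using periodic_shift[OF assms, of "i + 1" j] by (simp add: algebra_simps)
  then show ?thesis
    by (simp add: periodic_def strip_curl_def curl_params_period[OF assms] periodic_shift[OF assms])
qed

text \<open>
  A virtual column with entries \<open>u r\<close>, the limits of the ratios of the entries \<open>(r, j)\<close> and \<open>(l + 1, j)\<close>
  for large \<open>j\<close>, is adjoined to the right of the window. Minors that use it are limits of rescaled minors
  of \<open>X\<close>. As \<open>u r\<close> is \<open>\<epsilon>\<^sub>r\<close> times \<open>u (r + 1)\<close>, stripping the curl clears this column, row by row from the top.
\<close>

lemma strip_curl_tnn: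
  assumes n: "n \<ge> 1" and X: "U_tnn n X" and ne: "\<not> entire_growth X"
  shows "tnn_on UNIV UNIV (strip_curl X)"
proof (rule tnn_windows)
  fix a l :: int assume al: "a \<le> l"
  have p: "all_pos X" using not_entire_positive[OF n X ne] by (simp add: all_pos_def)
  have ep: "0 < ratio_limit X i" for i by (rule ratio_limit_pos[OF n X ne])
  let ?W = "{a..l + 1}"
  define u where "u r = icurl (ratio_limit X) r (l + 1)" for r
  define A where "A r c = (if c \<le> l then X r c else u r)" for r c
  have uu: "u r = ratio_limit X r * u (r + 1)" if "r \<le> l" for r
    using icurl_rec[of r "l + 1"] that by (simp add: u_def)
  have u0: "0 < u r" if "r \<le> l + 1" for r
    using that ep by (auto simp: u_def icurl_def intro!: prod_pos)
  have A: "tnn_on ?W ?W A"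
  proof (rule tnn_limit)
    show "eventually (\<lambda>j. tnn_on ?W ?W (\<lambda>r c. if c \<le> l then X r c else X r j / X (l + 1) j)) at_top"
      using eventually_ge_int[of "l + 1"]
    proof eventually_elim
      case (elim j)
      have 1: "tnn_on ?W ?W (\<lambda>r c. X r (if c \<le> l then c else j))"
        by (rule tnn_col_relabel[OF tnn_subset[OF U_tnnD(3)[OF X], of ?W UNIV]])
          (use elim in \<open>auto simp: strict_mono_on_def\<close>)
      show ?case
        by (rule tnn_col_scale[OF 1, of "1 / X (l + 1) j" _ "l + 1"]) (use U_tnn_nonneg[OF X] in auto)
    qed
    fix r c assume "r \<in> ?W" "c \<in> ?W"
    then show "((\<lambda>j. if c \<le> l then X r c else X r j / X (l + 1) j) \<longlongrightarrow> A r c) at_top"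
      using ratio_tendsto_icurl[OF X p, of r "l + 1"] by (auto simp: A_def u_def)
  qed simp
  \<comment> \<open>In \<open>B b\<close> the virtual column is cleared in the rows above \<open>b\<close>.\<close>
  define B where "B b r c = (if r < b then A r c - ratio_limit X r * A (r + 1) c else A r c)" for b r c
  have "tnn_on ?W ?W (B b)" if "a \<le> b" "b \<le> l + 1" for b
    using that
  proof (induction b rule: int_ge_induct)
    case base
    show ?case by (rule tnn_cong[OF A]) (auto simp: B_def)
  next
    case (step b)
    have Bl: "B b r (l + 1) = (if r < b then 0 else u r)" if "r \<le> l" for r
      using uu[OF that] by (simp add: B_def A_def)
    have "tnn_on ?W ?W ((B b)(b := \<lambda>c. B b b c - ratio_limit X b * B b (b + 1) c))"
    proof (rule tnn_eliminate[OF step.IH, of "l + 1"])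
      show "B b b (l + 1) = ratio_limit X b * B b (b + 1) (l + 1)" using uu[of b] step.prems by (simp add: B_def A_def)
      show "0 < B b (b + 1) (l + 1)" using u0[of "b + 1"] step.prems by (simp add: B_def A_def)
    qed (use step Bl in auto)
    moreover have "(B b)(b := \<lambda>c. B b b c - ratio_limit X b * B b (b + 1) c) = B (b + 1)"
      by (auto simp: B_def fun_eq_iff)
    ultimately show ?case by simp
  qed
  then have "tnn_on ?W ?W (B (l + 1))" using al by simp
  then have "tnn_on {a..l} {a..l} (B (l + 1))" by (rule tnn_subset) auto
  then show "tnn_on {a..l} {a..l} (strip_curl X)"
    by (rule tnn_cong) (use ne in \<open>auto simp: B_def A_def strip_curl_def curl_params_def\<close>)
qed

lemma U_tnn_strip_curl:
  assumes "n \<ge> 1" "U_tnn n X" shows "U_tnn n (strip_curl X)"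
proof (cases "entire_growth X")
  case True then show ?thesis using assms strip_curl_entire by simp
next
  case False
  then show ?thesis using strip_curl_tnn[OF assms False] U_tnnD[OF assms(2)] unitri_strip_curl periodic_strip_curl
    by (simp add: U_tnn_def)
qed

lemma strip_curl_le: "U_tnn n X \<Longrightarrow> strip_curl X i j \<le> X i j"
  using curl_params_nonneg[of n X i] U_tnn_nonneg[of n X "i + 1" j] by (simp add: strip_curl_def)

section \<open>Products of curls and the curl-free part\<close>

lemma period_icurl:
  assumes per: "\<And>i. a (i + int n) = a i"
  shows "periodic n (icurl a)"
proof -
  have "icurl a (i + int n) (j + int n) = icurl a i j" for i j
  proof -
    have "(\<Prod>k\<in>{i + int n..<j + int n}. a k) = (\<Prod>k\<in>{i..<j}. a k)"
      by (rule prod.reindex_bij_witness[of _ "\<lambda>k. k + int n" "\<lambda>k. k - int n"]) (use per[of "_ - int n"] in auto)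
    then show ?thesis by (simp add: icurl_def)
  qed
  then show ?thesis by (simp add: periodic_def)
qed

lemma period_prod:
  assumes n: "n \<ge> 1" and per: "\<And>i. a (i + int n) = a i"
  shows "icurl a i (i + int n) = icurl a 0 (int n)"
proof -
  have "icurl a (i + 1) (i + 1 + int n) = icurl a i (i + int n)" for i
  proof -
    have "icurl a (i + 1) (i + int n + 1) = icurl a (i + 1) (i + int n) * a (i + int n)"
      by (rule icurl_step) (use n in auto)
    also have "\<dots> = a i * icurl a (i + 1) (i + int n)" by (simp add: per)
    also have "\<dots> = icurl a i (i + int n)" by (rule icurl_rec[symmetric]) (use n in auto)
    finally show ?thesis by (simp add: algebra_simps)
  qed
  then show ?thesis using period_multiple[of "\<lambda>i. icurl a i (i + int n)" 1 0 i] by simp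
qed

lemma periodic_mult:
  assumes "unitri X" "unitri Y" "periodic n X" "periodic n Y"
  shows "periodic n (bi_mult X Y)"
proof -
  have "bi_mult X Y (i + int n) (j + int n) = bi_mult X Y i j" for i j
    unfolding bi_mult_unitri[OF assms(1,2)]
  proof (rule sum.reindex_bij_witness[of _ "\<lambda>k. k + int n" "\<lambda>k. k - int n"])
    fix k assume "k \<in> {i + int n..j + int n}"
    show "X i (k - int n) * Y (k - int n) j = X (i + int n) k * Y k (j + int n)"
      using periodic_shift[OF assms(3), of i "k - int n"] periodic_shift[OF assms(4), of "k - int n" j] by simp
  qed auto
  then show ?thesis by (simp add: periodic_def)
qed

lemma U_tnn_icurl_mult:
  assumes T: "U_tnn n T" and per: "\<And>i. a (i + int n) = a i" and a: "\<And>i. 0 \<le> a i"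
  shows "U_tnn n (bi_mult (icurl a) T)"
  unfolding U_tnn_def
  using unitri_mult[OF unitri_icurl U_tnnD(1)[OF T], of a] icurl_mult_tnn[OF U_tnnD(1,3)[OF T] a]
    periodic_mult[OF unitri_icurl U_tnnD(1)[OF T] period_icurl[of a, OF per] U_tnnD(2)[OF T]] by simp

lemma tnn_bi_id: "tnn_on UNIV UNIV bi_id"
proof (rule tnn_windows)
  fix a l :: int assume "a \<le> l"
  have w: "tnn_on {a..a + int d - 1} {a..a + int d - 1} bi_id" for d
  proof (induction d)
    case 0
    show ?case by (rule tnnI) (auto simp: )
  next
    case (Suc d)
    have "tnn_on {a..a + int d} {a..a + int d} bi_id"
      by (rule tnn_extend_window[OF unitri_bi_id Suc]) (auto simp: bi_id_def)
    then show ?case by (simp add: algebra_simps)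
  qed
  show "tnn_on {a..l} {a..l} bi_id" using w[of "nat (l + 1 - a)"] \<open>a \<le> l\<close> by simp
qed

lemma U_tnn_bi_id: "U_tnn n bi_id"
  by (simp add: U_tnn_def unitri_bi_id tnn_bi_id) (simp add: periodic_def bi_id_def)

lemma U_tnn_lim:
  assumes F: "\<And>k. U_tnn n (F k)" and lim: "entrywise_lim F X"
  shows "U_tnn n X"
proof -
  have l: "(\<lambda>k. F k i j) \<longlonglongrightarrow> X i j" for i j using lim by (simp add: entrywise_lim_def)
  have "X (i + int n) (j + int n) = X i j" for i j
    using LIMSEQ_unique[OF l[of "i + int n" "j + int n"]] l[of i j] by (simp add: periodic_shift[OF U_tnnD(2)[OF F]])
  moreover have "tnn_on UNIV UNIV X"
    by (rule tnn_limit[OF sequentially_bot always_eventually]) (use U_tnnD(3)[OF F] l in auto)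
  ultimately show ?thesis using unitri_lim[OF U_tnnD(1)[OF F] lim] by (simp add: U_tnn_def periodic_def)
qed

fun curl_prod :: "(nat \<Rightarrow> int \<Rightarrow> real) \<Rightarrow> nat \<Rightarrow> bimat" where
  "curl_prod a 0 = bi_id"
| "curl_prod a (Suc k) = bi_mult (curl_prod a k) (icurl (a k))"

lemma unitri_curl_prod: "unitri (curl_prod a k)"
  by (induction k) (simp_all add: unitri_bi_id unitri_mult unitri_icurl)

lemma U_tnn_curl_prod_mult:
  assumes "U_tnn n T" and per: "\<And>k i. a k (i + int n) = a k i" and a: "\<And>k i. 0 \<le> a k i"
  shows "U_tnn n (bi_mult (curl_prod a k) T)"
  using assms(1)
proof (induction k arbitrary: T)
  case (Suc k)
  have "U_tnn n (bi_mult (curl_prod a k) (bi_mult (icurl (a k)) T))"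
    by (intro Suc.IH U_tnn_icurl_mult Suc.prems per a)
  then show ?case by (simp add: bi_mult_assoc unitri_curl_prod unitri_icurl U_tnnD(1)[OF Suc.prems])
qed simp

lemma U_tnn_curl_prod:
  assumes "\<And>k i. a k (i + int n) = a k i" "\<And>k i. 0 \<le> a k i"
  shows "U_tnn n (curl_prod a k)"
proof -
  have "U_tnn n (bi_mult (curl_prod a k) bi_id)"
    by (rule U_tnn_curl_prod_mult[OF U_tnn_bi_id]) (use assms in auto)
  then show ?thesis by simp
qed

lemma curl_prod_add: "curl_prod a (K + k) = bi_mult (curl_prod a K) (curl_prod (\<lambda>i. a (K + i)) k)"
  by (induction k) (simp_all add: bi_mult_assoc unitri_curl_prod unitri_icurl)

lemma entire_growth_mono:
  assumes "\<And>i j. \<bar>A i j\<bar> \<le> \<bar>B i j\<bar>" "entire_growth B" shows "entire_growth A"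
  unfolding entire_growth_def
proof (intro allI impI)
  fix \<rho> :: real assume r: "0 < \<rho>"
  then obtain C where C: "\<And>i m. \<bar>B i (i + int m)\<bar> * \<rho> ^ m \<le> C"
    using assms(2) unfolding entire_growth_def by meson
  have "\<bar>A i (i + int m)\<bar> * \<rho> ^ m \<le> C" for i m
    by (rule order_trans[OF mult_right_mono[OF assms(1)] C]) (use r in simp)
  then show "\<exists>C. \<forall>i m. \<bar>A i (i + int m)\<bar> * \<rho> ^ m \<le> C" by blast
qed

abbreviation stripped :: "bimat \<Rightarrow> nat \<Rightarrow> bimat" where
  "stripped X k \<equiv> (strip_curl ^^ k) X"

text \<open>
  The limit exists because the stripped matrices decrease entrywise and stay nonnegative.
\<close>

definition curl_free_part :: "bimat \<Rightarrow> bimat" where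
  "curl_free_part X = (\<lambda>i j. lim (\<lambda>k. stripped X k i j))"

context
  fixes n :: nat and X :: bimat
  assumes n: "n \<ge> 1" and X: "U_tnn n X"
begin

lemma U_tnn_stripped: "U_tnn n (stripped X k)"
  by (induction k) (simp_all add: X U_tnn_strip_curl[OF n])

lemma stripped_decseq: "decseq (\<lambda>k. stripped X k i j)"
  by (rule decseq_SucI) (simp add: strip_curl_le[OF U_tnn_stripped])

lemma curl_free_part_lim: "entrywise_lim (stripped X) (curl_free_part X)"
  unfolding entrywise_lim_def
proof (intro allI)
  fix i j
  have "convergent (\<lambda>k. stripped X k i j)"
    using decseq_convergent[OF stripped_decseq[of i j], of 0] U_tnn_nonneg[OF U_tnn_stripped]
    by (metis convergentI)
  then show "(\<lambda>k. stripped X k i j) \<longlonglongrightarrow> curl_free_part X i j" by (simp add: curl_free_part_def convergent_LIMSEQ_iff)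
qed

lemma U_tnn_curl_free_part: "U_tnn n (curl_free_part X)"
  by (rule U_tnn_lim[OF U_tnn_stripped curl_free_part_lim])

lemma curl_free_part_le: "curl_free_part X i j \<le> stripped X k i j"
  using decseq_ge[OF stripped_decseq] curl_free_part_lim by (simp add: entrywise_lim_def)

text \<open>
  Superdiagonal entries add under multiplication of unitriangular matrices; this is the source of the
  summability of the parameters.
\<close>

lemma curl_params_partial_sum: "(\<Sum>k<K. curl_params (stripped X k) i) = X i (i + 1) - stripped X K i (i + 1)"
proof (induction K)
  case (Suc K)
  have "stripped X K (i + 1) (i + 1) = 1" by (rule unitriD(1)[OF U_tnnD(1)[OF U_tnn_stripped]])
  moreover have "stripped X (Suc K) i (i + 1) =
      stripped X K i (i + 1) - curl_params (stripped X K) i * stripped X K (i + 1) (i + 1)"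
    unfolding funpow.simps comp_def strip_curl_def[of "stripped X K"] ..
  ultimately show ?case using Suc by simp
qed simp

lemma curl_params_summable: "summable (\<lambda>k. curl_params (stripped X k) i)"
  and curl_params_sum_le: "(\<Sum>k<K. curl_params (stripped X k) i) \<le> X i (i + 1)"
proof -
  show le: "(\<Sum>k<K. curl_params (stripped X k) i) \<le> X i (i + 1)" for K
    using curl_params_partial_sum[of i K] U_tnn_nonneg[OF U_tnn_stripped, of K i "i + 1"] by simp
  show "summable (\<lambda>k. curl_params (stripped X k) i)"
    by (rule summableI_nonneg_bounded[OF curl_params_nonneg[OF U_tnn_stripped] le])
qed

lemma curl_params_tendsto: "(\<lambda>k. curl_params (stripped X k) i) \<longlonglongrightarrow> 0"
  by (rule summable_LIMSEQ_zero[OF curl_params_summable])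

lemma curl_params_prod_tendsto: "(\<lambda>k. icurl (curl_params (stripped X k)) 0 (int n)) \<longlonglongrightarrow> 0"
proof -
  have "(\<lambda>k. \<Prod>m\<in>{0..<int n}. curl_params (stripped X k) m) \<longlonglongrightarrow> (\<Prod>m\<in>{0..<int n}. 0)"
    by (intro tendsto_prod curl_params_tendsto)
  then show ?thesis using n by (simp add: icurl_def power_0_left)
qed

lemma curl_prod_stripped: "bi_mult (curl_prod (\<lambda>k. curl_params (stripped X k)) k) (stripped X k) = X"
proof (induction k)
  case (Suc k)
  have "bi_mult (icurl (curl_params (stripped X k))) (strip_curl (stripped X k)) = stripped X k"
    by (rule strip_curl_inverse[OF U_tnnD(1)[OF U_tnn_stripped]])
  then show ?case
    using Suc by (simp add: bi_mult_assoc unitri_curl_prod unitri_icurl unitri_strip_curl U_tnnD(1)[OF U_tnn_stripped])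
qed simp

text \<open>
  The product of the first \<open>k\<close> stripped curls is \<open>X\<close> times the inverse of \<open>stripped X k\<close>, so it converges along with
  the stripped matrices.
\<close>

lemma curl_prod_curl_params_lim: "entrywise_lim (curl_prod (\<lambda>k. curl_params (stripped X k))) (bi_mult X (unitri_inv (curl_free_part X)))"
proof -
  have eq: "curl_prod (\<lambda>k. curl_params (stripped X k)) k = bi_mult X (unitri_inv (stripped X k))" for k
    using cancel_right[OF unitri_curl_prod U_tnnD(1)[OF U_tnn_stripped[of k]], of "\<lambda>k. curl_params (stripped X k)" k] by (simp add: curl_prod_stripped)
  show ?thesis
    unfolding eq
    by (rule bi_mult_lim) (use U_tnnD(1)[OF X] in \<open>auto intro: unitri_unitri_inv entrywise_lim_const unitri_inv_lim curl_free_part_lim\<close>)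
qed

text \<open>
  The growth rate of a stripped matrix is the product of its limits of ratios over a period. These
  products tend to \<open>0\<close>, and the curl-free part lies below all stripped matrices.
\<close>

lemma entire_curl_free_part: "entire_growth (curl_free_part X)"
proof (cases "\<exists>k. entire_growth (stripped X k)")
  case True
  then obtain k where k: "entire_growth (stripped X k)" by blast
  show ?thesis
    by (rule entire_growth_mono[OF _ k])
      (use curl_free_part_le U_tnn_nonneg[OF U_tnn_curl_free_part] U_tnn_nonneg[OF U_tnn_stripped] in auto)
next
  case False
  then have ne: "\<not> entire_growth (stripped X k)" for k by blast
  show ?thesis
    unfolding entire_growth_def
  proof (intro allI impI)
    fix \<rho> :: real assume \<rho>: "0 < \<rho>"
    have "eventually (\<lambda>k. icurl (curl_params (stripped X k)) 0 (int n) < (1 / \<rho>) ^ n) sequentially"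
      by (rule order_tendstoD(2)[OF curl_params_prod_tendsto]) (use \<rho> in simp)
    then obtain k where k: "icurl (curl_params (stripped X k)) 0 (int n) < (1 / \<rho>) ^ n"
      by (meson eventually_happens sequentially_bot)
    have ce: "curl_params (stripped X k) = ratio_limit (stripped X k)" using ne by (simp add: curl_params_def)
    have "icurl (curl_params (stripped X k)) i (i + int n) = icurl (curl_params (stripped X k)) 0 (int n)" for i
      by (rule period_prod[OF n]) (rule curl_params_period[OF U_tnnD(2)[OF U_tnn_stripped]])
    then have "icurl (ratio_limit (stripped X k)) i (i + int n) < (1 / \<rho>) ^ n" for i
      using k unfolding ce by metis
    moreover have "all_pos (stripped X k)"
      using not_entire_positive[OF n U_tnn_stripped ne] by (simp add: all_pos_def)
    ultimately obtain C where C: "\<And>i m. stripped X k i (i + int m) \<le> C * (1 / \<rho>) ^ m"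
      using growth_upper[OF n U_tnn_stripped, of k "1 / \<rho>"] \<rho> by auto
    have "\<bar>curl_free_part X i (i + int m)\<bar> * \<rho> ^ m \<le> C" for i m
      using order_trans[OF curl_free_part_le C, of i m] \<rho> U_tnn_nonneg[OF U_tnn_curl_free_part, of i "i + int m"]
      by (simp add: field_simps)
    then show "\<exists>C. \<forall>i m. \<bar>curl_free_part X i (i + int m)\<bar> * \<rho> ^ m \<le> C" by blast
  qed
qed

end

section \<open>The curl-free part of a product\<close>

lemma tendsto_half_power: "((\<lambda>j::int. (1 / 2 :: real) ^ nat (j - k)) \<longlongrightarrow> 0) at_top"
proof (rule filterlim_compose[of "\<lambda>m. (1 / 2 :: real) ^ m" _ sequentially])
  show "(\<lambda>m. (1 / 2 :: real) ^ m) \<longlonglongrightarrow> 0" by (rule LIMSEQ_power_zero) simp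
  show "filterlim (\<lambda>j. nat (j - k)) sequentially at_top"
    unfolding filterlim_at_top
  proof
    fix Z :: nat
    show "eventually (\<lambda>j. Z \<le> nat (j - k)) at_top"
      by (rule eventually_at_top_linorderI[of "k + int Z"]) auto
  qed
qed

text \<open>
  The entries of an entire matrix decay faster than a geometric sequence with half the given ratio.
\<close>

lemma entire_ratio_tendsto:
  assumes Q: "U_tnn n Q" "entire_growth Q" and r: "0 < r"
    and X: "\<And>m::nat. r ^ m \<le> X i (i + int m)"
  shows "((\<lambda>j. Q k j / X i j) \<longlongrightarrow> 0) at_top"
proof -
  obtain C where C: "\<And>i m. \<bar>Q i (i + int m)\<bar> * (2 / r) ^ m \<le> C"
    using Q(2) r unfolding entire_growth_def by (meson divide_pos_pos zero_less_numeral)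
  have C0: "0 \<le> C" using C[of k 0] by (metis abs_ge_zero mult.right_neutral order_trans power_0)
  define K where "K = r powi (i - k)"
  have bound: "Q k j / X i j \<le> C * K * (1 / 2) ^ nat (j - k)" if j: "max i k \<le> j" for j
  proof -
    define p where "p = nat (j - k)"
    define q where "q = nat (j - i)"
    have jp: "j = k + int p" "j = i + int q" using j by (auto simp: p_def q_def)
    have "int p = int q + (i - k)" using jp by linarith
    then have "r powi (int p) = r powi (int q) * K"
      unfolding K_def using r by (metis power_int_add less_irrefl)
    then have rp: "r ^ p = r ^ q * K" by simp
    have "Q k j * (2 / r) ^ p \<le> C" using C[of k p] U_tnn_nonneg[OF Q(1), of k j] by (simp add: jp(1))
    then have "Q k j \<le> C * (1 / 2) ^ p * r ^ p" using r by (simp add: field_simps)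
    also have "\<dots> = (C * K * (1 / 2) ^ p) * r ^ q" by (simp add: rp)
    also have "\<dots> \<le> (C * K * (1 / 2) ^ p) * X i j"
      by (rule mult_left_mono) (use X[of q] jp(2) C0 r in \<open>auto simp: K_def\<close>)
    finally have "Q k j \<le> (C * K * (1 / 2) ^ p) * X i j" .
    moreover have "0 < X i j" using less_le_trans[OF _ X[of q]] r jp(2) by simp
    ultimately show ?thesis by (simp add: p_def divide_le_eq)
  qed
  have X0: "0 < X i j" if "i \<le> j" for j
    using less_le_trans[OF _ X[of "nat (j - i)"]] r that by simp
  show ?thesis
  proof (rule tendsto_sandwich)
    show "eventually (\<lambda>j. 0 \<le> Q k j / X i j) at_top"
      using eventually_ge_int[of i]
      by eventually_elim (use X0 U_tnn_nonneg[OF Q(1)] in \<open>auto intro!: divide_nonneg_pos\<close>)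
    show "eventually (\<lambda>j. Q k j / X i j \<le> C * K * (1 / 2) ^ nat (j - k)) at_top"
      using eventually_ge_int[of "max i k"] by eventually_elim (rule bound)
    show "((\<lambda>j. C * K * (1 / 2) ^ nat (j - k)) \<longlongrightarrow> 0) at_top"
      by (rule tendsto_mult_right_zero[OF tendsto_half_power])
  qed simp
qed

lemma mult_ge_left:
  assumes A: "unitri A" "\<And>i j. 0 \<le> A i j" and B: "U_tnn n B"
  shows "A i j \<le> bi_mult A B i j"
proof (cases "i \<le> j")
  case True
  have "A i j * B j j \<le> (\<Sum>k\<in>{i..j}. A i k * B k j)"
    by (rule member_le_sum) (use True A(2) U_tnn_nonneg[OF B] in auto)
  then show ?thesis by (simp add: bi_mult_unitri[OF A(1) U_tnnD(1)[OF B]] unitriD(1)[OF U_tnnD(1)[OF B]])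
next
  case False
  then show ?thesis using unitriD(2)[OF A(1)] unitriD(2)[OF unitri_mult[OF A(1) U_tnnD(1)[OF B]]] by simp
qed

lemma icurl_zero:
  assumes "\<And>i. a i = 0" shows "icurl a = bi_id"
proof (intro ext)
  fix i j :: int
  consider "j < i" | "j = i" | "i < j" by linarith
  then show "icurl a i j = bi_id i j"
    by cases (simp_all add: unitriD[OF unitri_icurl] icurl_rec assms bi_id_def)
qed

lemma icurl_nonneg: "(\<And>i. 0 \<le> a i) \<Longrightarrow> 0 \<le> icurl a i j"
  by (simp add: icurl_def prod_nonneg)

lemma icurl_shift: "icurl (\<lambda>i. g (i + 1)) i j = icurl g (i + 1) (j + 1)"
proof -
  have "(\<Prod>k\<in>{i..<j}. g (k + 1)) = (\<Prod>k\<in>{i + 1..<j + 1}. g k)"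
    by (rule prod.reindex_bij_witness[of _ "\<lambda>k. k - 1" "\<lambda>k. k + 1"]) auto
  then show ?thesis by (simp add: icurl_def)
qed

text \<open>
  Let \<open>S\<close> be the product of the curl of \<open>a\<close> with \<open>T\<close>, and let \<open>e\<close> and \<open>f\<close> be the limits of ratios of \<open>S\<close> and
  \<open>T\<close>. The difference \<open>d i = e i - a i\<close> is the limit of the ratio of the entries \<open>(i, j)\<close> of \<open>T\<close> and
  \<open>(i + 1, j)\<close> of \<open>S\<close>. Either \<open>T\<close> is negligible against \<open>S\<close>; then \<open>d = 0\<close>, the leading curl of \<open>S\<close> is that of
  \<open>a\<close>, and stripping it returns \<open>T\<close>. Or \<open>T\<close> and \<open>S\<close> grow at the same rate; then the leading curl of
  \<open>T\<close> is stripped first and the curl of \<open>a\<close> moves past it with changed parameters. The formula for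
  \<open>a'\<close> is the commutation relation between two curls.
\<close>

lemma curl_step_dichotomy:
  assumes n: "n \<ge> 1" and T: "U_tnn n T" and per: "\<And>i. a (i + int n) = a i" and a: "\<And>i. 0 < a i"
  shows "strip_curl (bi_mult (icurl a) T) = T \<or>
    (\<exists>a'. (\<forall>i. 0 < a' i) \<and> (\<forall>i. a' (i + int n) = a' i) \<and>
       strip_curl (bi_mult (icurl a) T) = bi_mult (icurl a') (strip_curl T) \<and>
       icurl a' 0 (int n) = icurl a 0 (int n) \<and> icurl a 0 (int n) \<le> icurl (curl_params T) 0 (int n))"
proof -
  define S where "S = bi_mult (icurl a) T"
  have S: "U_tnn n S" unfolding S_def by (rule U_tnn_icurl_mult[OF T, of a]) (use per a in \<open>auto simp: less_imp_le\<close>)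
  have Srec: "S i j = T i j + a i * S (i + 1) j" for i j
    unfolding S_def by (rule icurl_mult[OF U_tnnD(1)[OF T]])
  obtain r where r: "0 < r" "\<And>i m. r ^ m \<le> icurl a i (i + int m)"
    using icurl_lower[OF n, of a] per a by blast
  have Sr: "r ^ m \<le> S i (i + int m)" for i m
    using r(2)[of m i] mult_ge_left[OF unitri_icurl _ T, of a i "i + int m"] icurl_nonneg[of a] a
    unfolding S_def by (meson less_imp_le order_trans)
  have neS: "\<not> entire_growth S" by (rule not_entire_if_ge[OF r(1) Sr])
  have pS: "all_pos S" using not_entire_positive[OF n S neS] by (simp add: all_pos_def)
  have nz: "S i j \<noteq> 0" if "i \<le> j" for i j using pS that by (auto simp: all_pos_def less_le)
  define e where "e = ratio_limit S"
  have e: "0 < e i" for i unfolding e_def by (rule ratio_limit_pos[OF n S neS])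
  have eper: "e (i + int n) = e i" for i unfolding e_def by (rule ratio_limit_period[OF U_tnnD(2)[OF S]])
  define d where "d i = e i - a i" for i
  have dper: "d (i + int n) = d i" for i by (simp add: d_def eper per)
  have dlim: "((\<lambda>j. T i j / S (i + 1) j) \<longlongrightarrow> d i) at_top" for i
  proof -
    have "((\<lambda>j. S i j / S (i + 1) j - a i) \<longlongrightarrow> d i) at_top"
      unfolding d_def e_def by (intro tendsto_diff ratio_limit_tendsto[OF S pS] tendsto_const)
    moreover have "eventually (\<lambda>j. S i j / S (i + 1) j - a i = T i j / S (i + 1) j) at_top"
      using eventually_ge_int[of "i + 1"]
    proof eventually_elim
      case (elim j)
      then show ?case using nz[of "i + 1" j] Srec[of i j] by (simp add: field_simps)
    qed
    ultimately show ?thesis by (rule Lim_transform_eventually)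
  qed
  have d0: "0 \<le> d i" for i
    by (rule tendsto_lowerbound[OF dlim]) (auto intro!: always_eventually divide_nonneg_nonneg U_tnn_nonneg[OF T] U_tnn_nonneg[OF S])
  have cS: "strip_curl S i j = T i j - d i * S (i + 1) j" for i j
    using neS Srec[of i j] by (simp add: strip_curl_def curl_params_def d_def e_def algebra_simps)
  have zero: "strip_curl S = T" if "\<And>i. d i = 0" using that by (simp add: cS fun_eq_iff)
  show ?thesis
  proof (cases "entire_growth T")
    case True
    have "d i = 0" for i
    proof -
      have "((\<lambda>j. T i j / S (i + 1) j) \<longlongrightarrow> 0) at_top"
        by (rule entire_ratio_tendsto[OF T True r(1)]) (rule Sr)
      from tendsto_unique[OF _ dlim[of i] this] show ?thesis by simp
    qed
    then show ?thesis using zero by (simp add: S_def)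
  next
    case False
    define f where "f = ratio_limit T"
    have f: "0 < f i" for i unfolding f_def by (rule ratio_limit_pos[OF n T False])
    have fper: "f (i + int n) = f i" for i unfolding f_def by (rule ratio_limit_period[OF U_tnnD(2)[OF T]])
    have pT: "all_pos T" using not_entire_positive[OF n T False] by (simp add: all_pos_def)
    have nzT: "T i j \<noteq> 0" if "i \<le> j" for i j using pT that by (auto simp: all_pos_def less_le)
    \<comment> \<open>By this recursion either all \<open>d i\<close> vanish or none; in the latter case \<open>e\<close> and \<open>f\<close> have the same product over a period.\<close>
    have drec: "d i = f i * d (i + 1) / e (i + 1)" for i
    proof -
      have "((\<lambda>j. (T i j / T (i + 1) j) * (T (i + 1) j / S (i + 1 + 1) j) / (S (i + 1) j / S (i + 1 + 1) j))
          \<longlongrightarrow> f i * d (i + 1) / e (i + 1)) at_top"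
        unfolding f_def e_def
        by (intro tendsto_divide tendsto_mult ratio_limit_tendsto[OF T pT] ratio_limit_tendsto[OF S pS] dlim)
          (use e[of "i + 1"] in \<open>simp add: e_def\<close>)
      moreover have "eventually (\<lambda>j. (T i j / T (i + 1) j) * (T (i + 1) j / S (i + 1 + 1) j) / (S (i + 1) j / S (i + 1 + 1) j)
          = T i j / S (i + 1) j) at_top"
        using eventually_ge_int[of "i + 2"]
      proof eventually_elim
        case (elim j)
        then show ?case using nz[of "i + 1 + 1" j] nz[of "i + 1" j] nzT[of "i + 1" j] by simp
      qed
      ultimately have "((\<lambda>j. T i j / S (i + 1) j) \<longlongrightarrow> f i * d (i + 1) / e (i + 1)) at_top"
        by (rule Lim_transform_eventually)
      then show ?thesis using tendsto_unique[OF _ dlim] by (metis trivial_limit_at_top_linorder)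
    qed
    show ?thesis
    proof (cases "\<exists>i. d i = 0")
      case True
      then obtain i0 where i0: "d i0 = 0" by blast
      have "(d (i + 1) = 0) = (d i = 0)" for i using drec[of i] f[of i] e[of "i + 1"] by auto
      then have "(d (i0 + k * 1) = 0) = (d i0 = 0)" for k
        by (rule period_multiple[of "\<lambda>i. d i = 0"])
      from this[of "_ - i0"] have "d i = 0" for i using i0 by simp
      then show ?thesis using zero by (simp add: S_def)
    next
      case False
      then have dp: "0 < d i" for i using d0[of i] by (metis less_le)
      define a' where "a' i = f i * a (i + 1) / e (i + 1)" for i
      have a'p: "0 < a' i" for i using f a e by (simp add: a'_def)
      have shift: "g (i + int n + 1) = g (i + 1)" if "\<And>i. g (i + int n) = g i" for g :: "int \<Rightarrow> real" and i
        using that[of "i + 1"] by (simp add: algebra_simps)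
      have a'per: "a' (i + int n) = a' i" for i
        by (simp add: a'_def fper shift[of a, OF per] shift[of e, OF eper])
      have ad: "a' i * d (i + 1) = d i * a (i + 1)" for i
        unfolding drec[of i] by (simp add: a'_def)
      have fd: "d i + a' i = f i" for i
      proof -
        have "d i + a' i = f i * (d (i + 1) + a (i + 1)) / e (i + 1)"
          unfolding drec[of i] a'_def by (simp add: add_divide_distrib distrib_left)
        also have "\<dots> = f i" using e[of "i + 1"] by (simp add: d_def)
        finally show ?thesis .
      qed
      have "bi_mult (iwhirl (\<lambda>k. - a' k)) (strip_curl S) = strip_curl T"
      proof (intro ext)
        fix i j
        have "bi_mult (iwhirl (\<lambda>k. - a' k)) (strip_curl S) i j =
            T i j - d i * S (i + 1) j - a' i * (T (i + 1) j - d (i + 1) * S (i + 1 + 1) j)"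
          by (simp add: iwhirl_mult cS)
        also have "\<dots> = T i j - (d i + a' i) * T (i + 1) j + (a' i * d (i + 1) - d i * a (i + 1)) * S (i + 1 + 1) j"
          unfolding Srec[of "i + 1" j] by (simp add: algebra_simps)
        also have "\<dots> = strip_curl T i j" using \<open>\<not> entire_growth T\<close> by (simp add: ad fd strip_curl_def curl_params_def f_def)
        finally show "bi_mult (iwhirl (\<lambda>k. - a' k)) (strip_curl S) i j = strip_curl T i j" .
      qed
      then have eq: "strip_curl S = bi_mult (icurl a') (strip_curl T)"
        using cancel_left'[OF unitri_icurl unitri_strip_curl[OF U_tnnD(1)[OF S]], of a'] by (simp add: unitri_inv_icurl)
      have sh: "icurl (\<lambda>i. g (i + 1)) 0 (int n) = icurl g 0 (int n)" if "\<And>i. g (i + int n) = g i" for g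
        using period_prod[OF n, of g 1] that by (simp add: icurl_shift add.commute)
      have quot: "icurl (\<lambda>i. f i * g (i + 1) / e (i + 1)) 0 (int n) =
          icurl f 0 (int n) * icurl g 0 (int n) / icurl e 0 (int n)" if "\<And>i. g (i + int n) = g i" for g
        unfolding sh[of g, OF that, symmetric] sh[of e, OF eper, symmetric]
        by (simp add: icurl_def prod.distrib prod_dividef)
      have pos: "0 < icurl g 0 (int n)" if "\<And>i. 0 < g i" for g
        using that by (simp add: icurl_def prod_pos)
      have "icurl d 0 (int n) = icurl (\<lambda>i. f i * d (i + 1) / e (i + 1)) 0 (int n)"
        by (rule arg_cong[where f="\<lambda>g. icurl g 0 (int n)"], rule ext, rule drec)
      then have fe: "icurl f 0 (int n) = icurl e 0 (int n)"
        using quot[of d, OF dper] pos[of d, OF dp] pos[of e, OF e] by (simp add: field_simps)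
      have "icurl a' 0 (int n) = icurl a 0 (int n)"
        using quot[of a, OF per] pos[of e, OF e] by (simp add: fe a'_def[abs_def])
      moreover have "icurl a 0 (int n) \<le> icurl f 0 (int n)"
        unfolding fe
        unfolding icurl_def using a d0 by (auto intro!: prod_mono simp: less_imp_le d_def)
      moreover have "curl_params T = f" using \<open>\<not> entire_growth T\<close> by (simp add: curl_params_def f_def)
      ultimately have "(\<forall>i. 0 < a' i) \<and> (\<forall>i. a' (i + int n) = a' i) \<and>
          strip_curl S = bi_mult (icurl a') (strip_curl T) \<and>
          icurl a' 0 (int n) = icurl a 0 (int n) \<and> icurl a 0 (int n) \<le> icurl (curl_params T) 0 (int n)"
        using eq a'p a'per by simp
      then show ?thesis unfolding S_def by blast
    qed
  qed
qed

lemma curl_free_part_offset: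
  assumes n: "n \<ge> 1" and X: "U_tnn n X"
  shows "curl_free_part (stripped X k) = curl_free_part X"
proof (rule entrywise_lim_unique)
  show "entrywise_lim (stripped (stripped X k)) (curl_free_part (stripped X k))"
    by (rule curl_free_part_lim[OF n U_tnn_stripped[OF n X]])
  have eq: "stripped (stripped X k) m = stripped X (m + k)" for m by (simp add: funpow_add)
  show "entrywise_lim (stripped (stripped X k)) (curl_free_part X)"
    using curl_free_part_lim[OF n X] unfolding entrywise_lim_def eq by (auto intro!: LIMSEQ_ignore_initial_segment)
qed

text \<open>
  As long as the second alternative of \<open>curl_step_dichotomy\<close> applies, the product of the parameters of
  the moving curl over a period stays the same, and it is at most the corresponding product for the stripped curl.
  The latter tends to \<open>0\<close>. So at some step the moving curl itself is stripped off, and from then on the two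
  sequences of stripped matrices agree up to a shift by one.
\<close>

lemma curl_free_part_icurl_mult:
  assumes n: "n \<ge> 1" and T: "U_tnn n T" and per: "\<And>i. a (i + int n) = a i" and a: "\<And>i. 0 < a i"
  shows "curl_free_part (bi_mult (icurl a) T) = curl_free_part T"
proof -
  let ?S = "bi_mult (icurl a) T"
  have S: "U_tnn n ?S" by (rule U_tnn_icurl_mult[OF T, of a]) (use per a in \<open>auto simp: less_imp_le\<close>)
  have "\<exists>k. stripped ?S (Suc k) = stripped T k"
  proof (rule ccontr)
    assume "\<not> ?thesis"
    then have no: "\<forall>k. stripped ?S (Suc k) \<noteq> stripped T k" by (simp only: not_ex simp_thms)
    let ?P = "\<lambda>k b. (\<forall>i. 0 < b i) \<and> (\<forall>i. b (i + int n) = b i) \<and>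
        stripped ?S k = bi_mult (icurl b) (stripped T k) \<and> icurl b 0 (int n) = icurl a 0 (int n)"
    have next_b: "(\<exists>b'. ?P (Suc k) b') \<and> icurl a 0 (int n) \<le> icurl (curl_params (stripped T k)) 0 (int n)"
      if "?P k b" for k b
    proof -
      have eq: "stripped ?S (Suc k) = strip_curl (bi_mult (icurl b) (stripped T k))" using that by simp
      have ne: "strip_curl (bi_mult (icurl b) (stripped T k)) \<noteq> stripped T k"
        using no[THEN spec, of k] unfolding eq .
      have b: "b (i + int n) = b i" "0 < b i" for i using that by auto
      note dich = curl_step_dichotomy[OF n U_tnn_stripped[OF n T, of k], of b]
      from dich b ne obtain b' where "\<forall>i. 0 < b' i" "\<forall>i. b' (i + int n) = b' i"
        "strip_curl (bi_mult (icurl b) (stripped T k)) = bi_mult (icurl b') (strip_curl (stripped T k))"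
        "icurl b' 0 (int n) = icurl b 0 (int n)" "icurl b 0 (int n) \<le> icurl (curl_params (stripped T k)) 0 (int n)"
        by metis
      then have P: "?P (Suc k) b'" and le: "icurl a 0 (int n) \<le> icurl (curl_params (stripped T k)) 0 (int n)"
        using eq that by auto
      show ?thesis by (rule conjI[OF exI[of "?P (Suc k)", OF P] le])
    qed
    have "\<exists>b. ?P k b" for k
    proof (induction k)
      case 0
      show ?case by (rule exI[of _ a]) (use per a in auto)
    next
      case (Suc k)
      then obtain b where "?P k b" by (rule exE)
      from next_b[OF this] show ?case by (rule conjunct1)
    qed
    note ex = this
    have "icurl a 0 (int n) \<le> icurl (curl_params (stripped T k)) 0 (int n)" for k
    proof -
      from ex[of k] obtain b where "?P k b" by (rule exE)
      from next_b[OF this] show ?thesis by (rule conjunct2)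
    qed
    then have "icurl a 0 (int n) \<le> 0"
      by (intro LIMSEQ_le_const[OF curl_params_prod_tendsto[OF n T]]) auto
    moreover have "0 < icurl a 0 (int n)" using a by (simp add: icurl_def prod_pos)
    ultimately show False by simp
  qed
  then obtain k where "stripped ?S (Suc k) = stripped T k" by blast
  then have "curl_free_part (stripped ?S (Suc k)) = curl_free_part (stripped T k)" by (rule arg_cong)
  then show ?thesis by (simp only: curl_free_part_offset[OF n S] curl_free_part_offset[OF n T])
qed

lemma sum_int_nat: "(\<Sum>k\<in>{i..i + int m}. f k) = (\<Sum>p\<le>m. f (i + int p))"
  by (rule sum.reindex_bij_witness[of _ "\<lambda>p. i + int p" "\<lambda>k. nat (k - i)"]) auto

text \<open>
  Passing from \<open>\<rho>\<close> to \<open>2 \<rho>\<close> pays for the \<open>m + 1\<close> terms of the sum.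
\<close>

lemma entire_growth_mult:
  assumes A: "unitri A" "entire_growth A" and B: "unitri B" "entire_growth B"
  shows "entire_growth (bi_mult A B)"
  unfolding entire_growth_def
proof (intro allI impI)
  fix \<rho> :: real assume \<rho>: "0 < \<rho>"
  then have \<rho>2: "0 < 2 * \<rho>" by simp
  obtain C where C: "\<And>i m. \<bar>A i (i + int m)\<bar> * (2 * \<rho>) ^ m \<le> C"
    using A(2) \<rho>2 unfolding entire_growth_def by meson
  obtain D where D: "\<And>i m. \<bar>B i (i + int m)\<bar> * (2 * \<rho>) ^ m \<le> D"
    using B(2) \<rho>2 unfolding entire_growth_def by meson
  have C0: "0 \<le> C" using C[of 0 0] by (metis abs_ge_zero mult.right_neutral order_trans power_0)
  have D0: "0 \<le> D" using D[of 0 0] by (metis abs_ge_zero mult.right_neutral order_trans power_0)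
  have "\<bar>bi_mult A B i (i + int m)\<bar> * \<rho> ^ m \<le> C * D" for i m
  proof -
    have "\<bar>bi_mult A B i (i + int m)\<bar> * (2 * \<rho>) ^ m =
        \<bar>\<Sum>p\<le>m. A i (i + int p) * B (i + int p) (i + int m)\<bar> * (2 * \<rho>) ^ m"
      by (simp add: bi_mult_unitri[OF A(1) B(1)] sum_int_nat)
    also have "\<dots> \<le> (\<Sum>p\<le>m. \<bar>A i (i + int p) * B (i + int p) (i + int m)\<bar>) * (2 * \<rho>) ^ m"
      by (rule mult_right_mono[OF sum_abs]) (use \<rho> in simp)
    also have "\<dots> = (\<Sum>p\<le>m. (\<bar>A i (i + int p)\<bar> * (2 * \<rho>) ^ p) *
        (\<bar>B (i + int p) (i + int p + int (m - p))\<bar> * (2 * \<rho>) ^ (m - p)))"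
      unfolding sum_distrib_right
    proof (rule sum.cong[OF refl])
      fix p assume "p \<in> {..m}"
      then have "(2 * \<rho>) ^ m = (2 * \<rho>) ^ p * (2 * \<rho>) ^ (m - p)" "i + int p + int (m - p) = i + int m"
        using power_add[of "2 * \<rho>" p "m - p"] by (simp_all add: of_nat_diff)
      then show "\<bar>A i (i + int p) * B (i + int p) (i + int m)\<bar> * (2 * \<rho>) ^ m =
          (\<bar>A i (i + int p)\<bar> * (2 * \<rho>) ^ p) * (\<bar>B (i + int p) (i + int p + int (m - p))\<bar> * (2 * \<rho>) ^ (m - p))"
        by (simp only: abs_mult ac_simps)
    qed
    also have "\<dots> \<le> (\<Sum>p\<le>m. C * D)"
      by (intro sum_mono mult_mono C D) (use C0 \<rho> in auto)
    also have "\<dots> = real (Suc m) * (C * D)" by simp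
    also have "\<dots> \<le> 2 ^ m * (C * D)"
      by (rule mult_right_mono) (use C0 D0 of_nat_le_iff[of "Suc m" "2 ^ m", where ?'a=real] less_exp[of m] in \<open>auto simp: Suc_le_eq\<close>)
    finally have "(\<bar>bi_mult A B i (i + int m)\<bar> * \<rho> ^ m) * 2 ^ m \<le> (C * D) * 2 ^ m"
      by (simp only: power_mult_distrib ac_simps)
    then show ?thesis by (rule mult_right_le_imp_le) simp
  qed
  then show "\<exists>C. \<forall>i m. \<bar>bi_mult A B i (i + int m)\<bar> * \<rho> ^ m \<le> C" by blast
qed

text \<open>
  Row \<open>i\<close> of the product combines the entries \<open>(i, k)\<close> of \<open>T\<close> with the weights \<open>Q k j\<close>. The terms with bounded \<open>k\<close>
  are negligible because \<open>Q\<close> is entire and \<open>T\<close> is not; in the others, the entries \<open>(i, k)\<close> and \<open>(i + 1, k)\<close>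
  of \<open>T\<close> are nearly in the limiting ratio.
\<close>

lemma ratio_limit_mult_entire:
  assumes n: "n \<ge> 1" and T: "U_tnn n T" and Q: "U_tnn n Q" "entire_growth Q"
    and X: "U_tnn n (bi_mult T Q)" and ne: "\<not> entire_growth T"
  shows "ratio_limit (bi_mult T Q) i = ratio_limit T i"
proof -
  let ?X = "bi_mult T Q"
  have Xsum: "?X i j = (\<Sum>k\<in>{i..j}. T i k * Q k j)" for i j
    by (rule bi_mult_unitri[OF U_tnnD(1)[OF T] U_tnnD(1)[OF Q(1)]])
  have pT: "all_pos T" using not_entire_positive[OF n T ne] by (simp add: all_pos_def)
  have TX: "T i j \<le> ?X i j" for i j
    by (rule mult_ge_left[OF U_tnnD(1)[OF T] U_tnn_nonneg[OF T] Q(1)])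
  have pX: "all_pos ?X" using pT TX unfolding all_pos_def by (meson less_le_trans)
  obtain r where r: "0 < r" "\<And>i m. r ^ m \<le> icurl (ratio_limit T) i (i + int m)"
    using icurl_lower[OF n, of "ratio_limit T"] ratio_limit_period[OF U_tnnD(2)[OF T]] ratio_limit_pos[OF n T ne] by blast
  have Xr: "r ^ m \<le> ?X i (i + int m)" for i m
    using r(2)[of m i] icurl_ratio_limit_le[OF T, of i "i + int m"] TX[of i "i + int m"] by linarith
  have Tz: "T (i + 1) i = 0" using unitriD(2)[OF U_tnnD(1)[OF T]] by simp
  have split: "(\<Sum>k\<in>{i + 1..j}. g k) = (\<Sum>k\<in>{i..j}. g k)" if "g i = 0" for g :: "int \<Rightarrow> real" and j
  proof (rule sum.mono_neutral_left)
    have "{i..j} - {i + 1..j} \<subseteq> {i}" by auto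
    then show "\<forall>k\<in>{i..j} - {i + 1..j}. g k = 0" using that by blast
  qed auto
  show ?thesis
  proof (rule antisym)
    show "ratio_limit T i \<le> ratio_limit ?X i"
    proof (rule tendsto_lowerbound[OF ratio_limit_tendsto[OF X pX]])
      show "eventually (\<lambda>j. ratio_limit T i \<le> ?X i j / ?X (i + 1) j) at_top"
        using eventually_ge_int[of "i + 1"]
      proof eventually_elim
        case (elim j)
        have "ratio_limit T i * ?X (i + 1) j = (\<Sum>k\<in>{i..j}. ratio_limit T i * T (i + 1) k * Q k j)"
          unfolding Xsum by (subst split) (simp_all add: Tz sum_distrib_left mult.assoc)
        also have "\<dots> \<le> ?X i j"
          unfolding Xsum by (intro sum_mono mult_right_mono ratio_limit_mult_le[OF T] U_tnn_nonneg[OF Q(1)])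
        finally show ?case using pX elim by (simp add: all_pos_def pos_le_divide_eq)
      qed
    qed simp
    show "ratio_limit ?X i \<le> ratio_limit T i"
    proof (rule dense_ge)
      fix y assume y: "ratio_limit T i < y"
      then have y0: "0 < y" using ratio_limit_nonneg[OF T, of i] by simp
      have "eventually (\<lambda>j. T i j / T (i + 1) j < y) at_top"
        by (rule order_tendstoD(2)[OF ratio_limit_tendsto[OF T pT] y])
      then obtain K0 where K0: "\<And>j. K0 \<le> j \<Longrightarrow> T i j / T (i + 1) j < y"
        by (auto simp: eventually_at_top_linorder)
      define K where "K = max K0 (i + 1)"
      have K: "T i k \<le> y * T (i + 1) k" if "K \<le> k" for k
      proof -
        have "0 < T (i + 1) k" using pT that by (simp add: all_pos_def K_def)
        then show ?thesis using K0[of k] that by (simp add: K_def divide_less_eq)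
      qed
      have "((\<lambda>j. y + (\<Sum>k\<in>{i..<K}. T i k * (Q k j / ?X (i + 1) j))) \<longlongrightarrow> y + (\<Sum>k\<in>{i..<K}. T i k * 0)) at_top"
        by (intro tendsto_intros entire_ratio_tendsto[OF Q r(1) Xr])
      then have lim: "((\<lambda>j. y + (\<Sum>k\<in>{i..<K}. T i k * (Q k j / ?X (i + 1) j))) \<longlongrightarrow> y) at_top" by simp
      show "ratio_limit ?X i \<le> y"
      proof (rule tendsto_le[OF _ lim ratio_limit_tendsto[OF X pX]])
        show "eventually (\<lambda>j. ?X i j / ?X (i + 1) j \<le> y + (\<Sum>k\<in>{i..<K}. T i k * (Q k j / ?X (i + 1) j))) at_top"
          using eventually_ge_int[of "K + 1"]
        proof eventually_elim
          case (elim j)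
          have Xp: "0 < ?X (i + 1) j" using pX elim by (simp add: all_pos_def K_def)
          have "{i..j} = {i..<K} \<union> {K..j}" using elim by (auto simp: K_def)
          moreover have "{i..<K} \<inter> {K..j} = {}" by auto
          ultimately have "?X i j = (\<Sum>k\<in>{i..<K}. T i k * Q k j) + (\<Sum>k\<in>{K..j}. T i k * Q k j)"
            unfolding Xsum by (simp add: sum.union_disjoint)
          also have "(\<Sum>k\<in>{K..j}. T i k * Q k j) \<le> (\<Sum>k\<in>{K..j}. y * T (i + 1) k * Q k j)"
            by (intro sum_mono mult_right_mono K U_tnn_nonneg[OF Q(1)]) simp
          also have "\<dots> \<le> (\<Sum>k\<in>{i + 1..j}. y * T (i + 1) k * Q k j)"
            by (rule sum_mono2) (use y0 U_tnn_nonneg[OF Q(1)] U_tnn_nonneg[OF T] in \<open>auto simp: K_def\<close>)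
          also have "\<dots> = y * ?X (i + 1) j" unfolding Xsum by (simp add: sum_distrib_left mult.assoc)
          finally have "?X i j \<le> (\<Sum>k\<in>{i..<K}. T i k * Q k j) + y * ?X (i + 1) j" by simp
          then have "?X i j / ?X (i + 1) j \<le> ((\<Sum>k\<in>{i..<K}. T i k * Q k j) + y * ?X (i + 1) j) / ?X (i + 1) j"
            using Xp by (simp add: divide_right_mono)
          also have "\<dots> = y + (\<Sum>k\<in>{i..<K}. T i k * (Q k j / ?X (i + 1) j))"
            using Xp by (simp add: add_divide_distrib sum_divide_distrib)
          finally show ?case .
        qed
      qed simp
    qed
  qed
qed

lemma strip_curl_mult_entire:
  assumes n: "n \<ge> 1" and T: "U_tnn n T" and Q: "U_tnn n Q" "entire_growth Q"
    and X: "U_tnn n (bi_mult T Q)"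
  shows "strip_curl (bi_mult T Q) = bi_mult (strip_curl T) Q"
proof -
  have "curl_params (bi_mult T Q) = curl_params T"
  proof (cases "entire_growth T")
    case True
    then show ?thesis
      using entire_growth_mult[OF U_tnnD(1)[OF T] True U_tnnD(1)[OF Q(1)] Q(2)] by (simp add: curl_params_def)
  next
    case False
    have "\<bar>T i j\<bar> \<le> \<bar>bi_mult T Q i j\<bar>" for i j
      using mult_ge_left[OF U_tnnD(1)[OF T] U_tnn_nonneg[OF T] Q(1), of i j] U_tnn_nonneg[OF T, of i j] by linarith
    then have "\<not> entire_growth (bi_mult T Q)" using entire_growth_mono False by blast
    then show ?thesis using False ratio_limit_mult_entire[OF n T Q X False] by (simp add: curl_params_def fun_eq_iff)
  qed
  then show ?thesis
    by (simp add: strip_curl_mult bi_mult_assoc unitri_iwhirl U_tnnD(1)[OF T] U_tnnD(1)[OF Q(1)])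
qed

lemma curl_free_part_mult_entire:
  assumes n: "n \<ge> 1" and T: "U_tnn n T" and Q: "U_tnn n Q" "entire_growth Q"
    and X: "U_tnn n (bi_mult T Q)"
  shows "curl_free_part (bi_mult T Q) = bi_mult (curl_free_part T) Q"
proof -
  have eq: "stripped (bi_mult T Q) k = bi_mult (stripped T k) Q" for k
  proof (induction k)
    case (Suc k)
    have "U_tnn n (bi_mult (stripped T k) Q)" using U_tnn_stripped[OF n X, of k] by (simp add: Suc)
    then show ?case using strip_curl_mult_entire[OF n U_tnn_stripped[OF n T] Q] Suc by simp
  qed simp
  show ?thesis
  proof (rule entrywise_lim_unique[OF curl_free_part_lim[OF n X]])
    show "entrywise_lim (stripped (bi_mult T Q)) (bi_mult (curl_free_part T) Q)"
      unfolding eq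
      by (rule bi_mult_lim[OF _ _ _ _ curl_free_part_lim[OF n T] entrywise_lim_const])
        (use U_tnnD(1)[OF U_tnn_stripped[OF n T]] U_tnnD(1)[OF U_tnn_curl_free_part[OF n T]] U_tnnD(1)[OF Q(1)] in auto)
  qed
qed

text \<open>
  All tails \<open>W K\<close> of the product have the same curl-free part as \<open>Z\<close>. It lies below each tail, and the
  tails tend to the identity.
\<close>

lemma curl_free_part_curl_prod_lim:
  assumes n: "n \<ge> 1" and per: "\<And>k i. a k (i + int n) = a k i"
    and a: "\<And>k. (\<forall>i. 0 < a k i) \<or> (\<forall>i. a k i = 0)"
    and lim: "entrywise_lim (curl_prod a) Z"
  shows "U_tnn n Z" and "curl_free_part Z = bi_id"
proof -
  have a0: "0 \<le> a k i" for k i using a[of k] by (auto simp: less_imp_le)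
  show Z: "U_tnn n Z" by (rule U_tnn_lim[OF U_tnn_curl_prod lim]) (use per a0 in auto)
  define W where "W K = bi_mult (unitri_inv (curl_prod a K)) Z" for K
  have uW: "U_tnn n (W K)" for K
  proof (rule U_tnn_lim)
    show "U_tnn n (curl_prod (\<lambda>i. a (K + i)) k)" for k by (rule U_tnn_curl_prod) (use per a0 in auto)
    have "entrywise_lim (\<lambda>k. curl_prod a (K + k)) Z"
      using lim unfolding entrywise_lim_def by (auto intro: LIMSEQ_ignore_initial_segment simp: add.commute[of K])
    then have "entrywise_lim (\<lambda>k. bi_mult (unitri_inv (curl_prod a K)) (curl_prod a (K + k))) (W K)"
      unfolding W_def
      by (intro bi_mult_lim entrywise_lim_const unitri_unitri_inv unitri_curl_prod U_tnnD(1)[OF Z])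
    then show "entrywise_lim (curl_prod (\<lambda>i. a (K + i))) (W K)"
      by (simp add: curl_prod_add cancel_left unitri_curl_prod)
  qed
  have WS: "W K = bi_mult (icurl (a K)) (W (Suc K))" for K
    by (simp add: W_def unitri_inv_mult unitri_curl_prod unitri_icurl bi_mult_assoc unitri_unitri_inv unitri_mult U_tnnD(1)[OF Z] cancel_left')
  have "curl_free_part (W K) = curl_free_part (W (Suc K))" for K
    using a[of K]
  proof
    assume "\<forall>i. 0 < a K i"
    then show ?thesis unfolding WS[of K] by (intro curl_free_part_icurl_mult[OF n uW]) (use per in auto)
  next
    assume z: "\<forall>i. a K i = 0"
    have "icurl (a K) = bi_id" by (rule icurl_zero) (use z in blast)
    then show ?thesis using WS[of K] by simp
  qed
  then have cW: "curl_free_part (W K) = curl_free_part Z" for K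
    by (induction K) (simp_all add: W_def unitri_inv_unique[OF unitri_bi_id unitri_bi_id])
  have Wlim: "entrywise_lim W bi_id"
    using bi_mult_lim[OF unitri_unitri_inv _ unitri_unitri_inv U_tnnD(1)[OF Z] unitri_inv_lim[OF lim] entrywise_lim_const] U_tnnD(1)[OF Z]
    by (simp add: unitri_inv_left W_def[abs_def])
  have "curl_free_part Z i j = bi_id i j" for i j
  proof (cases "i = j")
    case True
    then show ?thesis using unitriD(1)[OF U_tnnD(1)[OF U_tnn_curl_free_part[OF n Z]]] by (simp add: bi_id_def)
  next
    case False
    have "(\<lambda>K. W K i j) \<longlonglongrightarrow> bi_id i j" using Wlim by (simp add: entrywise_lim_def)
    moreover have "curl_free_part Z i j \<le> W K i j" for K
      using curl_free_part_le[OF n uW, of K i j 0] by (simp add: cW)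
    ultimately have "curl_free_part Z i j \<le> bi_id i j" by (intro LIMSEQ_le_const) auto
    then show ?thesis using False U_tnn_nonneg[OF U_tnn_curl_free_part[OF n Z], of i j] by (simp add: bi_id_def)
  qed
  then show "curl_free_part Z = bi_id" by (intro ext)
qed

text \<open>
  The curl-free part of the product is that of \<open>Z\<close>, which is the identity, times \<open>Q\<close>.
\<close>

lemma curl_free_part_unique:
  assumes n: "n \<ge> 1" and X: "U_tnn n (bi_mult Z Q)" and Q: "U_tnn n Q" "entire_growth Q"
    and "\<And>k i. a k (i + int n) = a k i" "\<And>k. (\<forall>i. 0 < a k i) \<or> (\<forall>i. a k i = 0)"
    and "entrywise_lim (curl_prod a) Z"
  shows "Q = curl_free_part (bi_mult Z Q)"
  using curl_free_part_mult_entire[OF n _ Q X] curl_free_part_curl_prod_lim[OF n, of a Z] assms(5-7) by simp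

section \<open>Foldings and entire functions\<close>

lemma nth_folding:
  assumes X: "unitri X" and "i < n" "j < n"
  shows "fls_nth (folding n X $$ (i, j)) k = X (int i + 1) (int j + 1 + k * int n)"
proof -
  have "X (int i + 1) (int j + 1 + k * int n) = 0" if "k < 0" for k
  proof (rule unitriD(2)[OF X])
    have "k * int n \<le> (- 1) * int n" by (rule mult_right_mono) (use that in auto)
    then show "int j + 1 + k * int n < int i + 1" using assms by linarith
  qed
  then show ?thesis
    using assms by (simp add: folding_def nth_Abs_fls_lower_bound[where N=0])
qed

text \<open>
  The constant term of the folding is a unitriangular matrix, so the determinant has constant term \<open>1\<close>.
\<close>

lemma det_folding:
  assumes X: "unitri X"
  shows "Determinant.det (folding n X) \<noteq> 0"
proof -
  interpret h1: comm_ring_hom "fps_to_fls :: real fps \<Rightarrow> real fls"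
    by unfold_locales (simp_all add: fls_times_fps_to_fls)
  interpret h2: comm_ring_hom "\<lambda>f :: real fps. fps_nth f 0"
    by unfold_locales simp_all
  define G where "G = Matrix.mat n n (\<lambda>(i, j). Abs_fps (\<lambda>k. X (int i + 1) (int j + 1 + int k * int n)))"
  have "folding n X = map_mat fps_to_fls G"
  proof (rule eq_matI)
    fix i j assume "i < dim_row (map_mat fps_to_fls G)" "j < dim_col (map_mat fps_to_fls G)"
    then have ij: "i < n" "j < n" by (auto simp: G_def)
    show "folding n X $$ (i, j) = map_mat fps_to_fls G $$ (i, j)"
    proof (rule fls_eqI)
      fix k
      have z: "fls_nth (folding n X $$ (i, j)) k = 0" if "k < 0"
      proof -
        have "k * int n \<le> (- 1) * int n" by (rule mult_right_mono) (use that in auto)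
        then have "int j + 1 + k * int n < int i + 1" using ij by linarith
        then show ?thesis unfolding nth_folding[OF X ij] by (rule unitriD(2)[OF X])
      qed
      show "fls_nth (folding n X $$ (i, j)) k = fls_nth (map_mat fps_to_fls G $$ (i, j)) k"
        using z nth_folding[OF X ij, of k] ij by (cases "k < 0") (simp_all add: G_def)
    qed
  qed (auto simp: folding_def G_def)
  moreover have "fps_nth (Determinant.det G) 0 = 1"
  proof -
    let ?H = "map_mat (\<lambda>f. fps_nth f 0) G"
    have "Determinant.det ?H = prod_list (diag_mat ?H)"
      by (rule det_upper_triangular[where n=n])
        (auto simp: G_def upper_triangular_def unitriD(2)[OF X])
    also have "diag_mat ?H = replicate n 1"
      by (rule nth_equalityI) (auto simp: diag_mat_def G_def unitriD(1)[OF X])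
    finally show ?thesis by simp
  qed
  ultimately show ?thesis by auto
qed

lemma unitri_periodic_GL: "unitri X \<Longrightarrow> periodic n X \<Longrightarrow> n \<ge> 1 \<Longrightarrow> X \<in> GL_unfolded n"
proof -
  assume X: "unitri X" "periodic n X" and n: "n \<ge> 1"
  have "\<forall>\<^sub>\<infinity>k::nat. X i (j - int k * int n) = 0" for i j
    unfolding MOST_nat
  proof (intro exI[of _ "nat (j - i)"] allI impI)
    fix k assume k: "nat (j - i) < k"
    have "int k * 1 \<le> int k * int n" by (rule mult_left_mono) (use n in auto)
    then show "X i (j - int k * int n) = 0" using k by (intro unitriD(2)[OF X(1)]) linarith
  qed
  then show ?thesis using X det_folding[OF X(1)] by (simp add: GL_unfolded_def periodic_def)
qed

lemma totally_nonneg_iff: "totally_nonneg X \<longleftrightarrow> tnn_on UNIV UNIV X"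
proof
  assume t: "totally_nonneg X"
  show "tnn_on UNIV UNIV X"
  proof (rule tnnI)
    fix rs cs :: "int list"
    assume *: "sorted_wrt (<) rs" "sorted_wrt (<) cs" "length rs = length cs"
    have "strict_mono_on {..<length rs} ((!) rs)" "strict_mono_on {..<length rs} ((!) cs)"
      using * by (auto simp: strict_mono_on_def sorted_wrt_iff_nth_less)
    then have "0 \<le> Determinant.det (Matrix.mat (length rs) (length rs) (\<lambda>(p, q). X (rs ! p) (cs ! q)))"
      using t unfolding totally_nonneg_def by blast
    also have "Matrix.mat (length rs) (length rs) (\<lambda>(p, q). X (rs ! p) (cs ! q)) =
        Matrix.mat (length (map X rs)) (length (map X rs)) (\<lambda>(p, q). (map X rs ! p) (cs ! q))"
      by (rule eq_matI) auto
    finally show "0 \<le> rows_minor (map X rs) cs" by (simp only: rows_minor_def)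
  qed
next
  assume t: "tnn_on UNIV UNIV X"
  show "totally_nonneg X"
    unfolding totally_nonneg_def
  proof (intro allI impI)
    fix m and r c :: "nat \<Rightarrow> int"
    assume *: "strict_mono_on {..<m} r" "strict_mono_on {..<m} c"
    have "0 \<le> rows_minor (map X (map r [0..<m])) (map c [0..<m])"
      by (rule tnnD[OF t]) (use * in \<open>auto simp: strict_mono_on_def sorted_wrt_iff_nth_less\<close>)
    also have "rows_minor (map X (map r [0..<m])) (map c [0..<m]) =
        Determinant.det (Matrix.mat m m (\<lambda>(p, q). X (r p) (c q)))"
      unfolding rows_minor_def by (rule arg_cong[where f=Determinant.det]) (rule eq_matI, auto)
    finally show "0 \<le> Determinant.det (Matrix.mat m m (\<lambda>(p, q). X (r p) (c q)))" .
  qed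
qed

lemma U_nonneg_iff: "n \<ge> 1 \<Longrightarrow> X \<in> U_nonneg n \<longleftrightarrow> U_tnn n X"
  using unitri_periodic_GL[of X n]
  by (auto simp: U_nonneg_def U_group_def U_tnn_def unitri_def totally_nonneg_iff GL_unfolded_def periodic_def)

text \<open>
  In both directions the exponents are compared through \<open>m = j - i + k n\<close> with \<open>i\<close> and \<open>j\<close> in \<open>{0..<n}\<close>.
\<close>

lemma entire_iff:
  assumes n: "n \<ge> 1" and X: "unitri X" "periodic n X"
  shows "entire n X \<longleftrightarrow> entire_growth X"
proof
  assume e: "entire n X"
  show "entire_growth X"
    unfolding entire_growth_def
  proof (intro allI impI)
    fix \<rho> :: real assume \<rho>: "0 < \<rho>"
    define s where "s = max 1 \<rho>"
    have s: "1 \<le> s" "\<rho> \<le> s" by (auto simp: s_def)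
    have "\<exists>C. \<forall>k::nat. \<bar>X (int i + 1) (int j + 1 + int k * int n)\<bar> * (s ^ n) ^ k \<le> C" if "i < n" "j < n" for i j
    proof -
      have "entire_fls (folding n X $$ (i, j))" using e that by (simp add: entire_def)
      then obtain F where F: "\<And>z. (\<lambda>k. complex_of_real (fls_nth (folding n X $$ (i, j)) (int k)) * z ^ k) sums F z"
        unfolding entire_fls_def by metis
      have "(\<lambda>k. complex_of_real (X (int i + 1) (int j + 1 + int k * int n)) * of_real (s ^ n) ^ k) \<longlonglongrightarrow> 0"
        using summable_LIMSEQ_zero[OF sums_summable[OF F]] by (simp add: nth_folding[OF X(1) that])
      then have "Bseq (\<lambda>k. complex_of_real (X (int i + 1) (int j + 1 + int k * int n)) * of_real (s ^ n) ^ k)"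
        by (intro convergent_imp_Bseq convergentI)
      then obtain C where "\<And>k. norm (complex_of_real (X (int i + 1) (int j + 1 + int k * int n)) * of_real (s ^ n) ^ k) \<le> C"
        by (auto simp: Bseq_def)
      then show ?thesis using s by (auto simp: norm_mult norm_power intro!: exI[of _ C])
    qed
    then obtain C where C: "\<And>i j k. i < n \<Longrightarrow> j < n \<Longrightarrow>
        \<bar>X (int i + 1) (int j + 1 + int k * int n)\<bar> * (s ^ n) ^ k \<le> C i j" by metis
    have C0: "0 \<le> C i j" if "i < n" "j < n" for i j
      by (rule order_trans[OF _ C[OF that, of 0]]) simp
    define D where "D = (\<Sum>i<n. \<Sum>j<n. C i j)"
    have CD: "C i j \<le> D" if "i < n" "j < n" for i j
    proof -
      have "C i j \<le> (\<Sum>j<n. C i j)" by (rule member_le_sum) (use that C0 in auto)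
      also have "\<dots> \<le> D" unfolding D_def
        by (rule member_le_sum[of i "{..<n}" "\<lambda>i. \<Sum>j<n. C i j"]) (use that C0 in \<open>auto intro!: sum_nonneg\<close>)
      finally show ?thesis .
    qed
    have "\<bar>X i (i + int m)\<bar> * \<rho> ^ m \<le> s ^ n * D" for i m
    proof -
      define i' where "i' = nat ((i - 1) mod int n)"
      define q where "q = (i - 1) div int n"
      define j where "j = (i' + m) mod n"
      define k where "k = (i' + m) div n"
      have i: "i = int i' + 1 + q * int n"
        using n div_mult_mod_eq[of "i - 1" "int n"] by (simp add: i'_def q_def)
      have ij: "i' < n" "j < n" using n by (auto simp: i'_def j_def nat_less_iff)
      have jk: "i' + m = j + k * n" by (simp add: j_def k_def)
      have im: "i + int m = int j + 1 + int k * int n + q * int n"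
      proof -
        have "int i' + int m = int j + int k * int n" using jk by (metis of_nat_add of_nat_mult)
        then show ?thesis unfolding i by linarith
      qed
      have "X i (i + int m) = X (int i' + 1) (int j + 1 + int k * int n)"
        unfolding im by (subst i, rule periodic_multiple[OF X(2)])
      moreover have "\<rho> ^ m \<le> s ^ n * (s ^ n) ^ k"
      proof -
        have "\<rho> ^ m \<le> s ^ m" by (rule power_mono) (use s \<rho> in auto)
        also have "\<dots> \<le> s ^ (n + n * k)" by (rule power_increasing) (use jk ij s in \<open>auto simp: mult.commute\<close>)
        finally show ?thesis by (simp add: power_add power_mult)
      qed
      ultimately have "\<bar>X i (i + int m)\<bar> * \<rho> ^ m \<le>
          \<bar>X (int i' + 1) (int j + 1 + int k * int n)\<bar> * (s ^ n * (s ^ n) ^ k)"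
        by (simp add: mult_left_mono)
      also have "\<dots> = s ^ n * (\<bar>X (int i' + 1) (int j + 1 + int k * int n)\<bar> * (s ^ n) ^ k)" by simp
      also have "\<dots> \<le> s ^ n * D"
        by (rule mult_left_mono[OF order_trans[OF C CD]]) (use ij s in auto)
      finally show ?thesis .
    qed
    then show "\<exists>C. \<forall>i m. \<bar>X i (i + int m)\<bar> * \<rho> ^ m \<le> C" by blast
  qed
next
  assume g: "entire_growth X"
  show "entire n X"
    unfolding entire_def
  proof (intro allI impI)
    fix i j assume ij: "i < n" "j < n"
    define f where "f k = X (int i + 1) (int j + 1 + k * int n)" for k
    have f: "fls_nth (folding n X $$ (i, j)) k = f k" for k
      by (simp add: f_def nth_folding[OF X(1) ij])
    have neg: "f k = 0" if "k < 0" for k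
    proof -
      have "k * int n \<le> (- 1) * int n" by (rule mult_right_mono) (use that in auto)
      then show ?thesis unfolding f_def by (intro unitriD(2)[OF X(1)]) (use ij in linarith)
    qed
    have summ: "summable (\<lambda>k. complex_of_real (f (int k)) * z ^ k)" for z
    proof -
      define r where "r = 2 * (norm z + 1)"
      have r: "1 \<le> r" "norm z \<le> r / 2" by (auto simp: r_def)
      have "0 < r" using r by linarith
      then have "\<exists>C. \<forall>p. \<forall>m::nat. \<bar>X p (p + int m)\<bar> * r ^ m \<le> C"
        using g unfolding entire_growth_def by (elim allE[of _ r] impE)
      then obtain C where "\<forall>p. \<forall>m::nat. \<bar>X p (p + int m)\<bar> * r ^ m \<le> C" by (rule exE)
      then have C: "\<bar>X p (p + int m)\<bar> * r ^ m \<le> C" for p m by blast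
      \<comment> \<open>For \<open>k = 0\<close> the index \<open>m\<close> below could be negative.\<close>
      have "norm (complex_of_real (f (int k)) * z ^ k) \<le> C * (1 / 2) ^ k" if k: "1 \<le> k" for k
      proof -
        define m where "m = nat (int j + int k * int n - int i)"
        have kn: "k \<le> (k - 1) * n + 1"
        proof -
          have "(k - 1) * 1 \<le> (k - 1) * n" by (rule mult_le_mono2) (use n in simp)
          then show ?thesis using k by linarith
        qed
        have "k * n = (k - 1) * n + n" using k by (cases k) auto
        then have "int k * int n = int ((k - 1) * n) + int n" by (metis of_nat_add of_nat_mult)
        then have le: "int k \<le> int j + int k * int n - int i" using kn ij by linarith
        then have m: "int m = int j + int k * int n - int i" by (simp add: m_def)
        have km: "k \<le> m" using le m by linarith
        have "f (int k) = X (int i + 1) (int i + 1 + int m)" by (simp add: f_def m algebra_simps)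
        then have "\<bar>f (int k)\<bar> * r ^ m \<le> C" using C by simp
        moreover have "\<bar>f (int k)\<bar> * r ^ k \<le> \<bar>f (int k)\<bar> * r ^ m"
          by (intro mult_left_mono power_increasing) (use r km in auto)
        ultimately have C1: "\<bar>f (int k)\<bar> * r ^ k \<le> C" by simp
        have "norm (complex_of_real (f (int k)) * z ^ k) = \<bar>f (int k)\<bar> * norm z ^ k"
          by (simp add: norm_mult norm_power)
        also have "\<dots> \<le> \<bar>f (int k)\<bar> * (r / 2) ^ k"
          by (intro mult_left_mono power_mono) (use r in auto)
        also have "\<dots> = (\<bar>f (int k)\<bar> * r ^ k) * (1 / 2) ^ k" by (simp add: power_divide)
        also have "\<dots> \<le> C * (1 / 2) ^ k" by (rule mult_right_mono[OF C1]) simp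
        finally show ?thesis .
      qed
      then show ?thesis
      proof (rule summable_comparison_test'[rotated])
        show "summable (\<lambda>k. C * (1 / 2 :: real) ^ k)" by (intro summable_mult summable_geometric) simp
      qed
    qed
    define F where "F z = (\<Sum>k. complex_of_real (f (int k)) * z ^ k)" for z
    have sums: "(\<lambda>k. complex_of_real (f (int k)) * z ^ k) sums F z" for z
      unfolding F_def by (rule summable_sums[OF summ])
    have "F holomorphic_on ball 0 r" for r
      by (rule power_series_holomorphic[of 0 r "\<lambda>k. complex_of_real (f (int k))"]) (use sums in simp)
    then have "F field_differentiable at z" for z
      by (rule holomorphic_on_imp_differentiable_at[of _ "ball 0 (norm z + 1)"]) auto
    then have "F holomorphic_on UNIV" by (simp add: holomorphic_on_def field_differentiable_at_within)
    then show "entire_fls (folding n X $$ (i, j))"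
      unfolding entire_fls_def f using neg sums by (intro conjI exI[of _ F]) auto
  qed
qed

text \<open>
  A row is covered by the \<open>n\<close> residue classes of columns, each of which contributes a bound.
\<close>

lemma GL_row_bounded:
  assumes n: "n \<ge> 1" and X: "X \<in> GL_unfolded n"
  shows "\<exists>L. \<forall>k<L. X i k = 0"
proof -
  have "\<exists>N. \<forall>k>N. X i (j - int k * int n) = 0" for j
    using X by (simp add: GL_unfolded_def MOST_nat)
  then obtain N where N: "\<And>j k. N j < k \<Longrightarrow> X i (j - int k * int n) = 0" by metis
  define M where "M = Max (N ` {0..<int n})"
  have "X i c = 0" if c: "c < - (int M + 1) * int n" for c
  proof -
    define j where "j = c mod int n"
    define q where "q = c div int n"
    have cj: "c = j + q * int n" by (simp add: j_def q_def)
    have j: "j \<in> {0..<int n}" using n by (simp add: j_def)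
    then have "N j \<le> M" by (simp add: M_def)
    have "q * int n \<le> c" using cj j by simp
    then have "q * int n < (- (int M + 1)) * int n" using c by linarith
    then have "q < - (int M + 1)" using n by (simp only: mult_less_cancel_right) 
    then have "N j < nat (- q)" using \<open>N j \<le> M\<close> by linarith
    then have "X i (j - int (nat (- q)) * int n) = 0" by (rule N)
    moreover have "j - int (nat (- q)) * int n = c" using cj \<open>q < - (int M + 1)\<close> by simp
    ultimately show ?thesis by (simp only:)
  qed
  then show ?thesis by blast
qed

lemma entire_growth_alternate: "entire_growth (alternate X) \<longleftrightarrow> entire_growth X"
proof -
  have "\<bar>alternate X i j\<bar> = \<bar>X i j\<bar>" for i j by (simp add: alternate_def abs_mult)
  then show ?thesis by (simp add: entire_growth_def)
qed

lemma periodic_alternate: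
  assumes "periodic n X" shows "periodic n (alternate X)"
proof -
  have "even (i + int n + (j + int n)) \<longleftrightarrow> even (i + j)" for i j by simp
  then show ?thesis by (simp only: periodic_def alternate_def periodic_shift[OF assms] simp_thms)
qed

lemma periodic_unitri_inv:
  assumes "periodic n X" shows "periodic n (unitri_inv X)"
proof -
  have "unitri_inv X (i + int n) (j + int n) = unitri_inv X i j" for i j
  proof (induction "nat (j - i)" arbitrary: j rule: less_induct)
    case less
    have "(\<Sum>k\<in>{i + int n..<j + int n}. unitri_inv X (i + int n) k * X k (j + int n)) = (\<Sum>k\<in>{i..<j}. unitri_inv X i k * X k j)"
    proof (rule sum.reindex_bij_witness[of _ "\<lambda>k. k + int n" "\<lambda>k. k - int n"])
      fix k assume "k \<in> {i + int n..<j + int n}"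
      then show "unitri_inv X i (k - int n) * X (k - int n) j = unitri_inv X (i + int n) k * X k (j + int n)"
        using less[of "k - int n"] periodic_shift[OF assms, of "k - int n" j] by simp
    qed auto
    then show ?case unfolding unitri_inv.simps[of X "i + int n" "j + int n"] unitri_inv.simps[of X i j] by simp
  qed
  then show ?thesis by (simp add: periodic_def)
qed

lemma U_tnn_dual: "U_tnn n X \<Longrightarrow> U_tnn n (dual X)"
  by (simp add: U_tnn_def unitri_dual dual_tnn) (simp add: dual_def periodic_alternate periodic_unitri_inv)

lemma doubly_entire_iff:
  assumes n: "n \<ge> 1" and Y: "U_tnn n Y"
  shows "doubly_entire n Y \<longleftrightarrow> entire_growth Y \<and> entire_growth (dual Y)"
proof -
  have u: "unitri (unitri_inv Y)" "periodic n (unitri_inv Y)" using unitri_unitri_inv periodic_unitri_inv[OF U_tnnD(2)[OF Y]] by auto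
  have d: "entire_growth (dual Y) \<longleftrightarrow> entire n (unitri_inv Y)"
    by (simp add: dual_def entire_growth_alternate entire_iff[OF n u])
  have "X' = unitri_inv Y" if "X' \<in> GL_unfolded n" "bi_mult X' Y = bi_id" for X'
    by (rule left_inverse_is_unitri_inv[OF U_tnnD(1)[OF Y] that(2) GL_row_bounded[OF n that(1)]])
  then have "(\<exists>X'\<in>GL_unfolded n. bi_mult Y X' = bi_id \<and> bi_mult X' Y = bi_id \<and> entire n X') \<longleftrightarrow> entire n (unitri_inv Y)"
    using unitri_periodic_GL[OF u n] unitri_inv_left[OF U_tnnD(1)[OF Y]] unitri_inv_right[OF U_tnnD(1)[OF Y]] by blast
  then show ?thesis
    unfolding doubly_entire_def entire_iff[OF n U_tnnD(1,2)[OF Y]] d by simp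
qed

section \<open>Products of curls and whirls with summable parameters\<close>

lemma cyc_mem: "n \<ge> 1 \<Longrightarrow> cyc n k \<in> {1..n}"
  by (auto simp: cyc_def nat_less_iff Suc_le_eq)

lemma cyc_period: "cyc n (k + int n) = cyc n k"
proof -
  have "k + int n - 1 = (k - 1) + int n" by simp
  then show ?thesis by (simp only: cyc_def mod_add_self2)
qed

lemma period_cyc:
  assumes n: "n \<ge> 1" and per: "\<And>i. f (i + int n) = f i"
  shows "f (int (cyc n k)) = f k"
proof -
  have "int (cyc n k) = (k - 1) mod int n + 1" using n by (simp add: cyc_def)
  also have "\<dots> = k + (- ((k - 1) div int n)) * int n"
    using div_mult_mod_eq[of "k - 1" "int n"] by (simp add: algebra_simps)
  finally have "int (cyc n k) = k + (- ((k - 1) div int n)) * int n" .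
  then show ?thesis by (simp only:) (rule period_multiple, rule per)
qed

lemma curl_icurl: "curl n a = icurl (\<lambda>k. a (cyc n k))"
  by (simp add: curl_def icurl_def)

lemma whirl_iwhirl: "whirl n a = iwhirl (\<lambda>k. a (cyc n k))"
  by (simp add: whirl_def iwhirl_def fun_eq_iff)

lemma dual_id: "dual bi_id = bi_id"
  by (simp add: dual_def unitri_inv_unique[OF unitri_bi_id unitri_bi_id])

lemma right_partial_prod_curl_prod:
  assumes "\<And>k. F (Suc k) = icurl (\<alpha> k)"
  shows "right_partial_prod F k = curl_prod \<alpha> k"
  by (induction k) (simp_all add: assms)

lemma left_partial_prod_curl_prod:
  assumes "\<And>k. F (- int (Suc k)) = iwhirl (\<beta> k)"
  shows "left_partial_prod F k = dual (curl_prod \<beta> k)"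
  by (induction k) (simp_all add: dual_id dual_mult unitri_curl_prod unitri_icurl dual_icurl assms del: of_nat_Suc)

lemma curl_prod_superdiagonal: "curl_prod a k i (i + 1) = (\<Sum>l<k. a l i)"
proof (induction k)
  case (Suc k)
  have "{i..i + 1} = {i, i + 1}" by auto
  then have "curl_prod a (Suc k) i (i + 1) = curl_prod a k i i * icurl (a k) i (i + 1) + curl_prod a k i (i + 1) * icurl (a k) (i + 1) (i + 1)"
    by (simp add: bi_mult_unitri[OF unitri_curl_prod unitri_icurl])
  also have "icurl (a k) i (i + 1) = a k i" using icurl_step[of i i "a k"] unitriD(1)[OF unitri_icurl] by simp
  finally show ?case by (simp add: Suc unitriD(1)[OF unitri_curl_prod] unitriD(1)[OF unitri_icurl])
qed (simp add: bi_id_def)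

text \<open>
  Multiplication by a whirl with parameters at most \<open>s l\<close> changes the weighted bound by the factor
  \<open>1 + \<rho> * s l\<close>, which is at most \<open>exp (\<rho> * s l)\<close>. So a product of whirls with summable parameters stays
  entire after multiplication by an entire matrix.
\<close>

lemma growth_mult_whirls:
  assumes A: "unitri A" "\<And>i m. \<bar>A i (i + int m)\<bar> * \<rho> ^ m \<le> C" and \<rho>: "0 < \<rho>"
    and b: "\<And>l i. 0 \<le> b l i" "\<And>l i. b l i \<le> s l"
  shows "\<bar>bi_mult A (dual (curl_prod b k)) i (i + int m)\<bar> * \<rho> ^ m \<le> C * exp (\<rho> * (\<Sum>l<k. s l))"
  using A
proof (induction k arbitrary: A C i m)
  case 0
  then show ?case by (simp add: dual_id)
next
  case (Suc k)
  let ?A = "bi_mult A (iwhirl (b k))"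
  have uA: "unitri ?A" by (rule unitri_mult[OF Suc.prems(1) unitri_iwhirl])
  have C0: "0 \<le> C" by (rule order_trans[OF _ Suc.prems(2)[of 0 0]]) simp
  have "\<bar>?A i (i + int m)\<bar> * \<rho> ^ m \<le> C * (1 + \<rho> * s k)" for i m
  proof (cases m)
    case 0
    have "1 \<le> C" using Suc.prems(2)[of i 0] unitriD(1)[OF Suc.prems(1)] by simp
    also have "C * 1 \<le> C * (1 + \<rho> * s k)"
      by (rule mult_left_mono) (use C0 \<rho> b order_trans[OF b(1) b(2)] in auto)
    then have "C \<le> C * (1 + \<rho> * s k)" by (simp only: mult_1_right)
    finally show ?thesis using unitriD(1)[OF uA] 0 by simp
  next
    case (Suc m')
    have "\<bar>?A i (i + int m)\<bar> \<le> \<bar>A i (i + int m)\<bar> + \<bar>A i (i + int m')\<bar> * s k"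
    proof -
      have "?A i (i + int m) = A i (i + int m) + A i (i + int m') * b k (i + int m')"
        by (simp add: mult_iwhirl Suc)
      then have "\<bar>?A i (i + int m)\<bar> \<le> \<bar>A i (i + int m)\<bar> + \<bar>A i (i + int m')\<bar> * b k (i + int m')"
        using b(1) by (metis abs_mult abs_of_nonneg abs_triangle_ineq)
      also have "\<bar>A i (i + int m')\<bar> * b k (i + int m') \<le> \<bar>A i (i + int m')\<bar> * s k"
        by (rule mult_left_mono[OF b(2)]) simp
      finally show ?thesis by simp
    qed
    then have "\<bar>?A i (i + int m)\<bar> * \<rho> ^ m \<le> (\<bar>A i (i + int m)\<bar> + \<bar>A i (i + int m')\<bar> * s k) * \<rho> ^ m"
      by (rule mult_right_mono) (use \<rho> in simp)
    also have "\<dots> = \<bar>A i (i + int m)\<bar> * \<rho> ^ m + (\<bar>A i (i + int m')\<bar> * \<rho> ^ m') * (\<rho> * s k)"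
      by (simp add: Suc algebra_simps)
    also have "\<dots> \<le> C + C * (\<rho> * s k)"
      by (intro add_mono mult_right_mono Suc.prems(2)) (use \<rho> order_trans[OF b(1) b(2)] in auto)
    finally show ?thesis by (simp add: algebra_simps)
  qed
  from Suc.IH[OF uA this]
  have "\<bar>bi_mult ?A (dual (curl_prod b k)) i (i + int m)\<bar> * \<rho> ^ m \<le> C * (1 + \<rho> * s k) * exp (\<rho> * (\<Sum>l<k. s l))" .
  also have "\<dots> \<le> C * exp (\<rho> * s k) * exp (\<rho> * (\<Sum>l<k. s l))"
    by (intro mult_right_mono mult_left_mono exp_ge_add_one_self) (use C0 in auto)
  also have "\<dots> = C * exp (\<rho> * (\<Sum>l<Suc k. s l))" by (simp add: exp_add[symmetric] algebra_simps)
  also have "bi_mult ?A (dual (curl_prod b k)) = bi_mult A (dual (curl_prod b (Suc k)))"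
    by (simp add: dual_mult unitri_curl_prod unitri_icurl dual_icurl bi_mult_assoc Suc.prems(1) unitri_iwhirl unitri_dual)
  finally show ?case .
qed

text \<open>
  The index \<open>i\<close> runs over positive or over negative integers; \<open>e\<close> translates it to the number of the
  stripping step.
\<close>

lemma summable_params:
  fixes f :: "'i \<Rightarrow> nat \<Rightarrow> real"
  assumes e: "inj_on e I" and f: "\<And>i j. i \<in> I \<Longrightarrow> j \<in> J \<Longrightarrow> f i j = g (e i) j" and J: "finite J"
    and g: "\<And>k j. 0 \<le> g k j" "\<And>K j. (\<Sum>k<(K::nat). g k j) \<le> B j"
  shows "(\<lambda>(i, j). f i j) summable_on (I \<times> J)"
proof (rule nonneg_bounded_partial_sums_imp_summable_on)
  show "0 \<le> (case x of (i, j) \<Rightarrow> f i j)" if "x \<in> I \<times> J" for x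
    using that f g(1) by auto
  show "\<forall>\<^sub>F F in finite_subsets_at_top (I \<times> J). (\<Sum>(i, j)\<in>F. f i j) \<le> (\<Sum>j\<in>J. B j)"
  proof (rule eventually_finite_subsets_at_top_weakI)
    fix F assume F: "finite F" "F \<subseteq> I \<times> J"
    define h where "h = (\<lambda>(i, j::nat). (e i, j))"
    have "inj_on h (I \<times> J)"
      unfolding h_def by (rule inj_onI) (auto dest: inj_onD[OF e])
    then have inj: "inj_on h F" using F(2) by (rule inj_on_subset)
    have "finite (fst ` h ` F)" using F(1) by simp
    then obtain K where "\<forall>k\<in>fst ` h ` F. k < K" unfolding finite_nat_set_iff_bounded by (rule exE)
    then have K: "fst x < K" if "x \<in> h ` F" for x using that by blast
    have "(\<Sum>(i, j)\<in>F. f i j) = (\<Sum>x\<in>F. (case h x of (k, j) \<Rightarrow> g k j))"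
      by (rule sum.cong) (use F(2) f in \<open>auto simp: h_def\<close>)
    also have "\<dots> = (\<Sum>(k, j)\<in>h ` F. g k j)" by (subst sum.reindex[OF inj]) simp
    also have "\<dots> \<le> (\<Sum>(k, j)\<in>{..<K} \<times> J. g k j)"
    proof (rule sum_mono2)
      show "h ` F \<subseteq> {..<K} \<times> J"
      proof
        fix x assume x: "x \<in> h ` F"
        then obtain i j where "(i, j) \<in> F" "x = (e i, j)" by (auto simp: h_def)
        then show "x \<in> {..<K} \<times> J" using K[OF x] F(2) by auto
      qed
      show "0 \<le> (case x of (k, j) \<Rightarrow> g k j)" for x using g(1) by (cases x) simp
    qed (use J in simp)
    also have "\<dots> = (\<Sum>j\<in>J. \<Sum>k<K. g k j)"
      by (subst sum.swap) (simp add: sum.cartesian_product)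
    also have "\<dots> \<le> (\<Sum>j\<in>J. B j)" by (intro sum_mono g(2))
    finally show "(\<Sum>(i, j)\<in>F. f i j) \<le> (\<Sum>j\<in>J. B j)" .
  qed
qed

lemma stripped_params:
  assumes n: "n \<ge> 1" and X: "U_tnn n X"
  defines "\<alpha> \<equiv> \<lambda>k. curl_params (stripped X k)"
  shows "icurl (\<lambda>i. \<alpha> k (int (cyc n i))) = icurl (\<alpha> k)"
    and "iwhirl (\<lambda>i. \<alpha> k (int (cyc n i))) = iwhirl (\<alpha> k)"
    and "(\<forall>i. 0 < \<alpha> k i) \<or> (\<forall>i. \<alpha> k i = 0)"
    and "0 \<le> \<alpha> k i"
proof -
  have "\<alpha> k (int (cyc n i)) = \<alpha> k i" for i
    unfolding \<alpha>_def by (rule period_cyc[OF n]) (rule curl_params_period[OF U_tnnD(2)[OF U_tnn_stripped[OF n X]]])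
  then show "icurl (\<lambda>i. \<alpha> k (int (cyc n i))) = icurl (\<alpha> k)"
    "iwhirl (\<lambda>i. \<alpha> k (int (cyc n i))) = iwhirl (\<alpha> k)" by simp_all
  show "(\<forall>i. 0 < \<alpha> k i) \<or> (\<forall>i. \<alpha> k i = 0)"
  proof (cases "entire_growth (stripped X k)")
    case True
    then show ?thesis by (simp add: \<alpha>_def curl_params_def)
  next
    case False
    then show ?thesis using ratio_limit_pos[OF n U_tnn_stripped[OF n X] False] by (simp add: \<alpha>_def curl_params_def)
  qed
  show "0 \<le> \<alpha> k i" unfolding \<alpha>_def by (rule curl_params_nonneg[OF U_tnn_stripped[OF n X]])
qed

lemma iwhirl_zero: "(\<And>i. a i = 0) \<Longrightarrow> iwhirl a = bi_id"
  by (auto simp: iwhirl_def bi_id_def fun_eq_iff)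

section \<open>Existence and uniqueness of the factorization\<close>

lemma factorization_exists:
  assumes n: "n \<ge> 1" and X: "U_tnn n X"
  shows "\<exists>Z Y W. curl_whirl_factorization n X Z Y W"
proof -
  define Q where "Q = curl_free_part X"
  define Z where "Z = bi_mult X (unitri_inv Q)"
  define V where "V = dual Q"
  define R where "R = curl_free_part V"
  define P where "P = bi_mult V (unitri_inv R)"
  define \<alpha> where "\<alpha> k = curl_params (stripped X k)" for k
  define \<beta> where "\<beta> k = curl_params (stripped V k)" for k
  have Q: "U_tnn n Q" "entire_growth Q" unfolding Q_def by (rule U_tnn_curl_free_part[OF n X], rule entire_curl_free_part[OF n X])
  have V: "U_tnn n V" unfolding V_def by (rule U_tnn_dual[OF Q(1)])
  have R: "U_tnn n R" "entire_growth R" unfolding R_def by (rule U_tnn_curl_free_part[OF n V], rule entire_curl_free_part[OF n V])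
  have Zlim: "entrywise_lim (curl_prod \<alpha>) Z"
    using curl_prod_curl_params_lim[OF n X] by (simp add: \<alpha>_def[abs_def] Z_def Q_def)
  have Plim: "entrywise_lim (curl_prod \<beta>) P"
    using curl_prod_curl_params_lim[OF n V] by (simp add: \<beta>_def[abs_def] P_def R_def)
  have P: "U_tnn n P"
    by (rule U_tnn_lim[OF U_tnn_curl_prod Plim])
      (auto simp: \<beta>_def curl_params_period[OF U_tnnD(2)[OF U_tnn_stripped[OF n V]]] curl_params_nonneg[OF U_tnn_stripped[OF n V]])
  define Y where "Y = dual R"
  define W where "W = dual P"
  have Y: "U_tnn n Y" unfolding Y_def by (rule U_tnn_dual[OF R(1)])
  have W: "U_tnn n W" unfolding W_def by (rule U_tnn_dual[OF P])
  have utZ: "unitri Z" unfolding Z_def by (rule unitri_mult[OF U_tnnD(1)[OF X] unitri_unitri_inv])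
  have PR: "bi_mult P R = V"
    by (simp add: P_def bi_mult_assoc U_tnnD(1)[OF V] U_tnnD(1)[OF R(1)] unitri_unitri_inv unitri_inv_left)
  have QYW: "Q = bi_mult Y W"
    using dual_mult[OF U_tnnD(1)[OF P] U_tnnD(1)[OF R(1)]] dual_dual[OF U_tnnD(1)[OF Q(1)]]
    by (simp add: PR Y_def W_def V_def)
  have "bi_mult Z Q = X"
    by (simp add: Z_def bi_mult_assoc U_tnnD(1)[OF X] U_tnnD(1)[OF Q(1)] unitri_unitri_inv unitri_inv_left)
  then have fact: "X = bi_mult (bi_mult Z Y) W"
    by (simp add: QYW bi_mult_assoc utZ U_tnnD(1)[OF Y] U_tnnD(1)[OF W])
  have "entire_growth Y"
  proof (rule entire_growth_mono[OF _ Q(2)])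
    fix i j show "\<bar>Y i j\<bar> \<le> \<bar>Q i j\<bar>"
      using mult_ge_left[OF U_tnnD(1)[OF Y] U_tnn_nonneg[OF Y] W, of i j] U_tnn_nonneg[OF Y, of i j]
      by (simp add: QYW)
  qed
  moreover have "dual Y = R" unfolding Y_def by (rule dual_dual[OF U_tnnD(1)[OF R(1)]])
  ultimately have de: "doubly_entire n Y" using doubly_entire_iff[OF n Y] R(2) by simp
  \<comment> \<open>Stripping steps are counted from 0, the factors of the two products from 1 and from -1.\<close>
  define a where "a i j = \<alpha> (i - 1) (int j)" for i j :: nat
  define b where "b i j = \<beta> (nat (- i) - 1) (int j)" for i :: int and j :: nat
  note pX = stripped_params[OF n X, folded \<alpha>_def] and pV = stripped_params[OF n V, folded \<beta>_def]
  have ca: "curl n (a i) = icurl (\<alpha> (i - 1))" for i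
    by (simp add: curl_icurl a_def pX(1))
  have wb: "whirl n (b i) = iwhirl (\<beta> (nat (- i) - 1))" for i
    by (simp add: whirl_iwhirl b_def pV(2))
  have nda: "nondegenerate n (a i) \<or> curl n (a i) = bi_id" for i
    using pX(3)[of "i - 1"] by (auto simp: nondegenerate_def a_def ca intro!: icurl_zero)
  have ndb: "nondegenerate n (b i) \<or> whirl n (b i) = bi_id" for i
    using pV(3)[of "nat (- i) - 1"] by (auto simp: nondegenerate_def b_def wb intro!: iwhirl_zero)
  have ra: "is_right_inf_prod (\<lambda>i. curl n (a i)) Z"
  proof -
    have "right_partial_prod (\<lambda>i. curl n (a i)) = curl_prod \<alpha>"
      by (rule ext, rule right_partial_prod_curl_prod) (simp add: ca)
    then show ?thesis using Zlim by (simp add: is_right_inf_prod_def)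
  qed
  have lb: "is_left_inf_prod (\<lambda>i. whirl n (b i)) W"
  proof -
    have "left_partial_prod (\<lambda>i. whirl n (b i)) = (\<lambda>k. dual (curl_prod \<beta> k))"
      by (rule ext, rule left_partial_prod_curl_prod) (simp add: wb del: of_nat_Suc)
    then show ?thesis using dual_lim[OF Plim] by (simp add: is_left_inf_prod_def W_def)
  qed
  have sa: "(\<lambda>(i, j). a i j) summable_on ({1..} \<times> {1..n})"
    by (rule summable_params[of "\<lambda>i. i - 1" _ _ _ "\<lambda>k j. \<alpha> k (int j)" "\<lambda>j. X (int j) (int j + 1)"])
      (use pX(4) curl_params_sum_le[OF n X] in \<open>auto simp: inj_on_def a_def \<alpha>_def\<close>)
  have sb: "(\<lambda>(i, j). b i j) summable_on ({..-1} \<times> {1..n})"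
    by (rule summable_params[of "\<lambda>i. nat (- i) - 1" _ _ _ "\<lambda>k j. \<beta> k (int j)" "\<lambda>j. V (int j) (int j + 1)"])
      (use pV(4) curl_params_sum_le[OF n V] in \<open>auto simp: inj_on_def b_def \<beta>_def\<close>)
  have nonneg: "0 \<le> a i j" "0 \<le> b i' j" for i i' j
    using pX(4) pV(4) by (auto simp: a_def b_def)
  have "curl_whirl_factorization n X Z Y W"
    unfolding curl_whirl_factorization_def
    using fact U_nonneg_iff[OF n] Y de nonneg nda ndb sa sb ra lb by blast
  then show ?thesis by blast
qed

text \<open>
  The factors are recovered from \<open>X\<close> by taking curl-free parts, first of \<open>X\<close> and then of the dual of \<open>Y W\<close>.
  For this \<open>Y W\<close> has to be entire, which uses that the whirl parameters are summable: their partial sums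
  are superdiagonal entries of partial products, which converge.
\<close>

lemma factorization_determined:
  assumes n: "n \<ge> 1" and X: "U_tnn n X" and f: "curl_whirl_factorization n X Z Y W"
  shows "Y = dual (curl_free_part (dual (curl_free_part X)))" "W = bi_mult (unitri_inv Y) (curl_free_part X)" "Z = bi_mult X (unitri_inv (curl_free_part X))"
proof -
  from f obtain a :: "nat \<Rightarrow> nat \<Rightarrow> real" and b :: "int \<Rightarrow> nat \<Rightarrow> real" where
    fact: "X = bi_mult (bi_mult Z Y) W" and YU: "Y \<in> U_nonneg n" and de: "doubly_entire n Y"
    and nda: "\<forall>i\<ge>1. nondegenerate n (a i) \<or> curl n (a i) = bi_id"
    and ndb: "\<forall>i\<le>-1. nondegenerate n (b i) \<or> whirl n (b i) = bi_id"
    and ra: "is_right_inf_prod (\<lambda>i. curl n (a i)) Z" and lb: "is_left_inf_prod (\<lambda>i. whirl n (b i)) W"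
    unfolding curl_whirl_factorization_def by blast
  have Y: "U_tnn n Y" using YU U_nonneg_iff[OF n] by simp
  define \<alpha> where "\<alpha> k i = a (Suc k) (cyc n i)" for k i
  define \<beta> where "\<beta> k i = b (- int (Suc k)) (cyc n i)" for k i
  have per: "\<alpha> k (i + int n) = \<alpha> k i" "\<beta> k (i + int n) = \<beta> k i" for k i
    by (simp_all add: \<alpha>_def \<beta>_def cyc_period)
  have ap: "(\<forall>i. 0 < \<alpha> k i) \<or> (\<forall>i. \<alpha> k i = 0)" for k
  proof -
    consider "nondegenerate n (a (Suc k))" | "curl n (a (Suc k)) = bi_id" using nda by force
    then show ?thesis
    proof cases
      case 1
      then show ?thesis using cyc_mem[OF n] by (simp add: nondegenerate_def \<alpha>_def)
    next
      case 2
      have "\<alpha> k i = curl n (a (Suc k)) i (i + 1)" for i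
        using icurl_step[of i i] unitriD(1)[OF unitri_icurl] by (simp add: curl_icurl \<alpha>_def)
      then show ?thesis using 2 by (simp add: bi_id_def)
    qed
  qed
  have bp: "(\<forall>i. 0 < \<beta> k i) \<or> (\<forall>i. \<beta> k i = 0)" for k
  proof -
    have le: "- int (Suc k) \<le> - 1" by simp
    consider "nondegenerate n (b (- int (Suc k)))" | "whirl n (b (- int (Suc k))) = bi_id"
      using ndb[rule_format, OF le] by blast
    then show ?thesis
    proof cases
      case 1
      then show ?thesis using cyc_mem[OF n] by (simp add: nondegenerate_def \<beta>_def)
    next
      case 2
      have "\<beta> k i = whirl n (b (- int (Suc k))) i (i + 1)" for i
        by (simp add: whirl_iwhirl iwhirl_def \<beta>_def)
      then show ?thesis using 2 by (simp add: bi_id_def)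
    qed
  qed
  have b0: "0 \<le> \<beta> k i" for k i using bp[of k] by (auto simp: less_imp_le)
  have Zlim: "entrywise_lim (curl_prod \<alpha>) Z"
  proof -
    have "right_partial_prod (\<lambda>i. curl n (a i)) = curl_prod \<alpha>"
      by (rule ext, rule right_partial_prod_curl_prod) (simp add: curl_icurl \<alpha>_def[abs_def])
    then show ?thesis using ra by (simp add: is_right_inf_prod_def)
  qed
  have Wlim: "entrywise_lim (\<lambda>k. dual (curl_prod \<beta> k)) W"
  proof -
    have "left_partial_prod (\<lambda>i. whirl n (b i)) = (\<lambda>k. dual (curl_prod \<beta> k))"
      by (rule ext, rule left_partial_prod_curl_prod) (simp add: whirl_iwhirl \<beta>_def[abs_def])
    then show ?thesis using lb by (simp add: is_left_inf_prod_def)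
  qed
  have utW: "unitri W" by (rule unitri_lim[OF unitri_dual Wlim])
  have Plim: "entrywise_lim (curl_prod \<beta>) (dual W)"
    using dual_lim[OF Wlim] by (simp add: dual_dual[OF unitri_curl_prod])
  have Z: "U_tnn n Z" by (rule curl_free_part_curl_prod_lim(1)[OF n per(1) ap Zlim])
  define Q where "Q = bi_mult Y W"
  have utQ: "unitri Q" unfolding Q_def by (rule unitri_mult[OF U_tnnD(1)[OF Y] utW])
  have dQ: "dual Q = bi_mult (dual W) (dual Y)" unfolding Q_def by (rule dual_mult[OF U_tnnD(1)[OF Y] utW])
  have udY: "U_tnn n (dual Y)" by (rule U_tnn_dual[OF Y])
  have "U_tnn n (dual Q)"
    unfolding dQ
  proof (rule U_tnn_lim)
    show "U_tnn n (bi_mult (curl_prod \<beta> k) (dual Y))" for k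
      by (rule U_tnn_curl_prod_mult[OF udY]) (use per b0 in auto)
    show "entrywise_lim (\<lambda>k. bi_mult (curl_prod \<beta> k) (dual Y)) (bi_mult (dual W) (dual Y))"
      by (rule bi_mult_lim[OF _ _ _ _ Plim entrywise_lim_const]) (auto simp: unitri_curl_prod unitri_dual)
  qed
  note udQ = this
  have uQ: "U_tnn n Q" using U_tnn_dual[OF udQ] by (simp add: dual_dual[OF utQ])
  have de': "entire_growth Y" "entire_growth (dual Y)" using de doubly_entire_iff[OF n Y] by auto
  have eQ: "entire_growth Q"
    unfolding entire_growth_def
  proof (intro allI impI)
    fix \<rho> :: real assume \<rho>: "0 < \<rho>"
    obtain C where C: "\<And>i m. \<bar>Y i (i + int m)\<bar> * \<rho> ^ m \<le> C"
      using de'(1) \<rho> unfolding entire_growth_def by meson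
    have C0: "0 \<le> C" by (rule order_trans[OF _ C[of 0 0]]) simp
    define s where "s l = (\<Sum>j\<in>{1..n}. \<beta> l (int j))" for l
    define B where "B = (\<Sum>j\<in>{1..n}. dual W (int j) (int j + 1))"
    have bs: "\<beta> l i \<le> s l" for l i
    proof -
      have "\<beta> l i = \<beta> l (int (cyc n i))" by (rule period_cyc[symmetric, OF n]) (rule per(2))
      also have "\<dots> \<le> s l" unfolding s_def
        by (rule member_le_sum[of "cyc n i" "{1..n}" "\<lambda>j. \<beta> l (int j)"]) (use cyc_mem[OF n] b0 in auto)
      finally show ?thesis .
    qed
    have sB: "(\<Sum>l<k. s l) \<le> B" for k
    proof -
      have "(\<Sum>l<k. \<beta> l i) \<le> dual W i (i + 1)" for i
      proof (rule LIMSEQ_le_const)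
        show "(\<lambda>m. curl_prod \<beta> m i (i + 1)) \<longlonglongrightarrow> dual W i (i + 1)" using Plim by (simp add: entrywise_lim_def)
        show "\<exists>N. \<forall>m\<ge>N. (\<Sum>l<k. \<beta> l i) \<le> curl_prod \<beta> m i (i + 1)"
          unfolding curl_prod_superdiagonal by (intro exI[of _ k] allI impI sum_mono2) (use b0 in auto)
      qed
      then show ?thesis unfolding s_def B_def by (subst sum.swap) (intro sum_mono)
    qed
    have bound: "\<bar>Q i (i + int m)\<bar> * \<rho> ^ m \<le> C * exp (\<rho> * B)" for i m
    proof (rule LIMSEQ_le_const2)
      have "entrywise_lim (\<lambda>k. bi_mult Y (dual (curl_prod \<beta> k))) Q"
        unfolding Q_def
        by (rule bi_mult_lim[OF _ _ _ _ entrywise_lim_const Wlim]) (auto simp: unitri_dual U_tnnD(1)[OF Y] utW)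
      then show "(\<lambda>k. \<bar>bi_mult Y (dual (curl_prod \<beta> k)) i (i + int m)\<bar> * \<rho> ^ m) \<longlonglongrightarrow> \<bar>Q i (i + int m)\<bar> * \<rho> ^ m"
        by (intro tendsto_intros) (simp add: entrywise_lim_def)
      have "\<bar>bi_mult Y (dual (curl_prod \<beta> k)) i (i + int m)\<bar> * \<rho> ^ m \<le> C * exp (\<rho> * (\<Sum>l<k. s l))" for k
        by (rule growth_mult_whirls[OF U_tnnD(1)[OF Y] C \<rho> b0 bs])
      moreover have "C * exp (\<rho> * (\<Sum>l<k. s l)) \<le> C * exp (\<rho> * B)" for k
        using sB[of k] C0 \<rho> by (simp add: mult_left_mono)
      ultimately show "\<exists>N. \<forall>k\<ge>N. \<bar>bi_mult Y (dual (curl_prod \<beta> k)) i (i + int m)\<bar> * \<rho> ^ m \<le> C * exp (\<rho> * B)"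
        by (meson order_trans)
    qed
    then show "\<exists>C. \<forall>i m. \<bar>Q i (i + int m)\<bar> * \<rho> ^ m \<le> C" by blast
  qed
  have XQ: "X = bi_mult Z Q"
    by (simp add: fact Q_def bi_mult_assoc U_tnnD(1)[OF Z] U_tnnD(1)[OF Y] utW)
  have cX: "curl_free_part X = Q"
    using curl_free_part_unique[OF n _ uQ eQ per(1) ap Zlim] X by (simp add: XQ)
  have "dual Y = curl_free_part (dual Q)"
    using curl_free_part_unique[OF n _ udY de'(2) per(2) bp Plim] udQ by (simp add: dQ)
  then show "Y = dual (curl_free_part (dual (curl_free_part X)))"
    using dual_dual[OF U_tnnD(1)[OF Y]] by (simp add: cX)
  show "W = bi_mult (unitri_inv Y) (curl_free_part X)"
    unfolding cX Q_def by (rule cancel_left[OF U_tnnD(1)[OF Y] utW, symmetric])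
  show "Z = bi_mult X (unitri_inv (curl_free_part X))"
    unfolding cX by (subst XQ) (rule cancel_right[OF U_tnnD(1)[OF Z] utQ, symmetric])
qed

theorem theorem8p3:
  fixes n :: nat and X :: bimat
  assumes "n \<ge> 1" and "X \<in> U_nonneg n"
  shows "(\<exists>Z Y W. curl_whirl_factorization n X Z Y W) \<and>
         (\<forall>Z Y W Z' Y' W'.
            curl_whirl_factorization n X Z Y W \<longrightarrow>
            curl_whirl_factorization n X Z' Y' W' \<longrightarrow>
            Z' = Z \<and> Y' = Y \<and> W' = W)"
proof (intro conjI allI impI)
  have X: "U_tnn n X" using assms U_nonneg_iff by simp
  show "\<exists>Z Y W. curl_whirl_factorization n X Z Y W" by (rule factorization_exists[OF assms(1) X])
  fix Z Y W Z' Y' W'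
  assume "curl_whirl_factorization n X Z Y W" "curl_whirl_factorization n X Z' Y' W'"
  note d = this[THEN factorization_determined(1)[OF assms(1) X]]
    this[THEN factorization_determined(2)[OF assms(1) X]] this[THEN factorization_determined(3)[OF assms(1) X]]
  show "Z' = Z" "Y' = Y" "W' = W" using d by simp_all
qed

end
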